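(* For every continuous homotopy $F:[0,1]^2\to\mathbb{H}$ with $F(0,0)=\mathbf 0$ there is a unique continuous lift $\widehat F:[0,1]^2\to\widehat{\mathbb{H}}$ with $\widehat F(0,0)=\mathbf 1$ such that $q\circ\widehat F=F$.
   Context: **Hawaiian Earring.** $\mathbb{H}=\bigcup_{i\in\mathbb N}C_i\subseteq\mathbb R^2$ with $C_i=\{(x,y)\in\mathbb{R}^2: x^2+(y-1/i)^2=1/i^2\}$, $i=1,2,3,\dots$, with the subspace topology and base point $\mathbf 0=(0,0)$. Let $l_i:[0,1]\to C_i$, $l_i(t)=((\sin 2\pi t)/i,(1-\cos 2\pi t)/i)$. **Words and Cayley tree.** Let $\mathcal W_n$ be the set of finite words over $\{a_1^{\pm1},\dots,a_n^{\pm1}\}$ and $\mathcal W=\bigcup_n\mathcal W_n$. For $w\in\mathcal W$, $w'$ is its complete free reduction and $|w|$ its length; $\mathbf 1$ denotes the empty word. Let $\Gamma$ be the directed Cayley graph of the free group on $\{a_1,a_2,\dots\}$: the vertex set $V$ is the set of reduced words, and there is a directed edge labeled $a_i$ from $u$ to $(ua_i)'$ for every $u\in V$, $i\in\mathbb N$. The underlying undirected graph is a tree. Fix a complete list $w_1,w_2,w_3,\dots$ of all non-empty words in $\mathcal W$. For each $j$ let $\widehat w_j=a_1a_2a_1a_2\cdots\in V$ be the word with letters alternating between $a_1$ and $a_2$ (starting with $a_1$) of length $|\widehat w_j|=2(|w_1|+\cdots+|w_{j-1}|)+3j+|w_j|$. **The graph $\widehat{\mathbb H}$.** Step 1: If $w_j=x_1x_2\cdots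 x_m$ with letters $x_i$, let $Z_j=\{(\widehat w_jx_1\cdots x_i)': 0\le i\le m\}$. Let $Z$ be the set of vertices of the infinite ray in $\Gamma$ starting at $\mathbf 1$ and following the edges $a_1,a_2,a_1,a_2,\dots$. Step 2: Let $n=n(j)\ge2$ be minimal with $w_j\in\mathcal W_n$. For $u\in Z_j$ and $1\le s\le n$ let $L_{u,s}=\{(ua_s^r)': r\in\mathbb Z\}$. Let $Y_j=Z_j\cup\bigcup_{u\in Z_j,\,1\le s\le n}L_{u,s}$ and $Y=Z\cup\bigcup_jY_j$. (The sets $Y_j$ are pairwise disjoint.) Step 3: Let $\Gamma_0=\Gamma$. Inductively, $\Gamma_j$ is obtained from $\Gamma_{j-1}$ by removing all vertices $v$ at edge-distance $1$ from $Y_j$, unless $v$ is connected to $Y_j$ by an edge labeled $a_1$ or $a_2$ (in either direction), along with all edges incident to $v$ and all vertices and edges of $\Gamma_{j-1}$ separated from $Y_j$ in $\Gamma_{j-1}$ by $v$. Each $\Gamma_j$ is a subtree containing $Y$. Step 4: $\Gamma^*$ is obtained from $\bigcap_j\Gamma_j$ by removing all vertices $v$ (and incident edges) of the reduced form $v=ua_k^{\pm1}w$, where $u$ is a vertex of $\bigcap_j\Gamma_j$ of infinite valence, $k\notin\{1,2\}$ and $w\in\mathcal W$. For every vertex $v$ of the tree $\Gamma^*$ there is a finite set $E_v\subseteq\mathbb N$ such that the directed edges of $\Gamma^*$ terminating at $v$ are labeled exactly by $\{a_i:i\in E_v\}$ (one each), and likewise for the directed edges emanating from $v$. Step 5: For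 every vertex $v$ of $\Gamma^*$ and every $i\in\mathbb N\setminus E_v$ add a directed loop from $v$ to $v$ labeled $a_i$. The geometric realization of the resulting graph is $\widehat{\mathbb H}$, with base point the vertex $\mathbf 1$. **The map $q$ and the topology of $\widehat{\mathbb H}$.** In $\mathbb H$ put $V_i^-=l_i([0,3/8))$, $V_i^+=l_i((5/8,1])$, $U_i=l_i((1/4,3/4))$ and $U_{n+1}^\infty=\bigcup_{i=1}^n(V_i^-\cup V_i^+)\cup\bigcup_{i\ge n+1}C_i$. For a directed edge (or loop) $e$ of $\widehat{\mathbb H}$ labeled $a_i$ with parametrization $\psi_e:[0,1]\to e$, put $V_e^-=\psi_e([0,3/8))$, $V_e^+=\psi_e((5/8,1])$, $U_e=\psi_e((1/4,3/4))$. The map $q:\widehat{\mathbb H}\to\mathbb H$ is given by $q(\psi_e(t))=l_i(t)$ for every edge or loop $e$ labeled $a_i$ (so vertices map to $\mathbf 0$). For a vertex $v$, with $n\ge2$ minimal such that $E_v\subseteq\{1,\dots,n\}$, let $U_v$ be the union of all $V_e^-$ with $e$ an edge or loop emanating from $v$, all $V_e^+$ with $e$ an edge or loop terminating at $v$, and all entire loops at $v$ labeled $a_i$ with $i>n$; $q$ restricts to bijections $U_e\to U_i$ and $U_v\to U_{n+1}^\infty$. $\widehat{\mathbb H}$ carries the unique topology making all $U_e$ and $U_v$ open and all the restrictions $q|_{U_e}:U_e\to U_i$ and $q|_{U_v}:U_v\to U_{n+1}^\infty$ homeomorphisms. *)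

theory Defs
  imports "HOL-Analysis.Analysis" "Graph_Theory.Digraph_Component"
begin

section \<open>The Hawaiian earring\<close>

definition circ :: "nat \<Rightarrow> (real \<times> real) set" where
  "circ i = {(x, y). x\<^sup>2 + (y - 1 / real i)\<^sup>2 = (1 / real i)\<^sup>2}"

definition hawaiian :: "(real \<times> real) set" where
  "hawaiian = (\<Union>i\<in>{1..}. circ i)"

definition loop_param :: "nat \<Rightarrow> real \<Rightarrow> real \<times> real" where
  "loop_param i t = (sin (2 * pi * t) / real i, (1 - cos (2 * pi * t)) / real i)"

definition V_minus :: "nat \<Rightarrow> (real \<times> real) set" where
  "V_minus i = loop_param i ` {0..<3/8}"

definition V_plus :: "nat \<Rightarrow> (real \<times> real) set" where
  "V_plus i = loop_param i ` {5/8<..1}"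

definition U_arc :: "nat \<Rightarrow> (real \<times> real) set" where
  "U_arc i = loop_param i ` {1/4<..<3/4}"

text \<open>\<open>U_inf m\<close> is the neighbourhood \<open>U\<^sub>m\<^sup>\<infinity>\<close> of the origin; it contains the circles with index at
  least \<open>m\<close> entirely.\<close>

definition U_inf :: "nat \<Rightarrow> (real \<times> real) set" where
  "U_inf m = (\<Union>i\<in>{1..<m}. V_minus i \<union> V_plus i) \<union> (\<Union>i\<in>{m..}. circ i)"


section \<open>Words and free reduction\<close>

text \<open>The letter \<open>(i, True)\<close> stands for \<open>a\<^sub>i\<close> and \<open>(i, False)\<close> for its inverse; indices start at 1.\<close>

type_synonym letter = "nat \<times> bool"
type_synonym word = "letter list"

definition inv_letter :: "letter \<Rightarrow> letter" where
  "inv_letter x = (fst x, \<not> snd x)"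

definition words_upto :: "nat \<Rightarrow> word set" where
  "words_upto n = lists ({1..n} \<times> UNIV)"

definition all_words :: "word set" where
  "all_words = (\<Union>n. words_upto n)"

definition reduced :: "word \<Rightarrow> bool" where
  "reduced v \<longleftrightarrow> (\<nexists>xs x ys. v = xs @ x # inv_letter x # ys)"

primrec freduce :: "word \<Rightarrow> word" where
  "freduce [] = []"
| "freduce (x # xs) =
    (case freduce xs of [] \<Rightarrow> [x] | y # ys \<Rightarrow> if y = inv_letter x then ys else x # y # ys)"

text \<open>\<open>freduce w\<close> is the complete free reduction of \<open>w\<close>: the only reduced word obtained from \<open>w\<close> by
  successively cancelling adjacent inverse letters (lemma \<open>freduce_iff\<close>).\<close>

inductive cancel :: "word \<Rightarrow> word \<Rightarrow> bool" where
  "cancel (xs @ x # inv_letter x # ys) (xs @ ys)"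

lemma inv_letter_inv_letter [simp]: "inv_letter (inv_letter x) = x"
  by (simp add: inv_letter_def)

lemma reduced_Nil [simp]: "reduced []"
  by (simp add: reduced_def)

lemma reduced_Cons:
  "reduced (x # xs) \<longleftrightarrow> reduced xs \<and> (case xs of [] \<Rightarrow> True | y # _ \<Rightarrow> y \<noteq> inv_letter x)"
proof -
  have "(\<exists>us z vs. x # xs = us @ z # inv_letter z # vs) \<longleftrightarrow>
      (\<exists>vs. xs = inv_letter x # vs) \<or> (\<exists>us z vs. xs = us @ z # inv_letter z # vs)"
    (is "?L \<longleftrightarrow> ?R")
  proof
    assume ?L
    then obtain us z vs where *: "x # xs = us @ z # inv_letter z # vs" by blast
    show ?R
    proof (cases us)
      case Nil
      with * show ?thesis by simp
    next
      case (Cons u us')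
      with * have "xs = us' @ z # inv_letter z # vs" by simp
      then show ?thesis by blast
    qed
  next
    assume ?R
    then show ?L
    proof
      assume "\<exists>vs. xs = inv_letter x # vs"
      then obtain vs where "x # xs = [] @ x # inv_letter x # vs" by auto
      then show ?L by blast
    next
      assume "\<exists>us z vs. xs = us @ z # inv_letter z # vs"
      then obtain us z vs where "x # xs = (x # us) @ z # inv_letter z # vs" by auto
      then show ?L by blast
    qed
  qed
  then have "reduced (x # xs) \<longleftrightarrow> reduced xs \<and> (\<nexists>vs. xs = inv_letter x # vs)"
    unfolding reduced_def by blast
  also have "(\<nexists>vs. xs = inv_letter x # vs) \<longleftrightarrow> (case xs of [] \<Rightarrow> True | y # _ \<Rightarrow> y \<noteq> inv_letter x)"
    by (cases xs) simp_all
  finally show ?thesis .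
qed

lemma reduced_freduce: "reduced (freduce w)"
proof (induction w)
  case (Cons x w)
  then show ?case
    by (cases "freduce w") (simp_all add: reduced_Cons)
qed simp

lemma freduce_reduced: "reduced w \<Longrightarrow> freduce w = w"
proof (induction w)
  case (Cons x w)
  then have "freduce w = w"
    by (simp add: reduced_Cons)
  with Cons.prems show ?case
    by (cases w) (simp_all add: reduced_Cons del: freduce.simps(2) add: freduce.simps(2)[of x])
qed simp

lemma cancel_Cons: "cancel v w \<Longrightarrow> cancel (x # v) (x # w)"
proof (induction rule: cancel.induct)
  case (1 xs y ys)
  show ?case
    using cancel.intros[of "x # xs" y ys] by simp
qed

lemma cancels_Cons: "cancel\<^sup>*\<^sup>* v w \<Longrightarrow> cancel\<^sup>*\<^sup>* (x # v) (x # w)"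
proof (induction rule: rtranclp_induct)
  case (step y z)
  then show ?case
    using cancel_Cons[of y z x] by (meson rtranclp.rtrancl_into_rtrancl)
qed simp

lemma cancels_freduce: "cancel\<^sup>*\<^sup>* w (freduce w)"
proof (induction w)
  case (Cons x w)
  have *: "cancel\<^sup>*\<^sup>* (x # w) (x # freduce w)"
    using Cons by (rule cancels_Cons)
  show ?case
  proof (cases "\<exists>ys. freduce w = inv_letter x # ys")
    case True
    then obtain ys where ys: "freduce w = inv_letter x # ys" by blast
    have "cancel (x # freduce w) ys"
      using cancel.intros[of "[]" x ys] ys by simp
    with * have "cancel\<^sup>*\<^sup>* (x # w) ys"
      by (rule rtranclp.rtrancl_into_rtrancl)
    with ys show ?thesis by simp
  next
    case False
    then have "freduce (x # w) = x # freduce w"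
      by (cases "freduce w") simp_all
    with * show ?thesis by simp
  qed
qed simp

lemma freduce_cancel: "cancel v w \<Longrightarrow> freduce v = freduce w"
proof (induction rule: cancel.induct)
  case (1 xs x ys)
  have "freduce (x # inv_letter x # ys) = freduce ys"
  proof (cases "freduce ys")
    case (Cons y zs)
    then show ?thesis
      using reduced_freduce[of ys] by (cases zs) (auto simp: reduced_Cons)
  qed simp
  then show ?case
    by (induction xs) simp_all
qed

lemma freduce_iff: "cancel\<^sup>*\<^sup>* w v \<and> reduced v \<longleftrightarrow> v = freduce w"
proof -
  have "cancel\<^sup>*\<^sup>* w v \<Longrightarrow> freduce w = freduce v"
    by (induction rule: rtranclp_induct) (simp_all add: freduce_cancel)
  then show ?thesis
    using reduced_freduce[of w] cancels_freduce[of w] freduce_reduced[of v] by auto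
qed


section \<open>The Cayley tree and the graph defining the cover\<close>

text \<open>The arc \<open>(u, i)\<close> is the edge labeled \<open>a\<^sub>i\<close> emanating from \<open>u\<close>.\<close>

type_synonym edge = "word \<times> nat"
type_synonym graph = "(word, edge) pre_digraph"

definition cayley :: graph where
  "cayley = \<lparr> verts = {v \<in> all_words. reduced v},
              arcs = {v \<in> all_words. reduced v} \<times> {1..},
              tail = fst,
              head = (\<lambda>(u, i). freduce (u @ [(i, True)])) \<rparr>"

definition gen_power :: "nat \<Rightarrow> int \<Rightarrow> word" where
  "gen_power s r = replicate (nat \<bar>r\<bar>) (s, 0 \<le> r)"

definition alternating :: "nat \<Rightarrow> word" where
  "alternating m = map (\<lambda>k. (if even k then 1 else 2, True)) [0..<m]"

definition Z_ray :: "word set" where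
  "Z_ray = range alternating"

definition joined :: "graph \<Rightarrow> edge \<Rightarrow> word \<Rightarrow> word set \<Rightarrow> bool" where
  "joined G e v S \<longleftrightarrow> (tail G e = v \<and> head G e \<in> S) \<or> (head G e = v \<and> tail G e \<in> S)"

text \<open>The vertices at edge-distance 1 from \<open>S\<close> that are not connected to \<open>S\<close> by an edge labeled
  \<open>a\<^sub>1\<close> or \<open>a\<^sub>2\<close>.\<close>

definition cut_verts :: "word set \<Rightarrow> graph \<Rightarrow> word set" where
  "cut_verts S G = {v \<in> verts G - S.
      (\<exists>e\<in>arcs G. joined G e v S) \<and> \<not> (\<exists>e\<in>arcs G. snd e \<in> {1, 2} \<and> joined G e v S)}"

definition separated :: "graph \<Rightarrow> word \<Rightarrow> word set \<Rightarrow> word set" where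
  "separated G v S = {x \<in> verts G - {v}.
      \<forall>y\<in>S. \<not> x \<rightarrow>\<^sup>*\<^bsub>with_proj (mk_symmetric (pre_digraph.del_vert G v))\<^esub> y}"

text \<open>An edge separated from \<open>S\<close> by \<open>v\<close> has an end point that is separated or equal to \<open>v\<close>, so it
  disappears from the induced subgraph.\<close>

definition prune :: "word set \<Rightarrow> graph \<Rightarrow> graph" where
  "prune S G = G \<restriction> (verts G - (\<Union>v\<in>cut_verts S G. insert v (separated G v S)))"

text \<open>The remaining graphs depend on the chosen list \<open>w 1, w 2, \<dots>\<close> of all non-empty words; the
  value \<open>w 0\<close> is never used.\<close>

definition w_hat :: "(nat \<Rightarrow> word) \<Rightarrow> nat \<Rightarrow> word" where
  "w_hat w j = alternating (2 * (\<Sum>k\<in>{1..<j}. length (w k)) + 3 * j + length (w j))"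

definition Z_set :: "(nat \<Rightarrow> word) \<Rightarrow> nat \<Rightarrow> word set" where
  "Z_set w j = {freduce (w_hat w j @ take i (w j)) |i. i \<le> length (w j)}"

definition n_of :: "(nat \<Rightarrow> word) \<Rightarrow> nat \<Rightarrow> nat" where
  "n_of w j = (LEAST n. 2 \<le> n \<and> w j \<in> words_upto n)"

definition L_line :: "word \<Rightarrow> nat \<Rightarrow> word set" where
  "L_line u s = {freduce (u @ gen_power s r) |r. True}"

definition Y_set :: "(nat \<Rightarrow> word) \<Rightarrow> nat \<Rightarrow> word set" where
  "Y_set w j = Z_set w j \<union> (\<Union>u\<in>Z_set w j. \<Union>s\<in>{1..n_of w j}. L_line u s)"

primrec Gamma :: "(nat \<Rightarrow> word) \<Rightarrow> nat \<Rightarrow> graph" where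
  "Gamma w 0 = cayley"
| "Gamma w (Suc j) = prune (Y_set w (Suc j)) (Gamma w j)"

definition Gamma_inf :: "(nat \<Rightarrow> word) \<Rightarrow> graph" where
  "Gamma_inf w = \<lparr> verts = (\<Inter>j. verts (Gamma w j)), arcs = (\<Inter>j. arcs (Gamma w j)),
                   tail = tail cayley, head = head cayley \<rparr>"

definition infinite_valence :: "graph \<Rightarrow> word \<Rightarrow> bool" where
  "infinite_valence G u \<longleftrightarrow> infinite (in_arcs G u \<union> out_arcs G u)"

text \<open>Vertices are reduced words, so \<open>v = u @ (k, b) # x\<close> below is an equality of reduced forms.\<close>

definition Gamma_star :: "(nat \<Rightarrow> word) \<Rightarrow> graph" where
  "Gamma_star w = Gamma_inf w \<restriction>
     {v \<in> verts (Gamma_inf w). \<not> (\<exists>u k b x. u \<in> verts (Gamma_inf w) \<and>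
        infinite_valence (Gamma_inf w) u \<and> k \<notin> {1, 2} \<and> v = u @ (k, b) # x)}"

text \<open>The set \<open>E\<^sub>v\<close> is read off from the edges emanating from \<open>v\<close>; the edges terminating at \<open>v\<close>
  carry the same labels.\<close>

definition E_labels :: "(nat \<Rightarrow> word) \<Rightarrow> word \<Rightarrow> nat set" where
  "E_labels w v = snd ` out_arcs (Gamma_star w) v"

definition hat_graph :: "(nat \<Rightarrow> word) \<Rightarrow> graph" where
  "hat_graph w =
    \<lparr> verts = verts (Gamma_star w),
      arcs = arcs (Gamma_star w) \<union> {(v, i). v \<in> verts (Gamma_star w) \<and> i \<in> {1..} - E_labels w v},
      tail = fst,
      head = (\<lambda>e. if e \<in> arcs (Gamma_star w) then head (Gamma_star w) e else fst e) \<rparr>"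


section \<open>The geometric realization, the map q and the topology\<close>

text \<open>A point of the geometric realization is either a vertex or a point \<open>Inner e t\<close>, with
  \<open>0 < t < 1\<close>, in the interior of an edge or loop \<open>e\<close>.\<close>

datatype point = Vertex word | Inner edge real

definition hat_space :: "(nat \<Rightarrow> word) \<Rightarrow> point set" where
  "hat_space w = Vertex ` verts (hat_graph w) \<union> {Inner e t |e t. e \<in> arcs (hat_graph w) \<and> 0 < t \<and> t < 1}"

definition edge_param :: "(nat \<Rightarrow> word) \<Rightarrow> edge \<Rightarrow> real \<Rightarrow> point" where
  "edge_param w e t =
    (if t = 0 then Vertex (tail (hat_graph w) e)
     else if t = 1 then Vertex (head (hat_graph w) e)
     else Inner e t)"

fun q :: "point \<Rightarrow> real \<times> real" where
  "q (Vertex v) = (0, 0)"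
| "q (Inner e t) = loop_param (snd e) t"

lemma q_edge_param: "q (edge_param w e t) = loop_param (snd e) t"
  by (simp add: edge_param_def loop_param_def)

definition U_edge :: "(nat \<Rightarrow> word) \<Rightarrow> edge \<Rightarrow> point set" where
  "U_edge w e = edge_param w e ` {1/4<..<3/4}"

definition n_vert :: "(nat \<Rightarrow> word) \<Rightarrow> word \<Rightarrow> nat" where
  "n_vert w v = (LEAST n. 2 \<le> n \<and> E_labels w v \<subseteq> {1..n})"

definition U_vert :: "(nat \<Rightarrow> word) \<Rightarrow> word \<Rightarrow> point set" where
  "U_vert w v =
     (\<Union>e\<in>out_arcs (hat_graph w) v. edge_param w e ` {0..<3/8}) \<union>
     (\<Union>e\<in>in_arcs (hat_graph w) v. edge_param w e ` {5/8<..1}) \<union>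
     (\<Union>e\<in>{e \<in> out_arcs (hat_graph w) v \<inter> in_arcs (hat_graph w) v. n_vert w v < snd e}.
        edge_param w e ` {0..1})"

definition is_hat_topology :: "(nat \<Rightarrow> word) \<Rightarrow> point topology \<Rightarrow> bool" where
  "is_hat_topology w T \<longleftrightarrow>
     topspace T = hat_space w \<and>
     (\<forall>e\<in>arcs (hat_graph w). openin T (U_edge w e) \<and>
        homeomorphic_map (subtopology T (U_edge w e)) (top_of_set (U_arc (snd e))) q) \<and>
     (\<forall>v\<in>verts (hat_graph w). openin T (U_vert w v) \<and>
        homeomorphic_map (subtopology T (U_vert w v)) (top_of_set (U_inf (n_vert w v + 1))) q)"

definition hat_topology :: "(nat \<Rightarrow> word) \<Rightarrow> point topology" where
  "hat_topology w = (THE T. is_hat_topology w T)"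

end

theory Submission
  imports Defs
begin

text \<open>
  In general \<open>q\<close> is not a covering map, because no neighbourhood of the origin is evenly covered:
  the chart at a vertex \<open>v\<close> covers \<open>U_inf (n + 1)\<close> where \<open>n\<close> depends on \<open>v\<close>. However, an edge of
  \<open>\<Gamma>\<^sup>*\<close> with a label other than \<open>a\<^sub>1\<close> and \<open>a\<^sub>2\<close> has both end points in the same \<open>Y\<^sub>j\<close>, and all labels
  at vertices of \<open>Y\<^sub>j\<close> are bounded. So \<open>n\<close> is bounded on every component of \<open>\<Gamma>\<^sup>*\<close> without the edges
  labeled \<open>a\<^sub>1\<close> and \<open>a\<^sub>2\<close>, and over \<open>U_inf 3\<close> the space is a disjoint union of genuine
  covering spaces, one for each component. Maps from rectangles therefore lift over \<open>U_inf 3\<close>, and they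
  lift over the arcs \<open>U_arc 1\<close> and \<open>U_arc 2\<close>; subdividing the square, they lift over the whole earring.
  Lifts are unique because \<open>q\<close> is locally injective and points of a fibre have disjoint neighbourhoods.

  The structure of \<open>\<Gamma>\<^sup>*\<close> comes from the fact that the \<open>Y\<^sub>j\<close> are connected, pairwise disjoint (they meet
  disjoint stretches of the ray \<open>Z\<close>), and invariant under exchanging \<open>v a\<^sub>k\<close> and \<open>v a\<^sub>k\<^sup>-\<^sup>1\<close> for \<open>v\<close> in \<open>Y\<^sub>j\<close>.
\<close>

section \<open>The Hawaiian earring\<close>

text \<open>The obstacle is that the sheets over the origin have no common size, so pulling back one
  open cover of the earring and taking a Lebesgue number does not suffice. The Lebesgue argument is
  therefore run twice. Lifting is stated relative to a part \<open>K\<close> of the space: inside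
  one \<open>component_cover C\<close> a single \<open>U_inf (n + 1)\<close> serves every vertex,
  and the arcs with labels 3 to \<open>n\<close> extend the lifting to \<open>U_inf 3\<close>. This
  set no longer mentions \<open>n\<close>, so different components can be combined.

  On the combinatorial side, graphs are traded for sets of reduced words: a subtree is a
  prefix-closed set, and what a vertex hides from the root is the set of its extensions. In this
  language the vertices of \<open>\<Gamma>\<^sup>*\<close> are the words in which every letter other
  than \<open>a\<^sub>1\<close>, \<open>a\<^sub>2\<close> and their inverses is read along an edge
  inside some \<open>Y\<^sub>j\<close>.\<close>

lemma loop_param_zero_one [simp]: "loop_param i 0 = (0, 0)" "loop_param i 1 = (0, 0)"
  by (simp_all add: loop_param_def)

text \<open>On the circle \<open>C\<^sub>i\<close>, \<open>x / y\<close> is the cotangent of \<open>\<pi> t\<close>, and \<open>x\<^sup>2 + y\<^sup>2 = 2 y / i\<close>. So the following two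
  functions recover \<open>t\<close> and \<open>i\<close> from \<open>loop_param i t\<close>, continuously away from the origin.\<close>

definition angle_param :: "real \<times> real \<Rightarrow> real" where
  "angle_param p = 1/2 - arctan (fst p / snd p) / pi"

definition circ_index :: "real \<times> real \<Rightarrow> real" where
  "circ_index p = 2 * snd p / ((fst p)\<^sup>2 + (snd p)\<^sup>2)"

lemma half_angle: "sin (2 * pi * t) = 2 * sin (pi * t) * cos (pi * t)"
  "1 - cos (2 * pi * t) = 2 * (sin (pi * t))\<^sup>2"
  using sin_double[of "pi * t"] cos_double_sin[of "pi * t"] by (simp_all add: mult.assoc)

lemma sin_pi_pos: "0 < t \<Longrightarrow> t < 1 \<Longrightarrow> 0 < sin (pi * t)"
  by (intro sin_gt_zero) auto

lemma angle_param_loop_param: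
  assumes "1 \<le> i" "0 < t" "t < 1"
  shows "angle_param (loop_param i t) = t"
proof -
  have s: "0 < sin (pi * t)" using assms sin_pi_pos by blast
  have "fst (loop_param i t) / snd (loop_param i t) = cos (pi * t) / sin (pi * t)"
    using s assms(1) by (simp add: loop_param_def half_angle power2_eq_square)
  also have "\<dots> = tan (pi / 2 - pi * t)"
    by (simp add: tan_def sin_diff cos_diff)
  finally have "arctan (fst (loop_param i t) / snd (loop_param i t)) = pi / 2 - pi * t"
    using assms by (simp add: arctan_tan)
  then show ?thesis
    by (simp add: angle_param_def field_simps)
qed

lemma circ_index_loop_param:
  assumes "1 \<le> i" "0 < t" "t < 1"
  shows "circ_index (loop_param i t) = real i"
proof -
  have s: "0 < sin (pi * t)" using assms sin_pi_pos by blast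
  have c: "(cos (pi * t))\<^sup>2 = 1 - (sin (pi * t))\<^sup>2" by (rule cos_squared_eq)
  have "(2 * x * y)\<^sup>2 + (2 * x\<^sup>2)\<^sup>2 = 4 * x\<^sup>2 * (y\<^sup>2 + x\<^sup>2)" for x y :: real
    by algebra
  then have "(fst (loop_param i t))\<^sup>2 + (snd (loop_param i t))\<^sup>2
     = 4 * (sin (pi * t))\<^sup>2 * ((cos (pi * t))\<^sup>2 + (sin (pi * t))\<^sup>2) / (real i)\<^sup>2"
    unfolding loop_param_def half_angle fst_conv snd_conv power_divide
      add_divide_distrib[symmetric] by simp
  then have "(fst (loop_param i t))\<^sup>2 + (snd (loop_param i t))\<^sup>2 = 4 * (sin (pi * t))\<^sup>2 / (real i)\<^sup>2"
    by simp
  then show ?thesis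
    using s assms(1) by (simp add: circ_index_def loop_param_def half_angle power2_eq_square)
qed

lemma loop_param_nonzero:
  assumes "1 \<le> i" "0 < t" "t < 1"
  shows "snd (loop_param i t) > 0" "loop_param i t \<noteq> (0, 0)"
proof -
  show "snd (loop_param i t) > 0"
    using sin_pi_pos[OF assms(2,3)] assms(1) by (simp add: loop_param_def half_angle)
  then show "loop_param i t \<noteq> (0, 0)" by auto
qed

lemma loop_param_eq_iff:
  assumes "1 \<le> i" "0 < t" "t < 1" "1 \<le> j" "0 < s" "s < 1"
  shows "loop_param i t = loop_param j s \<longleftrightarrow> i = j \<and> t = s"
  using circ_index_loop_param[OF assms(1-3)] circ_index_loop_param[OF assms(4-6)]
    angle_param_loop_param[OF assms(1-3)] angle_param_loop_param[OF assms(4-6)] by auto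

lemma circ_eq:
  assumes "1 \<le> i" shows "circ i = loop_param i ` {0..1}"
proof (intro set_eqI iffI)
  fix p assume "p \<in> loop_param i ` {0..1}"
  then obtain t where p: "p = loop_param i t" by blast
  have "(sin (2*pi*t) / real i)\<^sup>2 + ((1 - cos (2*pi*t)) / real i - 1 / real i)\<^sup>2
     = ((sin (2*pi*t))\<^sup>2 + (cos (2*pi*t))\<^sup>2) / (real i)\<^sup>2"
    unfolding diff_divide_distrib[symmetric] power_divide add_divide_distrib[symmetric] by simp
  also have "\<dots> = (1 / real i)\<^sup>2" by (simp only: sin_cos_squared_add power_divide) simp
  finally show "p \<in> circ i"
    by (simp add: p circ_def loop_param_def)
next
  fix p assume "p \<in> circ i"
  then obtain x y where p: "p = (x, y)" and e: "x\<^sup>2 + (y - 1 / real i)\<^sup>2 = (1 / real i)\<^sup>2"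
    by (auto simp: circ_def)
  have i: "real i > 0" using assms by simp
  \<comment> \<open>In these coordinates the circle becomes the unit circle with the base point at
    angle 0.\<close>
  have "(1 - real i * y)\<^sup>2 + (real i * x)\<^sup>2 = (real i)\<^sup>2 * (x\<^sup>2 + (y - 1 / real i)\<^sup>2)"
    using i by (simp add: power2_eq_square field_simps)
  also have "\<dots> = 1" using i by (simp add: e power_divide)
  finally obtain t where t: "0 \<le> t" "t < 2 * pi" "1 - real i * y = cos t" "real i * x = sin t"
    by (rule sincos_total_2pi)
  have "p = loop_param i (t / (2 * pi))"
    using i t by (simp add: p loop_param_def field_simps)
  moreover have "t / (2 * pi) \<in> {0..1}" using t by (simp add: field_simps)
  ultimately show "p \<in> loop_param i ` {0..1}" by blast
qed

lemma hawaiian_cases: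
  assumes "p \<in> hawaiian"
  obtains "p = (0, 0)" | i t where "1 \<le> i" "0 < t" "t < 1" "p = loop_param i t"
proof -
  obtain i t where "1 \<le> i" "0 \<le> t" "t \<le> 1" "p = loop_param i t"
    using assms by (auto simp: hawaiian_def circ_eq)
  then show ?thesis
    using that by (cases "t = 0 \<or> t = 1") (auto simp: less_le)
qed

lemma loop_param_in_hawaiian:
  "1 \<le> i \<Longrightarrow> 0 \<le> t \<Longrightarrow> t \<le> 1 \<Longrightarrow> loop_param i t \<in> hawaiian"
  by (auto simp: hawaiian_def circ_eq intro!: bexI[of _ i])

lemma zero_in_hawaiian: "(0, 0) \<in> hawaiian"
  using loop_param_in_hawaiian[of 1 0] by simp

text \<open>Off the origin the circles are isolated from each other: \<open>circ_index\<close> is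
  continuous there and takes integer values on the earring, so radius 1/2 around \<open>i\<close>
  selects one circle, and \<open>angle_param\<close> then cuts out \<open>S\<close>.\<close>

lemma openin_loop_param_image:
  assumes "1 \<le> i" "open S" "S \<subseteq> {0<..<1}"
  shows "openin (top_of_set hawaiian) (loop_param i ` S)"
proof -
  define Q where "Q = {p :: real \<times> real. 0 < snd p}"
  have "open Q" unfolding Q_def
    by (intro open_Collect_less continuous_intros)
  have c1: "continuous_on Q circ_index" unfolding circ_index_def
    by (intro continuous_intros) (auto simp: Q_def sum_power2_eq_zero_iff)
  have c2: "continuous_on Q angle_param" unfolding angle_param_def
    by (intro continuous_intros) (auto simp: Q_def)
  have "open (Q \<inter> circ_index -` {real i - 1/2 <..< real i + 1/2})"
    by (rule continuous_open_preimage[OF c1 \<open>open Q\<close>]) simp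
  moreover have "open (Q \<inter> angle_param -` S)"
    by (rule continuous_open_preimage[OF c2 \<open>open Q\<close> assms(2)])
  moreover have "loop_param i ` S = hawaiian \<inter>
     ((Q \<inter> circ_index -` {real i - 1/2 <..< real i + 1/2}) \<inter> (Q \<inter> angle_param -` S))"
    (is "?L = ?R")
  proof (intro set_eqI iffI)
    fix p assume "p \<in> ?L"
    then obtain t where "p = loop_param i t" "t \<in> S" by blast
    moreover from this have "0 < t" "t < 1" using assms(3) by auto
    ultimately show "p \<in> ?R"
      using assms(1) by (auto simp: Q_def loop_param_nonzero circ_index_loop_param
        angle_param_loop_param loop_param_in_hawaiian)
  next
    fix p assume p: "p \<in> ?R"
    then have "p \<in> hawaiian" by blast
    then show "p \<in> ?L"
    proof (cases rule: hawaiian_cases)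
      case 1 then show ?thesis using p by (auto simp: Q_def)
    next
      case (2 k t)
      then have "\<bar>real k - real i\<bar> < 1/2" using p by (auto simp: circ_index_loop_param)
      then have "k = i" by linarith
      then show ?thesis using 2 p by (auto simp: angle_param_loop_param)
    qed
  qed
  ultimately show ?thesis by (metis open_Int openin_open_Int)
qed

lemma continuous_on_loop_param: "continuous_on S (loop_param i)"
  unfolding loop_param_def by (cases "i = 0") (auto intro!: continuous_intros)

text \<open>As the complement of finitely many compact arcs the set is visibly open in the earring,
  although infinitely many circles meet at the origin.\<close>

lemma U_inf_eq:
  assumes "1 \<le> m"
  shows "U_inf m = hawaiian - (\<Union>i\<in>{1..<m}. loop_param i ` {3/8..5/8})"
proof (intro set_eqI iffI)
  fix p assume "p \<in> U_inf m"
  then have "(\<exists>i\<in>{1..<m}. p \<in> loop_param i ` ({0..<3/8} \<union> {5/8<..1})) \<or> (\<exists>i\<ge>m. p \<in> circ i)"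
    unfolding U_inf_def V_minus_def V_plus_def by blast
  then obtain i t where i: "1 \<le> i" "0 \<le> t" "t \<le> 1" "p = loop_param i t"
    "i < m \<longrightarrow> t < 3/8 \<or> t > 5/8"
  proof (elim disjE bexE exE conjE)
    fix i assume i: "i \<in> {1..<m}" and "p \<in> loop_param i ` ({0..<3/8} \<union> {5/8<..1})"
    then obtain t where "p = loop_param i t" "t \<in> {0..<3/8} \<union> {5/8<..1}" by blast
    then show ?thesis using that[of i t] i by auto
  next
    fix i assume i: "m \<le> i" and "p \<in> circ i"
    then obtain t where "p = loop_param i t" "t \<in> {0..1}" using circ_eq[of i] assms by auto
    then show ?thesis using that[of i t] i assms by auto
  qed
  have "p \<notin> loop_param k ` {3/8..5/8}" if "1 \<le> k" "k < m" for k
  proof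
    assume "p \<in> loop_param k ` {3/8..5/8}"
    then obtain s where s: "p = loop_param k s" "3/8 \<le> s" "s \<le> 5/8" by auto
    then have "p \<noteq> (0,0)" using loop_param_nonzero[of k s] that by auto
    then have "t \<noteq> 0" "t \<noteq> 1" using i by auto
    then have "i = k \<and> t = s" using loop_param_eq_iff[of i t k s] i s that by auto
    then show False using i s that by auto
  qed
  then show "p \<in> hawaiian - (\<Union>i\<in>{1..<m}. loop_param i ` {3/8..5/8})"
    using i loop_param_in_hawaiian by auto
next
  fix p assume p: "p \<in> hawaiian - (\<Union>i\<in>{1..<m}. loop_param i ` {3/8..5/8})"
  then obtain i t where i: "1 \<le> i" "0 \<le> t" "t \<le> 1" "p = loop_param i t"
    by (auto simp: hawaiian_def circ_eq)
  show "p \<in> U_inf m"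
  proof (cases "i < m")
    case True
    then have "p \<notin> loop_param i ` {3/8..5/8}" using p i(1) by auto
    then have "t < 3/8 \<or> t > 5/8" using i by force
    then show ?thesis using i True by (auto simp: U_inf_def V_minus_def V_plus_def intro!: bexI[of _ i])
  next
    case False
    then show ?thesis using i by (auto simp: U_inf_def circ_eq intro!: bexI[of _ i])
  qed
qed

lemma U_inf_subset_hawaiian: "1 \<le> m \<Longrightarrow> U_inf m \<subseteq> hawaiian"
  by (simp add: U_inf_eq)

lemma openin_U_inf:
  assumes "1 \<le> m"
  shows "openin (top_of_set hawaiian) (U_inf m)"
proof -
  have "closed (\<Union>i\<in>{1..<m}. loop_param i ` {3/8..5/8})"
    by (intro closed_UN finite_atLeastLessThan ballI compact_imp_closed
        compact_continuous_image continuous_on_loop_param compact_Icc)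
  then show ?thesis
    unfolding U_inf_eq[OF assms] by (metis Diff_eq open_Compl openin_open_Int)
qed

lemma openin_U_arc: "1 \<le> i \<Longrightarrow> openin (top_of_set hawaiian) (U_arc i)"
  unfolding U_arc_def by (intro openin_loop_param_image) auto

lemma zero_in_U_inf: "1 \<le> m \<Longrightarrow> (0, 0) \<in> U_inf m"
proof -
  assume "1 \<le> m"
  moreover have "(0, 0) \<notin> loop_param i ` {3/8..5/8}" if "i \<in> {1..<m}" for i
  proof
    assume "(0, 0) \<in> loop_param i ` {3/8..5/8}"
    then obtain t where "(0, 0) = loop_param i t" "t \<in> {3/8..5/8}" by blast
    then show False using loop_param_nonzero(2)[of i t] that by auto
  qed
  ultimately show ?thesis using zero_in_hawaiian by (simp add: U_inf_eq)
qed

lemma loop_param_in_U_inf_iff: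
  assumes "1 \<le> m" "1 \<le> i" "0 < t" "t < 1"
  shows "loop_param i t \<in> U_inf m \<longleftrightarrow> m \<le> i \<or> t < 3/8 \<or> 5/8 < t"
proof -
  have "loop_param i t \<in> loop_param k ` {3/8..5/8} \<longleftrightarrow> k = i \<and> 3/8 \<le> t \<and> t \<le> 5/8"
    if "1 \<le> k" for k
  proof -
    have "loop_param i t = loop_param k s \<longleftrightarrow> i = k \<and> t = s" if "s \<in> {3/8..5/8}" for s
      using loop_param_eq_iff[of i t k s] \<open>1 \<le> k\<close> that assms by auto
    then show ?thesis by (auto simp: image_iff)
  qed
  then show ?thesis
    using assms loop_param_in_hawaiian[of i t] by (auto simp: U_inf_eq)
qed

lemma loop_param_in_U_arc_iff:
  assumes "1 \<le> k" "1 \<le> i" "0 < t" "t < 1"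
  shows "loop_param i t \<in> U_arc k \<longleftrightarrow> k = i \<and> 1/4 < t \<and> t < 3/4"
proof -
  have "loop_param i t = loop_param k s \<longleftrightarrow> i = k \<and> t = s" if "s \<in> {1/4<..<3/4}" for s
    using loop_param_eq_iff[of i t k s] that assms by auto
  then show ?thesis by (auto simp: image_iff U_arc_def)
qed

lemma U_inf_antimono: "1 \<le> m \<Longrightarrow> m \<le> m' \<Longrightarrow> U_inf m' \<subseteq> U_inf m"
proof -
  assume "1 \<le> m" "m \<le> m'"
  moreover from this have "{1..<m} \<subseteq> {1..<m'}" by auto
  ultimately show ?thesis
    unfolding U_inf_eq[OF \<open>1 \<le> m\<close>] U_inf_eq[OF order_trans[OF \<open>1 \<le> m\<close> \<open>m \<le> m'\<close>]] by blast
qed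

lemma zero_notin_U_arc:
  assumes "1 \<le> i"
  shows "(0, 0) \<notin> U_arc i"
proof
  assume "(0, 0) \<in> U_arc i"
  then obtain t where "(0, 0) = loop_param i t" "t \<in> {1/4<..<3/4}" unfolding U_arc_def by blast
  then show False using loop_param_nonzero(2)[of i t] assms by auto
qed

section \<open>Atlases and lifts of rectangles\<close>

definition atlas_topology :: "('c \<Rightarrow> 'a set) \<Rightarrow> 'c set \<Rightarrow> 'b topology \<Rightarrow> ('a \<Rightarrow> 'b) \<Rightarrow> 'a topology" where
  "atlas_topology U I Y p =
     topology (\<lambda>S. S \<subseteq> (\<Union>c\<in>I. U c) \<and> (\<forall>c\<in>I. openin Y (p ` (S \<inter> U c))))"

text \<open>Injectivity on the charts makes images commute with intersections, which closes the
  family under binary intersections.\<close>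

lemma openin_atlas_topology:
  assumes inj: "\<And>c. c \<in> I \<Longrightarrow> inj_on p (U c)"
  shows "openin (atlas_topology U I Y p) S \<longleftrightarrow>
    S \<subseteq> (\<Union>c\<in>I. U c) \<and> (\<forall>c\<in>I. openin Y (p ` (S \<inter> U c)))"
proof -
  define P where "P = (\<lambda>S. S \<subseteq> (\<Union>c\<in>I. U c) \<and> (\<forall>c\<in>I. openin Y (p ` (S \<inter> U c))))"
  have "istopology P"
    unfolding istopology_def
  proof (intro conjI allI impI)
    fix S S' assume "P S" "P S'"
    moreover have "p ` ((S \<inter> S') \<inter> U c) = p ` (S \<inter> U c) \<inter> p ` (S' \<inter> U c)" if "c \<in> I" for c
    proof -
      have "p ` ((S \<inter> U c) \<inter> (S' \<inter> U c)) = p ` (S \<inter> U c) \<inter> p ` (S' \<inter> U c)"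
        by (rule inj_on_image_Int[OF inj[OF that]]) auto
      moreover have "(S \<inter> U c) \<inter> (S' \<inter> U c) = S \<inter> S' \<inter> U c" by blast
      ultimately show ?thesis by simp
    qed
    ultimately show "P (S \<inter> S')" unfolding P_def by (auto intro: openin_Int)
  next
    fix \<S> assume "\<forall>S\<in>\<S>. P S"
    moreover have "p ` (\<Union>\<S> \<inter> U c) = (\<Union>S\<in>\<S>. p ` (S \<inter> U c))" for c by blast
    ultimately show "P (\<Union>\<S>)" unfolding P_def by (auto intro!: openin_Union)
  qed
  then show ?thesis
    by (simp add: atlas_topology_def topology_inverse' P_def)
qed

text \<open>Open overlaps are needed twice: they make the charts themselves open, and they make the
  preimage of an open set under one chart open when viewed through any other chart.\<close>

lemma atlas_topology_chart:
  assumes inj: "\<And>c. c \<in> I \<Longrightarrow> inj_on p (U c)"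
    and chart: "\<And>c. c \<in> I \<Longrightarrow> openin Y (p ` U c)"
    and overlap: "\<And>c d. c \<in> I \<Longrightarrow> d \<in> I \<Longrightarrow> openin Y (p ` (U c \<inter> U d))"
  shows "topspace (atlas_topology U I Y p) = (\<Union>c\<in>I. U c)"
    and "c \<in> I \<Longrightarrow> openin (atlas_topology U I Y p) (U c)"
    and "c \<in> I \<Longrightarrow> homeomorphic_map (subtopology (atlas_topology U I Y p) (U c)) (subtopology Y (p ` U c)) p"
proof -
  let ?T = "atlas_topology U I Y p"
  have openin: "openin ?T S \<longleftrightarrow> S \<subseteq> (\<Union>c\<in>I. U c) \<and> (\<forall>c\<in>I. openin Y (p ` (S \<inter> U c)))" for S
    by (rule openin_atlas_topology[OF inj])
  have U: "openin ?T (U c)" if "c \<in> I" for c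
    using that overlap by (auto simp: openin)
  then show "c \<in> I \<Longrightarrow> openin ?T (U c)" .
  show top: "topspace ?T = (\<Union>c\<in>I. U c)"
  proof
    show "topspace ?T \<subseteq> (\<Union>c\<in>I. U c)"
      by (rule conjunct1[OF openin[THEN iffD1, OF openin_topspace]])
    show "(\<Union>c\<in>I. U c) \<subseteq> topspace ?T"
      using U openin_subset by blast
  qed
  assume c: "c \<in> I"
  have topc: "topspace (subtopology ?T (U c)) = U c"
    by (rule topspace_subtopology_subset[OF openin_subset[OF U[OF c]]])
  have topq: "topspace (subtopology Y (p ` U c)) = p ` U c"
    by (rule topspace_subtopology_subset[OF openin_subset[OF chart[OF c]]])
  show "homeomorphic_map (subtopology ?T (U c)) (subtopology Y (p ` U c)) p"
  proof (rule bijective_open_imp_homeomorphic_map)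
    show "open_map (subtopology ?T (U c)) (subtopology Y (p ` U c)) p"
      unfolding open_map_def openin_open_subtopology[OF U[OF c]] openin_open_subtopology[OF chart[OF c]]
      using c by (auto simp: openin) (metis Int_absorb2)
    show "continuous_map (subtopology ?T (U c)) (subtopology Y (p ` U c)) p"
      unfolding continuous_map topc topq
    proof (intro conjI allI impI)
      fix W assume "openin (subtopology Y (p ` U c)) W"
      then have W: "openin Y W" "W \<subseteq> p ` U c"
        using openin_open_subtopology[OF chart[OF c]] by auto
      have "p ` ({x \<in> U c. p x \<in> W} \<inter> U d) = W \<inter> p ` (U c \<inter> U d)" for d by auto
      then have "openin ?T {x \<in> U c. p x \<in> W}"
        using c W overlap by (auto simp: openin intro!: openin_Int)
      then show "openin (subtopology ?T (U c)) {x \<in> U c. p x \<in> W}"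
        unfolding openin_open_subtopology[OF U[OF c]] by auto
    qed auto
  qed (use topc topq inj[OF c] in auto)
qed

text \<open>Openness can be tested on the traces in an open cover, and every trace is read off
  through \<open>p\<close>.\<close>

lemma atlas_topology_unique:
  assumes top: "topspace T = (\<Union>c\<in>I. U c)" "topspace T' = (\<Union>c\<in>I. U c)"
    and T: "\<And>c. c \<in> I \<Longrightarrow> openin T (U c)"
      "\<And>c. c \<in> I \<Longrightarrow> homeomorphic_map (subtopology T (U c)) (Y c) p"
    and T': "\<And>c. c \<in> I \<Longrightarrow> openin T' (U c)"
      "\<And>c. c \<in> I \<Longrightarrow> homeomorphic_map (subtopology T' (U c)) (Y c) p"
  shows "T = T'"
proof -
  have *: "openin X S \<longleftrightarrow> S \<subseteq> (\<Union>c\<in>I. U c) \<and> (\<forall>c\<in>I. openin (Y c) (p ` (S \<inter> U c)))"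
    if top: "topspace X = (\<Union>c\<in>I. U c)" and X: "\<And>c. c \<in> I \<Longrightarrow> openin X (U c)"
      "\<And>c. c \<in> I \<Longrightarrow> homeomorphic_map (subtopology X (U c)) (Y c) p" for X S
  proof -
    have c: "openin (Y c) (p ` (S \<inter> U c)) \<longleftrightarrow> openin X (S \<inter> U c)" if "c \<in> I" for c
    proof -
      have "S \<inter> U c \<subseteq> topspace (subtopology X (U c))"
        unfolding topspace_subtopology_subset[OF openin_subset[OF X(1)[OF that]]] by blast
      then have "openin (Y c) (p ` (S \<inter> U c)) \<longleftrightarrow> openin (subtopology X (U c)) (S \<inter> U c)"
        by (rule homeomorphic_map_openness[OF X(2)[OF that]])
      then show ?thesis by (simp add: openin_open_subtopology[OF X(1)[OF that]])
    qed
    show ?thesis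
    proof
      assume "openin X S"
      then show "S \<subseteq> (\<Union>c\<in>I. U c) \<and> (\<forall>c\<in>I. openin (Y c) (p ` (S \<inter> U c)))"
        using c X(1) openin_subset[of X S] top by (auto intro: openin_Int)
    next
      assume S: "S \<subseteq> (\<Union>c\<in>I. U c) \<and> (\<forall>c\<in>I. openin (Y c) (p ` (S \<inter> U c)))"
      have "openin X (\<Union>c\<in>I. S \<inter> U c)"
        by (intro openin_Union ballI) (use S c in auto)
      moreover have "(\<Union>c\<in>I. S \<inter> U c) = S" using S by blast
      ultimately show "openin X S" by simp
    qed
  qed
  show ?thesis
    unfolding topology_eq by (simp add: *[OF top(1) T] *[OF top(2) T'])
qed

section \<open>Lifts: uniqueness, gluing and subdivision\<close>

lemma unique_lift:
  fixes D :: "'z::topological_space set"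
  assumes haus: "\<And>x y. x \<in> topspace T \<Longrightarrow> y \<in> topspace T \<Longrightarrow> p x = p y \<Longrightarrow> x \<noteq> y \<Longrightarrow>
       \<exists>U V. openin T U \<and> openin T V \<and> x \<in> U \<and> y \<in> V \<and> disjnt U V"
    and inj: "\<And>x. x \<in> topspace T \<Longrightarrow> \<exists>U. openin T U \<and> x \<in> U \<and> inj_on p U"
    and "Topological_Spaces.connected D"
    and G: "continuous_map (top_of_set D) T G" and G': "continuous_map (top_of_set D) T G'"
    and eq: "\<And>z. z \<in> D \<Longrightarrow> p (G z) = p (G' z)"
    and c: "c \<in> D" "G c = G' c" and z: "z \<in> D"
  shows "G z = G' z"
proof -
  have GT: "G z \<in> topspace T" "G' z \<in> topspace T" if "z \<in> D" for z
    using that G G' by (auto simp: continuous_map_def)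
  have pre: "openin (top_of_set D) ({z \<in> D. G z \<in> U} \<inter> {z \<in> D. G' z \<in> V})"
    if "openin T U" "openin T V" for U V
    using openin_continuous_map_preimage[OF G that(1)] openin_continuous_map_preimage[OF G' that(2)]
    by (auto intro: openin_Int)
  \<comment> \<open>The set of agreement is clopen: open by local injectivity, closed because two
    lifts that differ at a point lie in the same fibre and can be separated there.\<close>
  let ?A = "{z \<in> D. G z = G' z}"
  have "openin (top_of_set D) ?A"
  proof (subst openin_subopen, intro ballI)
    fix z assume "z \<in> ?A"
    then obtain U where "openin T U" "G z \<in> U" "inj_on p U" using inj GT by blast
    then show "\<exists>W. openin (top_of_set D) W \<and> z \<in> W \<and> W \<subseteq> ?A"
      using pre[of U U] eq \<open>z \<in> ?A\<close>
      by (intro exI[of _ "{z \<in> D. G z \<in> U} \<inter> {z \<in> D. G' z \<in> U}"]) (auto dest: inj_onD)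
  qed
  moreover have "openin (top_of_set D) (D - ?A)"
  proof (subst openin_subopen, intro ballI)
    fix z assume z: "z \<in> D - ?A"
    then obtain U V where "openin T U" "openin T V" "G z \<in> U" "G' z \<in> V" "disjnt U V"
      using haus[of "G z" "G' z"] GT eq by blast
    then show "\<exists>W. openin (top_of_set D) W \<and> z \<in> W \<and> W \<subseteq> D - ?A"
      using pre[of U V] z
      by (intro exI[of _ "{z \<in> D. G z \<in> U} \<inter> {z \<in> D. G' z \<in> V}"]) (auto simp: disjnt_iff)
  qed
  ultimately have "?A = {} \<or> ?A = D"
    using \<open>Topological_Spaces.connected D\<close> unfolding connected_clopen closedin_def by auto
  then show ?thesis using c z by blast
qed

text \<open>The set \<open>K\<close> constrains the starting value as well as the lift, so that a
  lift can be confined to a part of the space where \<open>p\<close> behaves like a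
  covering.\<close>

definition lifts_on :: "'a topology \<Rightarrow> ('a \<Rightarrow> 'b::topological_space) \<Rightarrow> 'a set \<Rightarrow> 'z::topological_space set \<Rightarrow> ('z \<Rightarrow> 'b) \<Rightarrow> bool" where
  "lifts_on T p K S F \<longleftrightarrow> (\<forall>z\<in>S. \<forall>x\<in>K. p x = F z \<longrightarrow>
     (\<exists>G. continuous_map (top_of_set S) (subtopology T K) G \<and> G z = x \<and> (\<forall>y\<in>S. p (G y) = F y)))"

text \<open>The initial value may be prescribed at any point of the rectangle, which makes the property
  stable under gluing adjacent rectangles.\<close>

definition rect_lifting :: "'a topology \<Rightarrow> ('a \<Rightarrow> 'b::topological_space) \<Rightarrow> 'a set \<Rightarrow> 'b set \<Rightarrow> bool" where
  "rect_lifting T p K U \<longleftrightarrow> (\<forall>a b c d F. continuous_on ({a..b::real} \<times> {c..d::real}) F \<longrightarrow>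
     F ` ({a..b} \<times> {c..d}) \<subseteq> U \<longrightarrow> lifts_on T p K ({a..b} \<times> {c..d}) F)"

text \<open>A lift over one piece is continued from a common point \<open>c\<close>. By uniqueness
  both lifts agree on the connected intersection, so they can be pasted along closed sets.\<close>

lemma lifts_on_Un:
  assumes haus: "\<And>x y. x \<in> topspace T \<Longrightarrow> y \<in> topspace T \<Longrightarrow> p x = p y \<Longrightarrow> x \<noteq> y \<Longrightarrow>
       \<exists>U V. openin T U \<and> openin T V \<and> x \<in> U \<and> y \<in> V \<and> disjnt U V"
    and inj: "\<And>x. x \<in> topspace T \<Longrightarrow> \<exists>U. openin T U \<and> x \<in> U \<and> inj_on p U"
    and L: "lifts_on T p K S F" "lifts_on T p K S' F"
    and S: "closed S" "closed S'" "Topological_Spaces.connected (S \<inter> S')" "S \<inter> S' \<noteq> {}"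
  shows "lifts_on T p K (S \<union> S') F"
proof -
  have *: "\<exists>G. continuous_map (top_of_set (S \<union> S')) (subtopology T K) G \<and> G z = x \<and> (\<forall>y\<in>S\<union>S'. p (G y) = F y)"
    if L: "lifts_on T p K S F" "lifts_on T p K S' F"
    and S: "closed S" "closed S'" "Topological_Spaces.connected (S \<inter> S')" "S \<inter> S' \<noteq> {}"
    and z: "z \<in> S" "x \<in> K" "p x = F z" for z x S S'
  proof -
    obtain G where G: "continuous_map (top_of_set S) (subtopology T K) G" "G z = x" "\<forall>y\<in>S. p (G y) = F y"
      using L(1) z unfolding lifts_on_def by blast
    obtain c where c: "c \<in> S" "c \<in> S'" using S by blast
    then have "G c \<in> K" "p (G c) = F c" using G by (auto simp: continuous_map_def)
    then obtain G' where G': "continuous_map (top_of_set S') (subtopology T K) G'" "G' c = G c" "\<forall>y\<in>S'. p (G' y) = F y"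
      using L(2) c unfolding lifts_on_def by blast
    have GT: "continuous_map (top_of_set (S \<inter> S')) T G" "continuous_map (top_of_set (S \<inter> S')) T G'"
      using G(1) G'(1) continuous_map_in_subtopology continuous_map_from_subtopology_mono
      by (metis Int_lower1, metis Int_lower2)
    have agree: "G y = G' y" if "y \<in> S \<inter> S'" for y
      by (rule unique_lift[OF haus inj S(3) GT, of c]) (use that c G G' in auto)
    define H where "H = (\<lambda>y. if y \<in> S then G y else G' y)"
    have "continuous_map (top_of_set (S \<union> S')) (subtopology T K) H"
    proof (rule pasting_lemma_closed[where I = "UNIV :: bool set" and T = "\<lambda>i. if i then S else S'"
          and f = "\<lambda>i. if i then G else G'"])
      fix i :: bool
      show "closedin (top_of_set (S \<union> S')) (if i then S else S')"
        using S by (auto intro!: closed_subset)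
      have "(S \<union> S') \<inter> S = S" "(S \<union> S') \<inter> S' = S'" by auto
      then show "continuous_map (subtopology (top_of_set (S \<union> S')) (if i then S else S'))
          (subtopology T K) (if i then G else G')"
        using G G' by (simp add: subtopology_subtopology)
    next
      fix i j :: bool and x
      assume "x \<in> topspace (top_of_set (S \<union> S')) \<inter> (if i then S else S') \<inter> (if j then S else S')"
      then show "(if i then G else G') x = (if j then G else G') x"
        using agree by (auto split: if_splits)
    next
      fix x assume "x \<in> topspace (top_of_set (S \<union> S'))"
      then show "\<exists>j. j \<in> UNIV \<and> x \<in> (if j then S else S') \<and> H x = (if j then G else G') x"
        by (auto simp: H_def intro: exI[of _ True] exI[of _ False])
    qed simp
    moreover have "H z = x" using G z by (simp add: H_def)
    moreover have "\<forall>y\<in>S\<union>S'. p (H y) = F y" using G G' by (auto simp: H_def)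
    ultimately show ?thesis by blast
  qed
  show ?thesis
    unfolding lifts_on_def
  proof (intro ballI impI)
    fix z x assume z: "z \<in> S \<union> S'" "x \<in> K" "p x = F z"
    show "\<exists>G. continuous_map (top_of_set (S \<union> S')) (subtopology T K) G \<and> G z = x \<and> (\<forall>y\<in>S\<union>S'. p (G y) = F y)"
    proof (cases "z \<in> S")
      case True then show ?thesis using *[OF L S] z by blast
    next
      case False
      then show ?thesis using *[OF L(2,1) S(2,1), of z x] S(3,4) z by (simp add: Un_commute Int_commute)
    qed
  qed
qed

text \<open>A Lebesgue number for the pulled-back cover makes small rectangles liftable. Bisection
  glues them to thin strips, and a second bisection glues the strips; neighbouring pieces meet in a
  connected segment.\<close>

lemma rect_lifting_cover:
  assumes haus: "\<And>x y. x \<in> topspace T \<Longrightarrow> y \<in> topspace T \<Longrightarrow> p x = p y \<Longrightarrow> x \<noteq> y \<Longrightarrow>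
       \<exists>U V. openin T U \<and> openin T V \<and> x \<in> U \<and> y \<in> V \<and> disjnt U V"
    and inj: "\<And>x. x \<in> topspace T \<Longrightarrow> \<exists>U. openin T U \<and> x \<in> U \<and> inj_on p U"
    and U: "\<And>O'. O' \<in> \<O> \<Longrightarrow> openin (top_of_set U) O'" "U \<subseteq> \<Union>\<O>"
    and L: "\<And>O'. O' \<in> \<O> \<Longrightarrow> rect_lifting T p K O'"
  shows "rect_lifting T p K U"
  unfolding rect_lifting_def
proof (intro allI impI)
  fix a b c d :: real and F :: "real \<times> real \<Rightarrow> 'b"
  let ?R = "{a..b} \<times> {c..d}"
  assume F: "continuous_on ?R F" "F ` ?R \<subseteq> U"
  show "lifts_on T p K ?R F"
  proof (cases "?R = {}")
    case True then show ?thesis by (simp add: lifts_on_def)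
  next
    case False
    then have ab: "a \<le> b" "c \<le> d" by auto
    define C where "C = {W. open W \<and> (\<exists>O'\<in>\<O>. F ` (?R \<inter> W) \<subseteq> O')}"
    have ex: "\<exists>W\<in>C. z \<in> W" if zR: "z \<in> ?R" for z
    proof -
      obtain O' where O': "O' \<in> \<O>" "F z \<in> O'"
        using subsetD[OF U(2) subsetD[OF F(2) imageI[OF zR]]] by (elim UnionE)
      have "openin (top_of_set ?R) (?R \<inter> F -` O')"
        by (rule continuous_openin_preimage[OF F(1) _ U(1)[OF O'(1)]]) (use F(2) in \<open>simp add: image_subset_iff_funcset\<close>)
      then obtain W where W: "open W" "?R \<inter> F -` O' = ?R \<inter> W"
        unfolding openin_open by (elim exE conjE)
      have "F ` (?R \<inter> W) \<subseteq> O'" unfolding W(2)[symmetric] by blast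
      then have "W \<in> C" using O'(1) W(1) unfolding C_def mem_Collect_eq by (intro conjI bexI)
      moreover have "z \<in> W" using W(2) O'(2) zR IntI[of z ?R "F -` O'"] by simp
      ultimately show ?thesis by blast
    qed
    have "(a, c) \<in> ?R" using ab by simp
    then have Cne: "C \<noteq> {}" using ex by blast
    have Ccov: "?R \<subseteq> \<Union>C" using ex by blast
    have Copen: "open W" if "W \<in> C" for W using that unfolding C_def by simp
    obtain e where e: "0 < e" and e': "\<And>S. S \<subseteq> ?R \<Longrightarrow> diameter S < e \<Longrightarrow> \<exists>W\<in>C. S \<subseteq> W"
      using Lebesgue_number_lemma[OF compact_Times[OF compact_Icc compact_Icc] Cne Ccov Copen]
      by metis
    have small: "lifts_on T p K ({u..v} \<times> {s..t}) F"
      if sub: "a \<le> u" "v \<le> b" "c \<le> s" "t \<le> d" "u \<le> v" "s \<le> t" and len: "v - u < e/3" "t - s < e/3" for u v s t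
    proof -
      let ?S = "{u..v} \<times> {s..t}"
      \<comment> \<open>Sides shorter than \<open>e/3\<close> keep the diameter strictly below the
        Lebesgue number \<open>e\<close>.\<close>
      have "diameter ?S \<le> e/3 + e/3"
      proof (rule diameter_le)
        fix x y assume xy: "x \<in> ?S" "y \<in> ?S"
        have "norm (x - y) \<le> norm (fst x - fst y) + norm (snd x - snd y)"
          using norm_Pair_le[of "fst x - fst y" "snd x - snd y"] by (simp add: minus_prod_def)
        also have "\<dots> \<le> e/3 + e/3"
          using xy len by (intro add_mono) (auto simp: abs_if)
        finally show "norm (x - y) \<le> e/3 + e/3" .
      qed (use e in simp)
      then have "diameter ?S < e" using e by linarith
      moreover have S: "?S \<subseteq> ?R" using sub by auto
      ultimately obtain W where "W \<in> C" "?S \<subseteq> W" using e' by blast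
      then obtain O' where O': "O' \<in> \<O>" "F ` (?R \<inter> W) \<subseteq> O'" unfolding C_def mem_Collect_eq by (elim conjE bexE)
      have "?S \<subseteq> ?R \<inter> W" using S \<open>?S \<subseteq> W\<close> by (rule Int_greatest)
      then have "F ` ?S \<subseteq> O'" using O'(2) by (meson image_mono order_trans)
      then show ?thesis
        using L[OF O'(1)] continuous_on_subset[OF F(1) S] unfolding rect_lifting_def by simp
    qed
    \<comment> \<open>The trivial premises \<open>c \<le> c\<close> and \<open>d \<le> d\<close>
      make this an instance of the predicate on subintervals to which \<open>Bolzano\<close> is
      applied.\<close>
    have strip: "u \<le> v \<longrightarrow> a \<le> u \<longrightarrow> v \<le> b \<longrightarrow> v - u < e/3 \<longrightarrow> c \<le> c \<longrightarrow> d \<le> d \<longrightarrow> lifts_on T p K ({u..v} \<times> {c..d}) F" for u v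
      using ab(2)
    proof (induction rule: Bolzano[where P = "\<lambda>s t. u \<le> v \<longrightarrow> a \<le> u \<longrightarrow> v \<le> b \<longrightarrow> v - u < e/3 \<longrightarrow> c \<le> s \<longrightarrow> t \<le> d \<longrightarrow> lifts_on T p K ({u..v} \<times> {s..t}) F"])
      case (trans r s t)
      show ?case
      proof (intro impI)
        assume *: "u \<le> v" "a \<le> u" "v \<le> b" "v - u < e / 3" "c \<le> r" "t \<le> d"
        have "lifts_on T p K ({u..v} \<times> {r..s} \<union> {u..v} \<times> {s..t}) F"
        proof (rule lifts_on_Un[OF haus inj])
          show "lifts_on T p K ({u..v} \<times> {r..s}) F" "lifts_on T p K ({u..v} \<times> {s..t}) F"
            using trans * by auto
          have "{u..v} \<times> {r..s} \<inter> {u..v} \<times> {s..t} = {u..v} \<times> {s}" using trans by auto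
          then show "Topological_Spaces.connected ({u..v} \<times> {r..s} \<inter> {u..v} \<times> {s..t})"
            "{u..v} \<times> {r..s} \<inter> {u..v} \<times> {s..t} \<noteq> {}"
            using * by (auto intro!: connected_Times)
        qed (auto intro!: closed_Times)
        moreover have "{u..v} \<times> {r..s} \<union> {u..v} \<times> {s..t} = {u..v} \<times> {r..t}" using trans by auto
        ultimately show "lifts_on T p K ({u..v} \<times> {r..t}) F" by simp
      qed
    next
      case (local x)
      then show ?case using small e by (intro exI[of _ "e/3"]) auto
    qed
    have "a \<le> a \<longrightarrow> b \<le> b \<longrightarrow> lifts_on T p K ?R F"
      using ab(1)
    proof (induction rule: Bolzano[where P = "\<lambda>u v. a \<le> u \<longrightarrow> v \<le> b \<longrightarrow> lifts_on T p K ({u..v} \<times> {c..d}) F"])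
      case (trans r s t)
      show ?case
      proof (intro impI)
        assume *: "a \<le> r" "t \<le> b"
        have "lifts_on T p K ({r..s} \<times> {c..d} \<union> {s..t} \<times> {c..d}) F"
        proof (rule lifts_on_Un[OF haus inj])
          show "lifts_on T p K ({r..s} \<times> {c..d}) F" "lifts_on T p K ({s..t} \<times> {c..d}) F"
            using trans * by auto
          have "{r..s} \<times> {c..d} \<inter> {s..t} \<times> {c..d} = {s} \<times> {c..d}" using trans by auto
          then show "Topological_Spaces.connected ({r..s} \<times> {c..d} \<inter> {s..t} \<times> {c..d})"
            "{r..s} \<times> {c..d} \<inter> {s..t} \<times> {c..d} \<noteq> {}"
            using ab by (auto intro!: connected_Times)
        qed (auto intro!: closed_Times)
        moreover have "{r..s} \<times> {c..d} \<union> {s..t} \<times> {c..d} = {r..t} \<times> {c..d}" using trans by auto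
        ultimately show "lifts_on T p K ({r..t} \<times> {c..d}) F" by simp
      qed
    next
      case (local x)
      then show ?case using strip e by (intro exI[of _ "e/3"]) auto
    qed
    then show ?thesis by simp
  qed
qed

section \<open>Multiplication by a letter in the Cayley tree\<close>

lemma all_words_iff: "v \<in> all_words \<longleftrightarrow> (\<forall>x\<in>set v. 1 \<le> fst x)"
proof
  assume "v \<in> all_words"
  then obtain n where "v \<in> words_upto n" by (auto simp: all_words_def)
  then show "\<forall>x\<in>set v. 1 \<le> fst x" by (auto simp: words_upto_def)
next
  assume *: "\<forall>x\<in>set v. 1 \<le> fst x"
  have "x \<in> {1..Max (insert 0 (fst ` set v))} \<times> UNIV" if "x \<in> set v" for x
  proof -
    have "fst x \<le> Max (insert 0 (fst ` set v))" using that by (intro Max_ge) auto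
    then show ?thesis using * that by (simp add: mem_Times_iff)
  qed
  then have "v \<in> words_upto (Max (insert 0 (fst ` set v)))"
    unfolding words_upto_def by (intro in_listsI ballI)
  then show "v \<in> all_words" by (auto simp: all_words_def)
qed

lemma reduced_appendD: "reduced (u @ v) \<Longrightarrow> reduced u"
  unfolding reduced_def by (metis append.assoc append_Cons)

lemma reduced_snoc: "reduced (u @ [x]) \<longleftrightarrow> reduced u \<and> (u = [] \<or> last u \<noteq> inv_letter x)"
proof
  assume r: "reduced (u @ [x])"
  have "u = [] \<or> last u \<noteq> inv_letter x"
  proof (rule ccontr)
    assume "\<not> (u = [] \<or> last u \<noteq> inv_letter x)"
    then have "u = butlast u @ [inv_letter x]" by (metis append_butlast_last_id)
    then have "u @ [x] = butlast u @ inv_letter x # inv_letter (inv_letter x) # []"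
      by (metis append.assoc append_Cons append_Nil inv_letter_inv_letter)
    then show False using r unfolding reduced_def by blast
  qed
  then show "reduced u \<and> (u = [] \<or> last u \<noteq> inv_letter x)"
    using r reduced_appendD by blast
next
  assume r: "reduced u \<and> (u = [] \<or> last u \<noteq> inv_letter x)"
  show "reduced (u @ [x])"
    unfolding reduced_def
  proof
    assume "\<exists>xs y ys. u @ [x] = xs @ y # inv_letter y # ys"
    then obtain xs y ys where e: "u @ [x] = xs @ y # inv_letter y # ys" by blast
    show False
    proof (cases ys rule: rev_cases)
      case Nil
      then have "u @ [x] = (xs @ [y]) @ [inv_letter y]" using e by simp
      then have "u = xs @ [y]" "x = inv_letter y" by (metis append1_eq_conv)+
      then show False using r by simp
    next
      case (snoc zs z)
      then have "u @ [x] = (xs @ y # inv_letter y # zs) @ [z]" using e by simp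
      then have "u = xs @ y # inv_letter y # zs" by (metis append1_eq_conv)
      then show False using r unfolding reduced_def by blast
    qed
  qed
qed

lemma cancel_append: "cancel v w \<Longrightarrow> cancel (v @ u) (w @ u)"
proof (induction rule: cancel.induct)
  case (1 xs x ys)
  show ?case using cancel.intros[of xs x "ys @ u"] by simp
qed

lemma freduce_append: "freduce (freduce u @ v) = freduce (u @ v)"
proof -
  have "freduce (a @ v) = freduce (b @ v)" if "cancel\<^sup>*\<^sup>* a b" for a b
    using that by (induction rule: rtranclp_induct) (simp_all add: freduce_cancel[OF cancel_append])
  then show ?thesis using cancels_freduce[of u] by metis
qed

lemma set_freduce: "set (freduce w) \<subseteq> set w"
proof (induction w)
  case (Cons x w)
  then show ?case by (cases "freduce w") auto
qed simp

text \<open>On reduced words this is right multiplication in the free group, so the neighbours of a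
  vertex are found by editing its last letter only; \<open>freduce_snoc\<close> is the link.\<close>

definition rmul :: "word \<Rightarrow> letter \<Rightarrow> word" where
  "rmul u x = (if u \<noteq> [] \<and> last u = inv_letter x then butlast u else u @ [x])"

lemma rmul_cases:
  obtains (app) "rmul u x = u @ [x]" "u = [] \<or> last u \<noteq> inv_letter x"
  | (del) "u = rmul u x @ [inv_letter x]"
proof (cases "u \<noteq> [] \<and> last u = inv_letter x")
  case True
  then have "u = rmul u x @ [inv_letter x]" by (metis rmul_def append_butlast_last_id)
  then show ?thesis by (rule del)
qed (use app in \<open>auto simp: rmul_def\<close>)

lemma reduced_rmul: "reduced u \<Longrightarrow> reduced (rmul u x)"
  by (cases rule: rmul_cases[of u x]) (metis reduced_snoc, metis reduced_appendD)

lemma freduce_snoc: "reduced u \<Longrightarrow> freduce (u @ [x]) = rmul u x"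
proof (cases rule: rmul_cases[of u x])
  case app
  assume "reduced u"
  with app show ?thesis by (metis freduce_reduced reduced_snoc)
next
  case del
  assume r: "reduced u"
  then have "reduced (rmul u x)" by (rule reduced_rmul)
  moreover have "cancel (u @ [x]) (rmul u x)"
    using del cancel.intros[of "rmul u x" "inv_letter x" "[]"]
    by (metis append.assoc append_Cons append_Nil append_Nil2 inv_letter_inv_letter)
  ultimately show ?thesis by (metis freduce_cancel freduce_reduced)
qed

lemma freduce_append_snoc: "freduce (u @ v @ [x]) = rmul (freduce (u @ v)) x"
  by (metis append.assoc freduce_append freduce_snoc reduced_freduce)

lemma rmul_inverse:
  assumes "reduced u" "v = rmul u x"
  shows "u = rmul v (inv_letter x)"
proof (cases rule: rmul_cases[of u x])
  case app
  then show ?thesis by (simp add: assms rmul_def[of "u @ [x]"])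
next
  case del
  then have "reduced (v @ [inv_letter x])" using assms by simp
  then have "rmul v (inv_letter x) = v @ [inv_letter x]"
    by (auto simp: rmul_def reduced_snoc)
  then show ?thesis using del assms by simp
qed

lemma rmul_rmul:
  assumes "reduced u" shows "rmul (rmul u (k, b)) (k, \<not> b) = u"
  using rmul_inverse[OF assms refl, of "(k, b)"] unfolding inv_letter_def fst_conv snd_conv by (rule sym)

text \<open>One end of an edge is the other with one more letter. Hence a bound on the letters in a
  set of vertices also bounds the labels of the edges inside it.\<close>

lemma rmul_letter: "(k, b) \<in> set (rmul u (k, b)) \<or> (k, \<not> b) \<in> set u"
  by (cases rule: rmul_cases[of u "(k, b)"]) (auto simp: inv_letter_def, metis in_set_conv_decomp)

section \<open>Branches of the Cayley tree\<close>

definition extensions :: "word \<Rightarrow> word set" where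
  "extensions v = range ((@) v)"

lemma extensions_iff: "x \<in> extensions v \<longleftrightarrow> (\<exists>z. x = v @ z)"
  by (auto simp: extensions_def)

text \<open>The tree property in terms of words: the branch behind \<open>v\<close>, as seen from
  the root, is left only through the edge from \<open>v\<close> to its parent.\<close>

lemma leave_extensions:
  assumes "x \<in> extensions v" "rmul x l \<notin> extensions v" "v = p @ [y]"
  shows "x = v \<and> rmul x l = p \<and> y = inv_letter l"
proof (cases rule: rmul_cases[of x l])
  case app
  then have "rmul x l \<in> extensions v" using assms(1) unfolding extensions_iff by (metis append.assoc)
  then show ?thesis using assms(2) by blast
next
  case del
  obtain z where z: "x = v @ z" using assms(1) unfolding extensions_iff by blast
  show ?thesis
  proof (cases z rule: rev_cases)
    case Nil
    then have "p @ [y] = rmul x l @ [inv_letter l]" using del z assms(3) by (metis append_Nil2)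
    then have "p = rmul x l" "y = inv_letter l" by (metis append1_eq_conv)+
    then show ?thesis using Nil z by simp
  next
    case (snoc z' a)
    then have "(v @ z') @ [a] = rmul x l @ [inv_letter l]" using del z by simp
    then have "rmul x l = v @ z'" by simp
    then show ?thesis using assms(2) unfolding extensions_iff by blast
  qed
qed

text \<open>The only edge entering the branch is labeled \<open>k\<close>, so edges with other
  labels do not cross its boundary.\<close>

lemma rmul_extensions_iff:
  assumes "reduced x" "v = p @ [(k, c)]" "s \<noteq> k"
  shows "rmul x (s, b) \<in> extensions v \<longleftrightarrow> x \<in> extensions v"
proof -
  have *: "(k, c) \<noteq> inv_letter (s, b)" for b using assms(3) by (simp add: inv_letter_def)
  have "x = rmul (rmul x (s, b)) (inv_letter (s, b))" using rmul_inverse[OF assms(1)] by blast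
  then show ?thesis
    using leave_extensions[of x v "(s, b)", OF _ _ assms(2)]
      leave_extensions[of "rmul x (s, b)" v "inv_letter (s, b)", OF _ _ assms(2)] *[of b] *[of "\<not> b"]
    by (metis fst_conv inv_letter_def snd_conv)
qed

section \<open>Lines in the direction of a generator\<close>

lemma gen_power_Suc:
  "freduce (u @ gen_power s (r + 1)) = rmul (freduce (u @ gen_power s r)) (s, True)"
proof (cases "0 \<le> r")
  case True
  then have "nat \<bar>r + 1\<bar> = Suc (nat \<bar>r\<bar>)" by auto
  then have "gen_power s (r + 1) = gen_power s r @ [(s, True)]"
    using True by (simp add: gen_power_def replicate_append_same)
  then show ?thesis by (simp add: freduce_append_snoc)
next
  \<comment> \<open>For negative exponents the power gets shorter, so the equation is obtained by
    inverting a step. The case \<open>r + 1 = 0\<close> is special because the sign flag changes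
    there, where the power is empty.\<close>
  case False
  then have "nat \<bar>r\<bar> = Suc (nat \<bar>r + 1\<bar>)" by auto
  then have "gen_power s r = gen_power s (r + 1) @ [(s, False)]"
    using False by (cases "r + 1 = 0") (simp_all add: gen_power_def replicate_append_same)
  then have "freduce (u @ gen_power s r) = rmul (freduce (u @ gen_power s (r + 1))) (s, False)"
    by (simp add: freduce_append_snoc)
  then show ?thesis
    using rmul_rmul[OF reduced_freduce, of "u @ gen_power s (r + 1)" s False] by simp
qed

lemma L_line_rmul:
  assumes "v \<in> L_line u s" shows "rmul v (s, b) \<in> L_line u s"
proof -
  obtain r where r: "v = freduce (u @ gen_power s r)" using assms unfolding L_line_def by blast
  show ?thesis
  proof (cases b)
    case True
    then have "rmul v (s, b) = freduce (u @ gen_power s (r + 1))" by (simp add: gen_power_Suc r)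
    then show ?thesis unfolding L_line_def by blast
  next
    case False
    have "v = rmul (freduce (u @ gen_power s (r - 1))) (s, True)"
      using gen_power_Suc[of u s "r - 1"] r by simp
    then have "rmul v (s, b) = freduce (u @ gen_power s (r - 1))"
      using rmul_rmul[OF reduced_freduce, of "u @ gen_power s (r - 1)" s True] False by simp
    then show ?thesis unfolding L_line_def by blast
  qed
qed

lemma L_line_self: "reduced u \<Longrightarrow> u \<in> L_line u s"
  unfolding L_line_def by (auto simp: gen_power_def freduce_reduced intro!: exI[of _ 0])

text \<open>Induction along the line in both directions; as the step is an equivalence, the positive
  letter suffices.\<close>

lemma L_line_induct:
  assumes v: "v \<in> L_line u s" and u: "reduced u"
    and step: "\<And>x. reduced x \<Longrightarrow> P (rmul x (s, True)) \<longleftrightarrow> P x"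
  shows "P v \<longleftrightarrow> P u"
proof -
  have "P (freduce (u @ gen_power s r)) \<longleftrightarrow> P u" for r
  proof (induction r rule: int_induct[where k = 0])
    case base
    then show ?case using u by (simp add: gen_power_def freduce_reduced)
  next
    case (step1 r)
    then show ?case using step reduced_freduce by (simp add: gen_power_Suc)
  next
    case (step2 r)
    then show ?case using step[OF reduced_freduce] gen_power_Suc[of u s "r - 1"] by simp
  qed
  then show ?thesis using v unfolding L_line_def by blast
qed

lemma L_line_extensions_iff:
  assumes "v \<in> L_line u s" "reduced u" "s \<noteq> k"
  shows "v \<in> extensions (p @ [(k, c)]) \<longleftrightarrow> u \<in> extensions (p @ [(k, c)])"
  by (rule L_line_induct[OF assms(1,2)]) (rule rmul_extensions_iff[OF _ refl assms(3)])

text \<open>Connectedness of a set of vertices of the Cayley tree, stated as for topological spaces.\<close>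

definition edge_connected :: "word set \<Rightarrow> bool" where
  "edge_connected S \<longleftrightarrow> (\<forall>x\<in>S. reduced x) \<and>
    (\<forall>A. S \<inter> A \<noteq> {} \<longrightarrow> S - A \<noteq> {} \<longrightarrow> (\<exists>x\<in>S \<inter> A. \<exists>l. rmul x l \<in> S - A))"

text \<open>A connected set that meets a branch and its complement must contain both ends of the one
  edge joining them.\<close>

lemma edge_connected_extensions:
  assumes "edge_connected S" "x \<in> S" "x \<in> extensions (p @ [y])" "x' \<in> S" "x' \<notin> extensions (p @ [y])"
  shows "p \<in> S" "p @ [y] \<in> S"
proof -
  obtain z l where z: "z \<in> S" "z \<in> extensions (p @ [y])" "rmul z l \<in> S" "rmul z l \<notin> extensions (p @ [y])"
    using assms unfolding edge_connected_def by blast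
  then show "p \<in> S" "p @ [y] \<in> S" using leave_extensions[OF z(2,4) refl] by auto
qed

text \<open>Reversing an edge exchanges the two sides of a cut, so only cuts with \<open>x0\<close>
  on the side of \<open>A\<close> have to be examined.\<close>

lemma edge_connectedI:
  assumes "\<And>x. x \<in> S \<Longrightarrow> reduced x"
    and "\<And>A x. x0 \<in> S \<inter> A \<Longrightarrow> x \<in> S - A \<Longrightarrow> \<exists>x\<in>S \<inter> A. \<exists>l. rmul x l \<in> S - A"
    and "x0 \<in> S"
  shows "edge_connected S"
  unfolding edge_connected_def
proof (intro conjI ballI allI impI)
  fix A assume "S \<inter> A \<noteq> {}" "S - A \<noteq> {}"
  then obtain a b where ab: "a \<in> S \<inter> A" "b \<in> S - A" by blast
  show "\<exists>x\<in>S \<inter> A. \<exists>l. rmul x l \<in> S - A"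
  proof (cases "x0 \<in> A")
    case True
    then show ?thesis using assms(2)[of A b] assms(3) ab by blast
  next
    case False
    then obtain x l where x: "x \<in> S - A" "rmul x l \<in> S \<inter> A"
      using assms(2)[of "- A" a] assms(3) ab by blast
    moreover have "rmul (rmul x l) (inv_letter l) = x"
      using rmul_inverse[of x "rmul x l" l] assms(1) x by simp
    ultimately show ?thesis by metis
  qed
qed (rule assms(1))

section \<open>Levels along the ray\<close>

lemma alternating_prefix: "m \<le> n \<Longrightarrow> extensions (alternating n) \<subseteq> extensions (alternating m)"
proof -
  assume "m \<le> n"
  then have "[0..<n] = [0..<m] @ [m..<n]" by (metis le_add_diff_inverse upt_add_eq_append zero_le)
  then have "alternating n = alternating m @ map (\<lambda>k. (if even k then 1 else 2, True)) [m..<n]"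
    by (simp add: alternating_def)
  then show ?thesis by (auto simp: extensions_iff)
qed

lemma alternating_Suc: "alternating (Suc m) = alternating m @ [(if even m then 1 else 2, True)]"
  by (simp add: alternating_def)

lemma reduced_alternating: "reduced (alternating m)"
proof (induction m)
  case (Suc m)
  then show ?case
    unfolding alternating_Suc reduced_snoc
    by (auto simp: inv_letter_def alternating_def last_map)
qed (simp add: alternating_def)

lemma alternating_letters: "x \<in> set (alternating m) \<Longrightarrow> fst x \<in> {1, 2}"
  by (auto simp: alternating_def split: if_splits)

lemma length_alternating [simp]: "length (alternating m) = m"
  by (simp add: alternating_def)

lemma alternating_in_extensions_iff: "alternating m \<in> extensions (alternating n) \<longleftrightarrow> n \<le> m"
proof
  assume "alternating m \<in> extensions (alternating n)"
  then obtain z where "alternating m = alternating n @ z" unfolding extensions_iff by blast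
  then have "length (alternating m) = length (alternating n @ z)" by simp
  then show "n \<le> m" by simp
next
  assume "n \<le> m"
  then show "alternating m \<in> extensions (alternating n)"
    using alternating_prefix[of n m] by (auto simp: extensions_def)
qed

text \<open>Call the largest \<open>m\<close> with \<open>x \<in> extensions (alternating m)\<close>
  the level of \<open>x\<close>; it tells where the path from the root leaves the ray. The branches
  along the ray are nested, each with a single entry edge, so one step lowers the level by at most
  one.\<close>

lemma rmul_ray_lower:
  assumes "x \<in> extensions (alternating m)" shows "rmul x l \<in> extensions (alternating (m - 1))"
proof (cases "m = 0 \<or> rmul x l \<in> extensions (alternating m)")
  case True
  then show ?thesis
  proof
    assume "m = 0"
    then show ?thesis by (simp add: extensions_iff alternating_def)
  next
    assume "rmul x l \<in> extensions (alternating m)"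
    then show ?thesis using alternating_prefix[of "m - 1" m] by auto
  qed
next
  case False
  then obtain n where n: "m = Suc n" by (cases m) auto
  have "rmul x l = alternating n"
    using leave_extensions[OF assms] False alternating_Suc[of n] n by blast
  then show ?thesis using n by (auto simp: extensions_iff)
qed

lemma rmul_ray_upper:
  assumes "reduced x" "x \<notin> extensions (alternating m)" shows "rmul x l \<notin> extensions (alternating (Suc m))"
proof
  assume "rmul x l \<in> extensions (alternating (Suc m))"
  then have "rmul (rmul x l) (inv_letter l) \<in> extensions (alternating (Suc m - 1))"
    by (rule rmul_ray_lower)
  then show False using assms rmul_inverse[OF assms(1) refl, of l] by simp
qed

text \<open>A line in direction \<open>a\<^sub>s\<close> contains at most one edge of the ray, as consecutive edges of the ray
  have different labels.\<close>

lemma L_line_ray_aux: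
  assumes v: "v \<in> L_line u s" "reduced u"
    and "(v \<in> extensions (alternating m)) \<noteq> (u \<in> extensions (alternating m))"
    and "(v \<in> extensions (alternating (Suc m))) \<noteq> (u \<in> extensions (alternating (Suc m)))"
  shows False
proof -
  have "m \<noteq> 0"
  proof
    assume "m = 0"
    then show False using assms(3) by (simp add: extensions_iff alternating_def)
  qed
  then obtain n where n: "m = Suc n" by (cases m) auto
  have "s = (if even i then 1 else 2)"
    if "(v \<in> extensions (alternating (Suc i))) \<noteq> (u \<in> extensions (alternating (Suc i)))" for i
    using L_line_extensions_iff[OF v, of "if even i then 1 else 2" "alternating i" True] that
    unfolding alternating_Suc by argo
  from this[of m] this[of n] have "s = (if even m then 1 else 2)" "s = (if even n then 1 else 2)"
    using assms(3,4) n by auto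
  then show False using n by (simp split: if_splits)
qed

lemma L_line_ray_lower:
  assumes "v \<in> L_line u s" "reduced u" "u \<in> extensions (alternating m)"
  shows "v \<in> extensions (alternating (m - 1))"
proof (cases m)
  case 0
  then show ?thesis by (simp add: extensions_iff alternating_def)
next
  case (Suc n)
  then show ?thesis
    using L_line_ray_aux[OF assms(1,2), of n] assms(3) alternating_prefix[of n m] by auto
qed

lemma L_line_ray_upper:
  assumes "v \<in> L_line u s" "reduced u" "u \<notin> extensions (alternating m)"
  shows "v \<notin> extensions (alternating (Suc m))"
  using L_line_ray_aux[OF assms(1,2), of m] assms(3) alternating_prefix[of m "Suc m"] by auto

text \<open>The ray uses only the labels 1 and 2, so a path has left it before any other letter is
  read; the level is decided by \<open>p\<close>.\<close>

lemma extensions_alternating_big_letter: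
  assumes "k \<notin> {1, 2}"
  shows "p @ (k, b) # y \<in> extensions (alternating m) \<longleftrightarrow> p \<in> extensions (alternating m)"
proof
  assume "p @ (k, b) # y \<in> extensions (alternating m)"
  then obtain z where z: "p @ (k, b) # y = alternating m @ z" unfolding extensions_iff by blast
  then consider us where "p = alternating m @ us" | us where "p @ us = alternating m" "us \<noteq> []" "(k, b) # y = us @ z"
    unfolding append_eq_append_conv2 by force
  then show "p \<in> extensions (alternating m)"
  proof cases
    case 1 then show ?thesis unfolding extensions_iff by blast
  next
    case 2
    then have "(k, b) \<in> set (alternating m)" by (metis Cons_eq_append_conv in_set_conv_decomp)
    then show ?thesis using alternating_letters assms by fastforce
  qed
next
  assume "p \<in> extensions (alternating m)"
  then show "p @ (k, b) # y \<in> extensions (alternating m)" unfolding extensions_iff by auto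
qed

section \<open>The sets \<open>Y\<^sub>j\<close>\<close>

locale word_list =
  fixes w :: "nat \<Rightarrow> word"
  assumes w_words: "\<And>j. 1 \<le> j \<Longrightarrow> w j \<in> all_words"
begin

lemma n_of:
  assumes "1 \<le> j" shows "2 \<le> n_of w j" "w j \<in> words_upto (n_of w j)"
proof -
  obtain n where "w j \<in> words_upto n" using w_words[OF assms] by (auto simp: all_words_def)
  then have "w j \<in> words_upto (max 2 n)" by (force simp: words_upto_def lists_eq_set)
  then have "\<exists>n. 2 \<le> n \<and> w j \<in> words_upto n" by (metis max.cobounded1)
  then have "2 \<le> n_of w j \<and> w j \<in> words_upto (n_of w j)" unfolding n_of_def by (rule LeastI_ex)
  then show "2 \<le> n_of w j" "w j \<in> words_upto (n_of w j)" by auto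
qed

definition ray_height :: "nat \<Rightarrow> nat" where
  "ray_height j = 2 * (\<Sum>k\<in>{1..<j}. length (w k)) + 3 * j + length (w j)"

lemma w_hat_eq: "w_hat w j = alternating (ray_height j)"
  by (simp add: w_hat_def ray_height_def)

lemma Z_reduced: "x \<in> Z_set w j \<Longrightarrow> reduced x"
  by (auto simp: Z_set_def reduced_freduce)

lemma w_hat_in_Z: "alternating (ray_height j) \<in> Z_set w j"
  unfolding Z_set_def w_hat_eq[symmetric]
  using freduce_reduced[OF reduced_alternating[of "ray_height j"]]
  by (auto simp: w_hat_eq intro!: exI[of _ 0])

lemma Z_step:
  assumes "i < length (w j)"
  shows "freduce (w_hat w j @ take (Suc i) (w j)) = rmul (freduce (w_hat w j @ take i (w j))) (w j ! i)"
  using assms by (simp add: take_Suc_conv_app_nth freduce_append_snoc)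

lemma Z_connected: "edge_connected (Z_set w j)"
proof (rule edge_connectedI[OF Z_reduced _ w_hat_in_Z])
  fix A x assume A: "alternating (ray_height j) \<in> Z_set w j \<inter> A" "x \<in> Z_set w j - A"
  define z where "z = (\<lambda>i. freduce (w_hat w j @ take i (w j)))"
  have z0: "z 0 = alternating (ray_height j)"
    unfolding z_def by (simp add: w_hat_eq freduce_reduced reduced_alternating)
  have zZ: "z i \<in> Z_set w j" if "i \<le> length (w j)" for i using that by (auto simp: z_def Z_set_def)
  show "\<exists>x\<in>Z_set w j \<inter> A. \<exists>l. rmul x l \<in> Z_set w j - A"
  proof (rule ccontr)
    assume no: "\<not> ?thesis"
    have "z i \<in> A" if "i \<le> length (w j)" for i
      using that
    proof (induction i)
      case 0
      then show ?case using A z0 by simp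
    next
      case (Suc i)
      have zS: "z (Suc i) = rmul (z i) (w j ! i)" unfolding z_def by (rule Z_step) (use Suc in simp)
      show ?case
      proof (rule ccontr)
        assume "z (Suc i) \<notin> A"
        then have "rmul (z i) (w j ! i) \<in> Z_set w j - A" "z i \<in> Z_set w j \<inter> A"
          using Suc zZ[of i] zZ[of "Suc i"] zS by auto
        then show False using no by blast
      qed
    qed
    then show False using A(2) by (auto simp: Z_set_def z_def)
  qed
qed

text \<open>\<open>Z_set w j\<close> is traced by a path of \<open>length (w j)\<close> steps
  starting on the ray, and every step shifts the level by at most one.\<close>

lemma Z_ray:
  assumes "x \<in> Z_set w j"
  shows "x \<in> extensions (alternating (ray_height j - length (w j)))"
    and "x \<notin> extensions (alternating (Suc (ray_height j + length (w j))))"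
proof -
  have *: "freduce (w_hat w j @ take i (w j)) \<in> extensions (alternating (ray_height j - i)) \<and>
     freduce (w_hat w j @ take i (w j)) \<notin> extensions (alternating (Suc (ray_height j + i)))"
    if "i \<le> length (w j)" for i
    using that
  proof (induction i)
    case 0
    then show ?case
      by (simp add: w_hat_eq freduce_reduced reduced_alternating alternating_in_extensions_iff)
  next
    case (Suc i)
    then show ?case
      using rmul_ray_lower[of "freduce (w_hat w j @ take i (w j))" "ray_height j - i"]
        rmul_ray_upper[OF reduced_freduce, of "w_hat w j @ take i (w j)" "Suc (ray_height j + i)"]
      by (simp add: Z_step)
  qed
  obtain i where i: "i \<le> length (w j)" "x = freduce (w_hat w j @ take i (w j))"
    using assms by (auto simp: Z_set_def)
  have "extensions (alternating (ray_height j - i)) \<subseteq> extensions (alternating (ray_height j - length (w j)))"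
    "extensions (alternating (Suc (ray_height j + length (w j)))) \<subseteq> extensions (alternating (Suc (ray_height j + i)))"
    using i(1) by (auto intro!: alternating_prefix)
  then show "x \<in> extensions (alternating (ray_height j - length (w j)))"
    "x \<notin> extensions (alternating (Suc (ray_height j + length (w j))))"
    using *[OF i(1)] i(2) by auto
qed

lemma Y_cases:
  assumes "x \<in> Y_set w j" "1 \<le> j"
  obtains u s where "u \<in> Z_set w j" "1 \<le> s" "s \<le> n_of w j" "x \<in> L_line u s"
proof (cases "x \<in> Z_set w j")
  case True
  then show ?thesis using that[of x 1] n_of[OF assms(2)] L_line_self Z_reduced by simp
next
  case False
  then show ?thesis using assms(1) that unfolding Y_set_def by auto
qed

lemma Y_reduced: "x \<in> Y_set w j \<Longrightarrow> reduced x"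
  by (auto simp: Y_set_def Z_set_def L_line_def reduced_freduce)

lemma Z_subset_Y: "Z_set w j \<subseteq> Y_set w j"
  by (simp add: Y_set_def)

lemma L_line_subset_Y: "u \<in> Z_set w j \<Longrightarrow> 1 \<le> s \<Longrightarrow> s \<le> n_of w j \<Longrightarrow> L_line u s \<subseteq> Y_set w j"
  unfolding Y_set_def by auto

text \<open>If the cut splits \<open>Z_set w j\<close>, connectedness of that path yields the edge.
  Otherwise all of it lies in \<open>A\<close>, and without an edge across the cut membership in
  \<open>A\<close> would spread from \<open>u\<close> along a line to \<open>x\<close>.\<close>

lemma Y_connected:
  assumes j: "1 \<le> j" shows "edge_connected (Y_set w j)"
proof (rule edge_connectedI[OF Y_reduced])
  show "alternating (ray_height j) \<in> Y_set w j" using w_hat_in_Z Z_subset_Y by blast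
  fix A x assume A: "alternating (ray_height j) \<in> Y_set w j \<inter> A" "x \<in> Y_set w j - A"
  show "\<exists>x\<in>Y_set w j \<inter> A. \<exists>l. rmul x l \<in> Y_set w j - A"
  proof (cases "Z_set w j \<subseteq> A")
    case False
    then have "Z_set w j \<inter> A \<noteq> {}" "Z_set w j - A \<noteq> {}" using A w_hat_in_Z by blast+
    then obtain x l where "x \<in> Z_set w j \<inter> A" "rmul x l \<in> Z_set w j - A"
      using Z_connected unfolding edge_connected_def by meson
    then show ?thesis using Z_subset_Y by blast
  next
    case True
    obtain u s where u: "u \<in> Z_set w j" "1 \<le> s" "s \<le> n_of w j" "x \<in> L_line u s"
      using Y_cases[OF _ j] A(2) by blast
    show ?thesis
    proof (rule ccontr)
      assume no: "\<not> ?thesis"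
      have LY: "L_line u s \<subseteq> Y_set w j" using L_line_subset_Y u by blast
      have stay: "rmul y l \<in> A" if "y \<in> A" "y \<in> L_line u s" "rmul y l \<in> L_line u s" for y l
      proof (rule ccontr)
        assume "rmul y l \<notin> A"
        then have "rmul y l \<in> Y_set w j - A" "y \<in> Y_set w j \<inter> A" using that LY by auto
        then show False using no by blast
      qed
      have step: "(rmul y (s, True) \<in> L_line u s \<inter> A) \<longleftrightarrow> (y \<in> L_line u s \<inter> A)" if "reduced y" for y
      proof -
        have e: "y = rmul (rmul y (s, True)) (s, False)"
          using rmul_rmul[OF that, of s True] by simp
        show ?thesis
        proof
          assume a: "rmul y (s, True) \<in> L_line u s \<inter> A"
          then have "y \<in> L_line u s" using L_line_rmul[of "rmul y (s, True)" u s False] e by simp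
          moreover from this have "y \<in> A" using stay[of "rmul y (s, True)" "(s, False)"] a e by simp
          ultimately show "y \<in> L_line u s \<inter> A" by blast
        next
          assume a: "y \<in> L_line u s \<inter> A"
          then have "rmul y (s, True) \<in> L_line u s" using L_line_rmul by blast
          moreover from this have "rmul y (s, True) \<in> A" using stay a by blast
          ultimately show "rmul y (s, True) \<in> L_line u s \<inter> A" by blast
        qed
      qed
      have "x \<in> L_line u s \<inter> A \<longleftrightarrow> u \<in> L_line u s \<inter> A"
        by (rule L_line_induct[OF u(4) Z_reduced[OF u(1)]]) (rule step)
      then show False using u True A(2) L_line_self[OF Z_reduced[OF u(1)]] by blast
    qed
  qed
qed

text \<open>\<open>Y\<^sub>j\<close> leaves the ray at levels between \<open>ray_start j\<close> and \<open>ray_start (j + 1) - 1\<close>; this is what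
  the length of \<open>w_hat w j\<close> is chosen for.\<close>

definition ray_start :: "nat \<Rightarrow> nat" where
  "ray_start j = 2 * (\<Sum>k\<in>{1..<j}. length (w k)) + 3 * j - 1"

lemma ray_start_mono: "1 \<le> j \<Longrightarrow> j \<le> j' \<Longrightarrow> ray_start j \<le> ray_start j'"
proof -
  assume "1 \<le> j" "j \<le> j'"
  then have "(\<Sum>k\<in>{1..<j}. length (w k)) \<le> (\<Sum>k\<in>{1..<j'}. length (w k))"
    by (intro sum_mono2) auto
  then show ?thesis using \<open>j \<le> j'\<close> by (simp add: ray_start_def diff_le_mono)
qed

lemma Y_ray:
  assumes "x \<in> Y_set w j" "1 \<le> j"
  shows "x \<in> extensions (alternating (ray_start j))"
    and "x \<notin> extensions (alternating (ray_start (Suc j)))"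
proof -
  obtain u s where u: "u \<in> Z_set w j" "x \<in> L_line u s" using Y_cases[OF assms] by blast
  note Z = Z_ray[OF u(1)]
  \<comment> \<open>The lines add one level on either side of those reached by
    \<open>Z_set w j\<close>. Thus \<open>2 * length (w j) + 3\<close> consecutive levels are
    reserved for index \<open>j\<close>, which explains the factor 2 and the term
    \<open>3 * j\<close> in the definition.\<close>
  have 1: "ray_height j - length (w j) - 1 = ray_start j"
    by (simp add: ray_height_def ray_start_def)
  have 2: "Suc (Suc (ray_height j + length (w j))) = ray_start (Suc j)"
    using assms(2) by (simp add: ray_height_def ray_start_def)
  show "x \<in> extensions (alternating (ray_start j))"
    using L_line_ray_lower[OF u(2) Z_reduced[OF u(1)] Z(1)] 1 by simp
  show "x \<notin> extensions (alternating (ray_start (Suc j)))"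
    using L_line_ray_upper[OF u(2) Z_reduced[OF u(1)] Z(2)] 2 by simp
qed

text \<open>Equal levels are required instead of a common vertex because \<open>Y_convex\<close>
  compares a vertex with one of its prefixes.\<close>

lemma ray_level_unique:
  assumes "x \<in> Y_set w j" "1 \<le> j" "y \<in> Y_set w j'" "1 \<le> j'"
    and same: "\<And>m. x \<in> extensions (alternating m) \<longleftrightarrow> y \<in> extensions (alternating m)"
  shows "j = j'"
proof -
  have *: "\<not> j < j'" if "x \<in> Y_set w j" "1 \<le> j" "y \<in> Y_set w j'" "1 \<le> j'"
    "\<And>m. x \<in> extensions (alternating m) \<longleftrightarrow> y \<in> extensions (alternating m)" for x y j j'
  proof
    assume "j < j'"
    then have "ray_start (Suc j) \<le> ray_start j'" by (intro ray_start_mono) auto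
    then have "y \<in> extensions (alternating (ray_start (Suc j)))"
      using Y_ray(1)[OF that(3,4)] alternating_prefix by blast
    then show False using that(5) Y_ray(2)[OF that(1,2)] by blast
  qed
  show ?thesis
    using *[OF assms] *[OF assms(3,4,1,2)] same by (metis linorder_neqE_nat)
qed

lemma Y_disjoint: "x \<in> Y_set w j \<Longrightarrow> 1 \<le> j \<Longrightarrow> x \<in> Y_set w j' \<Longrightarrow> 1 \<le> j' \<Longrightarrow> j = j'"
  by (rule ray_level_unique) auto

text \<open>Letters come from the ray, from \<open>w j\<close> and from the lines; the condition
  \<open>2 \<le> n\<close> in \<open>n_of\<close> takes care of the ray. Reduction creates no new
  letters.\<close>

lemma Y_letters:
  assumes "x \<in> Y_set w j" "1 \<le> j" "l \<in> set x"
  shows "1 \<le> fst l" "fst l \<le> n_of w j"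
proof -
  obtain u s where u: "u \<in> Z_set w j" "1 \<le> s" "s \<le> n_of w j" "x \<in> L_line u s"
    using Y_cases[OF assms(1,2)] by blast
  obtain i where i: "u = freduce (w_hat w j @ take i (w j))" using u(1) by (auto simp: Z_set_def)
  obtain r where r: "x = freduce (u @ gen_power s r)" using u(4) by (auto simp: L_line_def)
  have "l \<in> set u \<union> set (gen_power s r)" using set_freduce[of "u @ gen_power s r"] assms(3) r by auto
  then have "l \<in> set (w_hat w j) \<union> set (w j) \<union> {(s, 0 \<le> r)}"
    using set_freduce[of "w_hat w j @ take i (w j)"] i
    by (auto simp: gen_power_def dest: in_set_takeD split: if_splits)
  then have "1 \<le> fst l \<and> fst l \<le> n_of w j"
    using n_of[OF assms(2)] u(2,3) alternating_letters[of l "ray_height j"]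
    by (auto simp: w_hat_eq words_upto_def)
  then show "1 \<le> fst l" "fst l \<le> n_of w j" by auto
qed

lemma Y_rmul_label:
  assumes "x \<in> Y_set w j" "1 \<le> j" "rmul x (k, b) \<in> Y_set w j"
  shows "1 \<le> k" "k \<le> n_of w j"
  using rmul_letter[of k b x] Y_letters[OF assms(1,2), of "(k, \<not> b)"] Y_letters[OF assms(3,2), of "(k, b)"]
  by auto

text \<open>If \<open>v\<close> and \<open>v a\<^sub>k\<close> lie on lines through \<open>Z_set w j\<close> in directions other than \<open>a\<^sub>k\<close>, then removing the
  edge between them separates two points of \<open>Z_set w j\<close>. So that edge is an edge of the connected set
  \<open>Z_set w j\<close>, or one of the two lines has direction \<open>a\<^sub>k\<close>.\<close>

lemma Y_symmetric:
  assumes v: "v \<in> Y_set w j" and j: "1 \<le> j" and v': "rmul v (k, b) \<in> Y_set w j"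
  shows "rmul v (k, b') \<in> Y_set w j"
proof -
  note k = Y_rmul_label[OF v j v']
  have inv: "v = rmul (rmul v (k, b)) (k, \<not> b)"
    using rmul_rmul[OF Y_reduced[OF v]] by simp
  have "\<exists>u\<in>Z_set w j. v \<in> L_line u k"
  proof (rule ccontr)
    assume no: "\<not> ?thesis"
    let ?v' = "rmul v (k, b)"
    have vZ: "v \<notin> Z_set w j" using no L_line_self Z_reduced by blast
    have no': "?v' \<notin> L_line u k" if "u \<in> Z_set w j" for u
      using no that L_line_rmul[of ?v' u k "\<not> b"] inv by auto
    have v'Z: "?v' \<notin> Z_set w j" using no' L_line_self Z_reduced by blast
    obtain u s where u: "u \<in> Z_set w j" "v \<in> L_line u s" using Y_cases[OF v j] by blast
    obtain u' s' where u': "u' \<in> Z_set w j" "?v' \<in> L_line u' s'" using Y_cases[OF v' j] by blast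
    have s: "s \<noteq> k" "s' \<noteq> k" using no no' u u' by auto
    obtain p c where p: "{v, ?v'} = {p, p @ [(k, c)]}"
      by (cases rule: rmul_cases[of v "(k, b)"]) (force simp: inv_letter_def)+
    let ?D = "extensions (p @ [(k, c)])"
    have "p \<notin> ?D" "p @ [(k, c)] \<in> ?D" by (auto simp: extensions_iff)
    then have "(v \<in> ?D) \<noteq> (?v' \<in> ?D)" using p by (auto simp: doubleton_eq_iff)
    then have "(u \<in> ?D) \<noteq> (u' \<in> ?D)"
      using L_line_extensions_iff[OF u(2) Z_reduced[OF u(1)] s(1)]
        L_line_extensions_iff[OF u'(2) Z_reduced[OF u'(1)] s(2)] by blast
    then have "p \<in> Z_set w j"
      using edge_connected_extensions(1)[OF Z_connected] u(1) u'(1) by blast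
    then show False using p vZ v'Z by (auto simp: doubleton_eq_iff)
  qed
  then show ?thesis using L_line_rmul L_line_subset_Y k by blast
qed

text \<open>A connected set lies wholly behind the edge through which it is entered from the root.
  So this edge is on the path to \<open>w_hat w j\<close>, all of whose labels are 1 or 2.\<close>

lemma Y_root:
  assumes j: "1 \<le> j" and "p \<notin> Y_set w j" "p @ [(k, b)] \<in> Y_set w j"
  shows "k \<in> {1, 2}"
proof (rule ccontr)
  assume k: "k \<notin> {1, 2}"
  have "alternating (ray_height j) \<notin> extensions (p @ [(k, b)])"
  proof
    assume "alternating (ray_height j) \<in> extensions (p @ [(k, b)])"
    then have "(k, b) \<in> set (alternating (ray_height j))" by (auto simp: extensions_iff)
    then show False using alternating_letters k by fastforce
  qed
  moreover have "alternating (ray_height j) \<in> Y_set w j" using w_hat_in_Z Z_subset_Y by blast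
  moreover have "p @ [(k, b)] \<in> extensions (p @ [(k, b)])" by (auto simp: extensions_iff)
  ultimately show False using edge_connected_extensions(1)[OF Y_connected[OF j]] assms by blast
qed

text \<open>\<open>x\<close> and its prefix \<open>p\<close> have the same level, which forces
  \<open>j = i\<close>; connectedness then puts the edge leaving \<open>p\<close> towards
  \<open>x\<close> into the set.\<close>

lemma Y_convex:
  assumes "x \<in> Y_set w j" "1 \<le> j" "p \<in> Y_set w i" "1 \<le> i" "x = p @ (k, b) # y" "k \<notin> {1, 2}"
  shows "p @ [(k, b)] \<in> Y_set w i"
proof -
  have "j = i"
    by (rule ray_level_unique[OF assms(1-4)]) (use extensions_alternating_big_letter assms(5,6) in simp)
  moreover have "x \<in> extensions (p @ [(k, b)])" "p \<notin> extensions (p @ [(k, b)])"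
    using assms(5) by (auto simp: extensions_iff)
  ultimately show ?thesis
    using edge_connected_extensions(2)[OF Y_connected[OF assms(4)]] assms(1,3) by blast
qed

end

section \<open>The pruned trees\<close>

lemma cayley_simps [simp]: "tail cayley = fst" "verts cayley = {v \<in> all_words. reduced v}"
  "arcs cayley = {v \<in> all_words. reduced v} \<times> {1..}"
  by (simp_all add: cayley_def)

lemma head_cayley: "reduced u \<Longrightarrow> head cayley (u, i) = rmul u (i, True)"
  by (simp add: cayley_def freduce_snoc)

lemma rmul_all_words: "u \<in> all_words \<Longrightarrow> 1 \<le> k \<Longrightarrow> rmul u (k, b) \<in> all_words"
  by (auto simp: rmul_def all_words_iff dest: in_set_butlastD)

definition subtree :: "word set \<Rightarrow> graph" where
  "subtree V = cayley \<restriction> V"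

text \<open>Closure under prefixes keeps the path from the root to each vertex inside the set; this
  is how subtrees are recognised.\<close>

definition vertex_subset :: "word set \<Rightarrow> bool" where
  "vertex_subset V \<longleftrightarrow> V \<subseteq> {v \<in> all_words. reduced v} \<and> (\<forall>u v. u @ v \<in> V \<longrightarrow> u \<in> V)"

lemma vertex_subsetD:
  assumes "vertex_subset V"
  shows "u \<in> V \<Longrightarrow> u \<in> all_words" "u \<in> V \<Longrightarrow> reduced u" "u @ v \<in> V \<Longrightarrow> u \<in> V"
  using assms by (auto simp: vertex_subset_def)

lemma subtree_simps [simp]: "verts (subtree V) = V" "tail (subtree V) = fst" "head (subtree V) = head cayley"
  by (simp_all add: subtree_def induce_subgraph_def)

lemma arcs_subtree:
  assumes "vertex_subset V"
  shows "arcs (subtree V) = {(u, i). u \<in> V \<and> 1 \<le> i \<and> rmul u (i, True) \<in> V}"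
  using assms by (auto simp: subtree_def induce_subgraph_def head_cayley vertex_subset_def)

lemma subtree_restrict: "W \<subseteq> V \<Longrightarrow> subtree V \<restriction> W = subtree W"
  by (auto simp: subtree_def induce_subgraph_def)

lemma subtree_UNIV: "cayley = subtree {v \<in> all_words. reduced v}"
proof -
  have "head cayley e \<in> {v \<in> all_words. reduced v}" if "e \<in> {v \<in> all_words. reduced v} \<times> {1..}" for e
  proof -
    obtain u i where e: "e = (u, i)" "u \<in> all_words" "reduced u" "1 \<le> i" using \<open>e \<in> _\<close> by auto
    show ?thesis using reduced_rmul[OF e(3)] rmul_all_words[OF e(2,4)] by (simp add: e(1) head_cayley[OF e(3)])
  qed
  then have "{e \<in> arcs cayley. tail cayley e \<in> {v \<in> all_words. reduced v} \<and> head cayley e \<in> {v \<in> all_words. reduced v}}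
      = arcs cayley" by auto
  then show ?thesis
    unfolding subtree_def induce_subgraph_def by (simp add: pre_digraph.equality)
qed

text \<open>An edge terminating at \<open>v\<close> is traversed backwards by an inverse letter, so
  both kinds of incidence turn into one multiplication.\<close>

lemma joined_subtree_iff:
  assumes V: "vertex_subset V" and v: "v \<in> V" and S: "S \<subseteq> V"
  shows "(\<exists>e\<in>arcs (subtree V). snd e \<in> I \<and> joined (subtree V) e v S) \<longleftrightarrow>
    (\<exists>i\<in>I. 1 \<le> i \<and> (\<exists>b. rmul v (i, b) \<in> S))"
proof
  assume "\<exists>e\<in>arcs (subtree V). snd e \<in> I \<and> joined (subtree V) e v S"
  then obtain u i where u: "u \<in> V" "1 \<le> i" "i \<in> I" "rmul u (i, True) \<in> V" "joined (subtree V) (u, i) v S"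
    by (auto simp: arcs_subtree[OF V])
  note r = vertex_subsetD(2)[OF V u(1)]
  from u(5) have "(u = v \<and> rmul u (i, True) \<in> S) \<or> (rmul u (i, True) = v \<and> u \<in> S)"
    by (simp add: joined_def head_cayley[OF r])
  then show "\<exists>i\<in>I. 1 \<le> i \<and> (\<exists>b. rmul v (i, b) \<in> S)"
  proof
    assume *: "rmul u (i, True) = v \<and> u \<in> S"
    then have "rmul v (i, False) \<in> S" using rmul_rmul[OF r, of i True] by simp
    then show ?thesis using u by blast
  qed (use u in blast)
next
  assume "\<exists>i\<in>I. 1 \<le> i \<and> (\<exists>b. rmul v (i, b) \<in> S)"
  then obtain i b where i: "i \<in> I" "1 \<le> i" "rmul v (i, b) \<in> S" by blast
  note r = vertex_subsetD(2)[OF V v]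
  show "\<exists>e\<in>arcs (subtree V). snd e \<in> I \<and> joined (subtree V) e v S"
  proof (cases b)
    case True
    then show ?thesis using i S v
      by (intro bexI[of _ "(v, i)"]) (auto simp: joined_def head_cayley[OF r] arcs_subtree[OF V])
  next
    case False
    let ?u = "rmul v (i, False)"
    have "rmul ?u (i, True) = v" using rmul_rmul[OF r, of i False] by simp
    then show ?thesis using i S v False
      by (intro bexI[of _ "(?u, i)"])
        (auto simp: joined_def head_cayley[OF reduced_rmul[OF r]] arcs_subtree[OF V])
  qed
qed

text \<open>By \<open>root\<close>, no cut vertex lies on the root side of \<open>S\<close>, so each
  is a child of a point of \<open>S\<close>. Conversely, a child outside \<open>S\<close> has no
  edge labeled 1 or 2 into \<open>S\<close>: the connected set \<open>S\<close> would reach into the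
  branch behind it without containing its entry edge.\<close>

lemma cut_verts_subtree:
  assumes V: "vertex_subset V" and S: "S \<subseteq> V" "edge_connected S"
    and root: "\<And>p k b. p \<notin> S \<Longrightarrow> p @ [(k, b)] \<in> S \<Longrightarrow> k \<in> {1, 2}"
  shows "cut_verts S (subtree V) = {v \<in> V. \<exists>p k b. v = p @ [(k, b)] \<and> p \<in> S \<and> v \<notin> S \<and> k \<notin> {1, 2}}"
proof -
  have "v \<in> cut_verts S (subtree V) \<longleftrightarrow> (\<exists>p k b. v = p @ [(k, b)] \<and> p \<in> S \<and> v \<notin> S \<and> k \<notin> {1, 2})"
    if v: "v \<in> V" for v
  proof -
    note r = vertex_subsetD(2)[OF V v]
    have cut: "v \<in> cut_verts S (subtree V) \<longleftrightarrow> v \<notin> S \<and> (\<exists>i b. 1 \<le> i \<and> rmul v (i, b) \<in> S)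
        \<and> \<not> (\<exists>i\<in>{1, 2}. 1 \<le> i \<and> (\<exists>b. rmul v (i, b) \<in> S))"
    proof -
      have "(\<exists>e\<in>arcs (subtree V). joined (subtree V) e v S) \<longleftrightarrow> (\<exists>i b. 1 \<le> i \<and> rmul v (i, b) \<in> S)"
        using joined_subtree_iff[OF V v S(1), of UNIV] by simp
      then show ?thesis
        unfolding cut_verts_def mem_Collect_eq joined_subtree_iff[OF V v S(1), of "{1, 2}"] using v by simp
    qed
    show ?thesis
    proof
      assume c: "v \<in> cut_verts S (subtree V)"
      then obtain i b where i: "v \<notin> S" "1 \<le> i" "rmul v (i, b) \<in> S" unfolding cut by blast
      have "i \<notin> {1, 2}" using c i unfolding cut by blast
      then show "\<exists>p k b. v = p @ [(k, b)] \<and> p \<in> S \<and> v \<notin> S \<and> k \<notin> {1, 2}"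
      proof (cases rule: rmul_cases[of v "(i, b)"])
        case app
        then show ?thesis using root[of v i b] i \<open>i \<notin> {1, 2}\<close> by simp
      next
        case del
        then have "v = rmul v (i, b) @ [(i, \<not> b)]" by (simp add: inv_letter_def)
        then show ?thesis using i \<open>i \<notin> {1, 2}\<close> by blast
      qed
    next
      assume "\<exists>p k b. v = p @ [(k, b)] \<and> p \<in> S \<and> v \<notin> S \<and> k \<notin> {1, 2}"
      then obtain p k b where p: "v = p @ [(k, b)]" "p \<in> S" "v \<notin> S" "k \<notin> {1, 2}" by blast
      have "1 \<le> k" using vertex_subsetD(1)[OF V v] p(1) by (auto simp: all_words_iff)
      moreover have "rmul v (k, \<not> b) = p" using p(1) by (simp add: rmul_def inv_letter_def)
      moreover have "rmul v (i, c) \<notin> S" if i: "i \<in> {1, 2}" for i c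
      proof
        assume a: "rmul v (i, c) \<in> S"
        have "rmul v (i, c) = v @ [(i, c)]" using p(1,4) i by (auto simp: rmul_def inv_letter_def)
        then have "rmul v (i, c) \<in> extensions (p @ [(k, b)])" using p(1) by (auto simp: extensions_iff)
        moreover have "p \<notin> extensions (p @ [(k, b)])" by (auto simp: extensions_iff)
        ultimately have "p @ [(k, b)] \<in> S" using edge_connected_extensions(2)[OF S(2) a _ p(2)] by blast
        then show False using p by simp
      qed
      ultimately show "v \<in> cut_verts S (subtree V)" unfolding cut using p(2,3) by metis
    qed
  qed
  moreover have "cut_verts S (subtree V) \<subseteq> V" by (auto simp: cut_verts_def)
  ultimately show ?thesis by blast
qed

text \<open>Vertices outside the branch behind \<open>v\<close> still reach \<open>p\<close> through
  the root, while inside the branch every exit passes through the deleted \<open>v\<close>.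
  Connectedness keeps \<open>S\<close> out of the branch.\<close>

lemma separated_subtree:
  assumes V: "vertex_subset V" and S: "S \<subseteq> V" "edge_connected S"
    and v: "v \<in> V" "v = p @ [(k, b)]" "p \<in> S" "v \<notin> S"
  shows "separated (subtree V) v S = V \<inter> extensions v - {v}"
proof -
  define H where "H = with_proj (mk_symmetric (pre_digraph.del_vert (subtree V) v))"
  have verts: "verts H = V - {v}" by (simp add: H_def pre_digraph.verts_del_vert)
  have adj: "(x, y) \<in> arcs_ends H \<longleftrightarrow> x \<in> V \<and> y \<in> V \<and> x \<noteq> v \<and> y \<noteq> v \<and> (\<exists>i b. 1 \<le> i \<and> y = rmul x (i, b))" for x y
  proof
    assume "(x, y) \<in> arcs_ends H"
    then obtain u i where u: "u \<in> V" "1 \<le> i" "rmul u (i, True) \<in> V" "u \<noteq> v" "head cayley (u, i) \<noteq> v"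
      "(x, y) = (u, head cayley (u, i)) \<or> (x, y) = (head cayley (u, i), u)"
      by (auto simp: H_def parcs_mk_symmetric pre_digraph.arcs_del_vert pre_digraph.tail_del_vert pre_digraph.head_del_vert arcs_subtree[OF V])
    note r = vertex_subsetD(2)[OF V u(1)]
    show "x \<in> V \<and> y \<in> V \<and> x \<noteq> v \<and> y \<noteq> v \<and> (\<exists>i b. 1 \<le> i \<and> y = rmul x (i, b))"
    proof -
      have "\<exists>k b. 1 \<le> k \<and> u = rmul (rmul u (i, True)) (k, b)"
        using u(2) rmul_rmul[OF r, of i True] by (intro exI[of _ i] exI[of _ False]) simp
      then show ?thesis using u unfolding head_cayley[OF r] by auto
    qed
  next
    assume xy: "x \<in> V \<and> y \<in> V \<and> x \<noteq> v \<and> y \<noteq> v \<and> (\<exists>i b. 1 \<le> i \<and> y = rmul x (i, b))"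
    then obtain i b where i: "1 \<le> i" "y = rmul x (i, b)" by blast
    have r: "reduced x" "reduced y" using xy vertex_subsetD(2)[OF V] by auto
    show "(x, y) \<in> arcs_ends H"
    proof (cases b)
      case True
      then have h: "head cayley (x, i) = y" "rmul x (i, True) = y" using i head_cayley[OF r(1)] by auto
      have "(x, i) \<in> arcs (pre_digraph.del_vert (subtree V) v)"
        using xy i(1) by (simp add: pre_digraph.arcs_del_vert arcs_subtree[OF V] h)
      with h(1) show ?thesis by (force simp: H_def parcs_mk_symmetric pre_digraph.tail_del_vert pre_digraph.head_del_vert)
    next
      case False
      then have "x = rmul y (i, True)" using i rmul_rmul[OF r(1), of i False] by simp
      then have h: "head cayley (y, i) = x" "rmul y (i, True) = x" using head_cayley[OF r(2)] by auto
      have "(y, i) \<in> arcs (pre_digraph.del_vert (subtree V) v)"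
        using xy i(1) by (simp add: pre_digraph.arcs_del_vert arcs_subtree[OF V] h)
      with h(1) show ?thesis by (force simp: H_def parcs_mk_symmetric pre_digraph.tail_del_vert pre_digraph.head_del_vert)
    qed
  qed
  have reach_Nil: "[] \<rightarrow>\<^sup>*\<^bsub>H\<^esub> x" if "x \<in> V" "x \<notin> extensions v" for x
    using that
  proof (induction x rule: rev_induct)
    case Nil
    then have "[] \<in> verts H" unfolding verts by (auto simp: extensions_iff)
    then show ?case by (simp add: reachable_def rtrancl_on_refl)
  next
    case (snoc l x)
    have x: "x \<in> V" using vertex_subsetD(3)[OF V snoc.prems(1)] .
    have nx: "x \<notin> extensions v" using snoc.prems(2) by (auto simp: extensions_iff)
    have "x @ [l] \<noteq> v" "x \<noteq> v" using nx snoc.prems(2) by (auto simp: extensions_iff)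
    moreover have "x @ [l] = rmul x (fst l, snd l)"
      using vertex_subsetD(2)[OF V snoc.prems(1)] by (auto simp: reduced_snoc rmul_def)
    moreover have "1 \<le> fst l" using vertex_subsetD(1)[OF V snoc.prems(1)] by (auto simp: all_words_iff)
    ultimately have "(x, x @ [l]) \<in> arcs_ends H" unfolding adj using x snoc.prems(1) by blast
    moreover have "x @ [l] \<in> verts H" using \<open>x @ [l] \<noteq> v\<close> snoc.prems(1) unfolding verts by simp
    ultimately show ?case
      using snoc.IH[OF x nx] unfolding reachable_def by (meson rtrancl_on_into_rtrancl_on)
  qed
  have sym: "symmetric H"
    unfolding H_def by (rule symmetric_mk_symmetric)
  have pv: "p \<notin> extensions v" using v(2) by (auto simp: extensions_iff)
  have p: "p \<in> V" using S(1) v(3) by blast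
  have 1: "x \<rightarrow>\<^sup>*\<^bsub>H\<^esub> p" if "x \<in> V" "x \<notin> extensions v" for x
  proof -
    have "x \<rightarrow>\<^sup>*\<^bsub>H\<^esub> []" using symmetric_reachable[OF sym reach_Nil[OF that]] .
    then show ?thesis using reach_Nil[OF p pv] unfolding reachable_def by (rule rtrancl_on_trans)
  qed
  have 2: "y \<in> extensions v" if "x \<rightarrow>\<^sup>*\<^bsub>H\<^esub> y" "x \<in> extensions v" for x y
    using that unfolding reachable_def
  proof (induction rule: rtrancl_on_induct)
    case (step y z)
    then have z: "y \<noteq> v" "\<exists>l. z = rmul y l" unfolding adj by auto
    show ?case
    proof (rule ccontr)
      assume "z \<notin> extensions v"
      then show False using leave_extensions[of y v _ p "(k, b)"] step z v(2) by blast
    qed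
  qed
  have 3: "y \<notin> extensions v" if "y \<in> S" for y
    using edge_connected_extensions(2)[OF S(2) that _ v(3)] v(2,4) pv by blast
  show ?thesis
  proof (intro set_eqI iffI)
    fix x assume "x \<in> separated (subtree V) v S"
    then have "x \<in> V" "x \<noteq> v" "\<forall>y\<in>S. \<not> x \<rightarrow>\<^sup>*\<^bsub>H\<^esub> y" by (auto simp: separated_def H_def)
    then show "x \<in> V \<inter> extensions v - {v}" using 1 v(3) by blast
  next
    fix x assume x: "x \<in> V \<inter> extensions v - {v}"
    then have "\<forall>y\<in>S. \<not> x \<rightarrow>\<^sup>*\<^bsub>H\<^esub> y" using 2 3 by blast
    then show "x \<in> separated (subtree V) v S" using x by (simp add: separated_def H_def)
  qed
qed

text \<open>Each cut vertex takes its whole branch with it, so a word survives exactly if none of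
  its prefixes is a cut vertex.\<close>

lemma prune_subtree:
  assumes V: "vertex_subset V" and S: "S \<subseteq> V" "edge_connected S"
    and root: "\<And>p k b. p \<notin> S \<Longrightarrow> p @ [(k, b)] \<in> S \<Longrightarrow> k \<in> {1, 2}"
  shows "prune S (subtree V) = subtree {x \<in> V. \<forall>p k b y. x = p @ (k, b) # y \<longrightarrow> k \<notin> {1, 2} \<longrightarrow> p \<in> S \<longrightarrow> p @ [(k, b)] \<in> S}"
    (is "_ = subtree ?W")
proof -
  have cut: "cut_verts S (subtree V) = {v \<in> V. \<exists>p k b. v = p @ [(k, b)] \<and> p \<in> S \<and> v \<notin> S \<and> k \<notin> {1, 2}}"
    by (rule cut_verts_subtree[OF V S root])
  have ins: "insert v (separated (subtree V) v S) = V \<inter> extensions v" if c: "v \<in> cut_verts S (subtree V)" for v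
  proof -
    obtain p k b where "v \<in> V" "v = p @ [(k, b)]" "p \<in> S" "v \<notin> S" using c unfolding cut by blast
    then have "separated (subtree V) v S = V \<inter> extensions v - {v}" "v \<in> V \<inter> extensions v"
      using separated_subtree[OF V S] by (auto simp: extensions_iff)
    then show ?thesis by blast
  qed
  have "V - (\<Union>v\<in>cut_verts S (subtree V). insert v (separated (subtree V) v S)) = ?W"
  proof (intro set_eqI iffI)
    fix x assume x: "x \<in> V - (\<Union>v\<in>cut_verts S (subtree V). insert v (separated (subtree V) v S))"
    have "p @ [(k, b)] \<in> S" if p: "x = p @ (k, b) # y" "k \<notin> {1, 2}" "p \<in> S" for p k b y
    proof (rule ccontr)
      assume n: "p @ [(k, b)] \<notin> S"
      have "p @ [(k, b)] \<in> V" using vertex_subsetD(3)[OF V, of "p @ [(k, b)]" y] x p(1) by simp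
      then have c: "p @ [(k, b)] \<in> cut_verts S (subtree V)" unfolding cut using p n by blast
      have "x \<in> V \<inter> extensions (p @ [(k, b)])" using x p(1) by (auto simp: extensions_iff)
      then show False using x c ins[OF c] by blast
    qed
    then show "x \<in> ?W" using x by blast
  next
    fix x assume x: "x \<in> ?W"
    have "x \<notin> insert v (separated (subtree V) v S)" if c: "v \<in> cut_verts S (subtree V)" for v
    proof
      assume "x \<in> insert v (separated (subtree V) v S)"
      then have "x \<in> extensions v" using ins[OF c] by blast
      moreover obtain p k b where p: "v = p @ [(k, b)]" "p \<in> S" "v \<notin> S" "k \<notin> {1, 2}" using c unfolding cut by blast
      ultimately obtain y where "x = p @ (k, b) # y" by (auto simp: extensions_iff)
      then show False using x p by blast
    qed
    then show "x \<in> V - (\<Union>v\<in>cut_verts S (subtree V). insert v (separated (subtree V) v S))" using x by blast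
  qed
  then show ?thesis
    unfolding prune_def by (simp add: subtree_restrict)
qed

context word_list begin

text \<open>The vertices cut off by \<open>Y\<^sub>i\<close> are those for which the path from the root leaves \<open>Y\<^sub>i\<close> through an
  edge with a label other than \<open>a\<^sub>1\<close> and \<open>a\<^sub>2\<close>.\<close>

definition pruned :: "nat set \<Rightarrow> word set" where
  "pruned I = {x \<in> all_words. reduced x \<and> (\<forall>i\<in>I. \<forall>p k b y. x = p @ (k, b) # y \<longrightarrow> k \<notin> {1, 2} \<longrightarrow>
      p \<in> Y_set w i \<longrightarrow> p @ [(k, b)] \<in> Y_set w i)}"

lemma prunedD:
  assumes "x \<in> pruned I"
  shows "x \<in> all_words" "reduced x"
    "i \<in> I \<Longrightarrow> x = p @ (k, b) # y \<Longrightarrow> k \<notin> {1, 2} \<Longrightarrow> p \<in> Y_set w i \<Longrightarrow> p @ [(k, b)] \<in> Y_set w i"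
  using assms unfolding pruned_def by blast+

lemma vertex_subset_pruned: "vertex_subset (pruned I)"
  unfolding vertex_subset_def
proof (intro conjI allI impI)
  show "pruned I \<subseteq> {v \<in> all_words. reduced v}" unfolding pruned_def by blast
  fix u v assume uv: "u @ v \<in> pruned I"
  have "p @ [(k, b)] \<in> Y_set w i" if "i \<in> I" "u = p @ (k, b) # y" "k \<notin> {1, 2}" "p \<in> Y_set w i" for i p k b y
    using prunedD(3)[OF uv that(1) _ that(3,4), of b "y @ v"] that(2) by simp
  moreover have "u \<in> all_words" "reduced u"
    using prunedD(1,2)[OF uv] reduced_appendD by (auto simp: all_words_iff)
  ultimately show "u \<in> pruned I" unfolding pruned_def by blast
qed

lemma Y_all_words: "x \<in> Y_set w j \<Longrightarrow> 1 \<le> j \<Longrightarrow> x \<in> all_words"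
  using Y_letters(1) by (auto simp: all_words_iff)

text \<open>By \<open>Y_convex\<close>, pruning around one \<open>Y_set w i\<close> does not damage
  another, so each stage still contains the set around which the next one prunes.\<close>

lemma Y_subset_pruned:
  assumes "1 \<le> j" "I \<subseteq> {1..}"
  shows "Y_set w j \<subseteq> pruned I"
proof
  fix x assume x: "x \<in> Y_set w j"
  have "p @ [(k, b)] \<in> Y_set w i" if "i \<in> I" "x = p @ (k, b) # y" "k \<notin> {1, 2}" "p \<in> Y_set w i" for i p k b y
    using Y_convex[OF x assms(1) that(4) _ that(2,3)] assms(2) that(1) by auto
  then show "x \<in> pruned I" unfolding pruned_def using Y_all_words[OF x assms(1)] Y_reduced[OF x] by blast
qed

lemma Gamma_eq: "Gamma w j = subtree (pruned {1..j})"
proof (induction j)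
  case 0
  have "pruned {1..0} = {v \<in> all_words. reduced v}" by (simp add: pruned_def)
  then show ?case using subtree_UNIV by simp
next
  case (Suc j)
  have "Gamma w (Suc j) = prune (Y_set w (Suc j)) (subtree (pruned {1..j}))"
    by (simp add: Suc)
  also have "\<dots> = subtree {x \<in> pruned {1..j}. \<forall>p k b y. x = p @ (k, b) # y \<longrightarrow> k \<notin> {1, 2} \<longrightarrow>
      p \<in> Y_set w (Suc j) \<longrightarrow> p @ [(k, b)] \<in> Y_set w (Suc j)}"
  proof (rule prune_subtree[OF vertex_subset_pruned])
    show "Y_set w (Suc j) \<subseteq> pruned {1..j}" by (rule Y_subset_pruned) auto
    show "edge_connected (Y_set w (Suc j))" by (rule Y_connected) simp
  qed (use Y_root[of "Suc j"] in auto)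
  also have "{x \<in> pruned {1..j}. \<forall>p k b y. x = p @ (k, b) # y \<longrightarrow> k \<notin> {1, 2} \<longrightarrow>
      p \<in> Y_set w (Suc j) \<longrightarrow> p @ [(k, b)] \<in> Y_set w (Suc j)} = pruned {1..Suc j}"
  proof -
    have "{1..Suc j} = insert (Suc j) {1..j}" by auto
    then show ?thesis unfolding pruned_def by (simp only: ball_simps mem_Collect_eq conj_ac)
  qed
  finally show ?case .
qed

lemma Inter_pruned: "(\<Inter>j. pruned {1..j}) = pruned {1..}"
proof
  show "(\<Inter>j. pruned {1..j}) \<subseteq> pruned {1..}"
  proof
    fix x assume x: "x \<in> (\<Inter>j. pruned {1..j})"
    have "p @ [(k, b)] \<in> Y_set w i" if "i \<in> {1..}" "x = p @ (k, b) # y" "k \<notin> {1, 2}" "p \<in> Y_set w i" for i p k b y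
      using prunedD(3)[of x "{1..i}" i p k b y] x that by auto
    moreover have "x \<in> pruned {1..0}" using x by blast
    ultimately show "x \<in> pruned {1..}" unfolding pruned_def by blast
  qed
  show "pruned {1..} \<subseteq> (\<Inter>j. pruned {1..j})" unfolding pruned_def by fastforce
qed

abbreviation "V_inf \<equiv> pruned {1..}"

lemma Gamma_inf_eq: "Gamma_inf w = subtree V_inf"
proof -
  have "(\<Inter>j. arcs (Gamma w j)) = arcs (subtree V_inf)"
    unfolding Gamma_eq arcs_subtree[OF vertex_subset_pruned] unfolding Inter_pruned[symmetric] by auto
  then show ?thesis
    unfolding Gamma_inf_def Gamma_eq by (intro pre_digraph.equality) (simp_all add: Inter_pruned[unfolded One_nat_def])
qed

lemma V_inf_Y:
  assumes "p @ (k, b) # y \<in> V_inf" "k \<notin> {1, 2}" "p \<in> Y_set w j" "1 \<le> j"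
  shows "p @ [(k, b)] \<in> Y_set w j"
  using prunedD(3)[OF assms(1) _ refl assms(2,3)] assms(4) by simp

text \<open>After pruning, an edge with a large label that leads away from the root stays inside
  \<open>Y_set w j\<close>; an edge towards the root is labeled by the last letter of
  \<open>u\<close>.\<close>

lemma V_inf_label_bound:
  assumes u: "u \<in> Y_set w j" "1 \<le> j" and v: "rmul u (i, b) \<in> V_inf"
  shows "i \<le> n_of w j"
proof (cases "i \<in> {1, 2}")
  case True
  then show ?thesis using n_of[OF u(2)] by auto
next
  case False
  show ?thesis
  proof (cases rule: rmul_cases[of u "(i, b)"])
    case app
    then have "u @ [(i, b)] \<in> Y_set w j" using V_inf_Y[of u i b "[]" j] v u False by simp
    then show ?thesis using Y_letters(2)[OF _ u(2), of _ "(i, b)"] by simp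
  next
    case del
    then have "(i, \<not> b) \<in> set u" by (metis in_set_conv_decomp inv_letter_def fst_conv snd_conv)
    then show ?thesis using Y_letters(2)[OF u, of "(i, \<not> b)"] by simp
  qed
qed

text \<open>Next to a vertex outside all \<open>Y_set w j\<close> nothing is pruned behind it,
  whereas inside one of them the labels are bounded.\<close>

lemma infinite_valence_iff:
  assumes u: "u \<in> V_inf"
  shows "infinite_valence (Gamma_inf w) u \<longleftrightarrow> (\<forall>j\<ge>1. u \<notin> Y_set w j)"
proof
  let ?G = "subtree V_inf"
  note arcs = arcs_subtree[OF vertex_subset_pruned]
  note r = prunedD(2)[OF u]
  assume inf: "infinite_valence (Gamma_inf w) u"
  show "\<forall>j\<ge>1. u \<notin> Y_set w j"
  proof (intro allI impI notI)
    fix j assume j: "1 \<le> j" and uY: "u \<in> Y_set w j"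
    have "out_arcs ?G u \<subseteq> {u} \<times> {..n_of w j}"
      using V_inf_label_bound[OF uY j] by (auto simp: out_arcs_def arcs)
    moreover have "in_arcs ?G u \<subseteq> (\<lambda>i. (rmul u (i, False), i)) ` {..n_of w j}"
    proof
      fix e assume "e \<in> in_arcs ?G u"
      then obtain v i where e: "e = (v, i)" "v \<in> V_inf" "head cayley (v, i) = u" by (auto simp: in_arcs_def arcs)
      note rv = prunedD(2)[OF e(2)]
      have v: "v = rmul u (i, False)" using e(3) rmul_rmul[OF rv, of i True] by (simp add: head_cayley[OF rv])
      then have "i \<le> n_of w j" using V_inf_label_bound[OF uY j] e(2) by blast
      then show "e \<in> (\<lambda>i. (rmul u (i, False), i)) ` {..n_of w j}" using e(1) v by blast
    qed
    ultimately have "finite (in_arcs ?G u \<union> out_arcs ?G u)"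
      by (meson finite_SigmaI finite_Un finite_atMost finite_imageI finite_subset finite.intros)
    then show False using inf by (simp add: infinite_valence_def Gamma_inf_eq)
  qed
next
  let ?G = "subtree V_inf"
  note arcs = arcs_subtree[OF vertex_subset_pruned]
  assume nY: "\<forall>j\<ge>1. u \<notin> Y_set w j"
  \<comment> \<open>Avoiding the label of the last letter turns the edge into an append, and
    infinitely many labels remain.\<close>
  have out: "(u, i) \<in> out_arcs ?G u" if i: "3 \<le> i" "u \<noteq> [] \<longrightarrow> i \<noteq> fst (last u)" for i
  proof -
    have app: "rmul u (i, True) = u @ [(i, True)]" using i(2) by (auto simp: rmul_def inv_letter_def)
    have "u @ [(i, True)] \<in> V_inf"
      unfolding pruned_def
    proof (intro CollectI conjI ballI allI impI)
      show "reduced (u @ [(i, True)])" using reduced_rmul[OF prunedD(2)[OF u]] app by metis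
      show "u @ [(i, True)] \<in> all_words" using prunedD(1)[OF u] i(1) by (auto simp: all_words_iff)
    next
      fix j p k b y
      assume a: "j \<in> {1..}" "u @ [(i, True)] = p @ (k, b) # y" "k \<notin> {1, 2}" "p \<in> Y_set w j"
      then have "p \<noteq> u" using nY by auto
      then obtain y' where "u = p @ (k, b) # y'" using a(2) by (cases y rule: rev_cases) auto
      then show "p @ [(k, b)] \<in> Y_set w j" using prunedD(3)[OF u a(1) _ a(3,4)] by blast
    qed
    then show ?thesis using u app i(1) by (simp add: out_arcs_def arcs)
  qed
  have "(\<lambda>i. (u, i)) ` ({3..} - {fst (last u)}) \<subseteq> out_arcs ?G u"
    by (intro image_subsetI out) auto
  moreover have "infinite ((\<lambda>i. (u, i)) ` ({3..} - {fst (last u)}))"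
    by (simp add: finite_image_iff inj_on_def infinite_Ici)
  ultimately show "infinite_valence (Gamma_inf w) u"
    unfolding infinite_valence_def Gamma_inf_eq by (meson finite_Un finite_subset)
qed

text \<open>The explicit form of the vertex set of \<open>Gamma_star w\<close>: a single condition
  on letters replaces pruning, intersection and the test for infinite valence.\<close>

definition star_verts :: "word set" where
  "star_verts = {x \<in> all_words. reduced x \<and> (\<forall>p k b y. x = p @ (k, b) # y \<longrightarrow> k \<notin> {1, 2} \<longrightarrow>
      (\<exists>j\<ge>1. p \<in> Y_set w j \<and> p @ [(k, b)] \<in> Y_set w j))}"

lemma star_vertsD:
  assumes "x \<in> star_verts"
  shows "x \<in> all_words" "reduced x"
    "x = p @ (k, b) # y \<Longrightarrow> k \<notin> {1, 2} \<Longrightarrow> \<exists>j\<ge>1. p \<in> Y_set w j \<and> p @ [(k, b)] \<in> Y_set w j"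
  using assms unfolding star_verts_def by blast+

lemma vertex_subset_star: "vertex_subset star_verts"
  unfolding vertex_subset_def
proof (intro conjI allI impI)
  show "star_verts \<subseteq> {v \<in> all_words. reduced v}" unfolding star_verts_def by blast
  fix u v assume uv: "u @ v \<in> star_verts"
  have "\<exists>j\<ge>1. p \<in> Y_set w j \<and> p @ [(k, b)] \<in> Y_set w j" if "u = p @ (k, b) # y" "k \<notin> {1, 2}" for p k b y
    using star_vertsD(3)[OF uv _ that(2), of p b "y @ v"] that(1) by simp
  moreover have "u \<in> all_words" "reduced u"
    using star_vertsD(1,2)[OF uv] reduced_appendD by (auto simp: all_words_iff)
  ultimately show "u \<in> star_verts" unfolding star_verts_def by blast
qed

text \<open>A prefix of finite valence lies in some \<open>Y_set w j\<close>, where the pruning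
  condition applies. Conversely, disjointness identifies the index given by
  \<open>star_verts\<close> with the one in the pruning condition.\<close>

lemma star_verts_eq:
  "{v \<in> V_inf. \<not> (\<exists>u k b x. u \<in> V_inf \<and> infinite_valence (Gamma_inf w) u \<and> k \<notin> {1, 2} \<and> v = u @ (k, b) # x)}
    = star_verts" (is "?L = _")
proof (intro set_eqI iffI)
  fix v assume v: "v \<in> ?L"
  then have vV: "v \<in> V_inf" by blast
  have "\<exists>j\<ge>1. p \<in> Y_set w j \<and> p @ [(k, b)] \<in> Y_set w j" if p: "v = p @ (k, b) # y" "k \<notin> {1, 2}" for p k b y
  proof -
    have "p \<in> V_inf" using vertex_subsetD(3)[OF vertex_subset_pruned] vV p(1) by blast
    then have "\<not> infinite_valence (Gamma_inf w) p" using v p by blast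
    then obtain j where "1 \<le> j" "p \<in> Y_set w j" using infinite_valence_iff[OF \<open>p \<in> V_inf\<close>] by blast
    then show ?thesis using V_inf_Y vV p by blast
  qed
  then show "v \<in> star_verts" unfolding star_verts_def using prunedD(1,2)[OF vV] by blast
next
  fix v assume v: "v \<in> star_verts"
  have "p @ [(k, b)] \<in> Y_set w i" if p: "i \<in> {1..}" "v = p @ (k, b) # y" "k \<notin> {1, 2}" "p \<in> Y_set w i" for i p k b y
  proof -
    obtain j where j: "1 \<le> j" "p \<in> Y_set w j" "p @ [(k, b)] \<in> Y_set w j"
      using star_vertsD(3)[OF v p(2,3)] by blast
    have "j = i" by (rule Y_disjoint[OF j(2,1) p(4)]) (use p(1) in simp)
    then show ?thesis using j(3) by simp
  qed
  then have vV: "v \<in> V_inf" unfolding pruned_def using star_vertsD(1,2)[OF v] by blast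
  moreover have "\<not> infinite_valence (Gamma_inf w) u" if "u \<in> V_inf" "k \<notin> {1, 2}" "v = u @ (k, b) # x" for u k b x
    using star_vertsD(3)[OF v that(3,2)] infinite_valence_iff[OF that(1)] by blast
  ultimately show "v \<in> ?L" by blast
qed

lemma Gamma_star_eq: "Gamma_star w = subtree star_verts"
proof -
  have "verts (Gamma_inf w) = V_inf" by (simp add: Gamma_inf_eq)
  then have "Gamma_star w = subtree V_inf \<restriction> star_verts"
    unfolding Gamma_star_def by (simp only: star_verts_eq) (simp only: Gamma_inf_eq)
  moreover have "star_verts \<subseteq> V_inf" using star_verts_eq by blast
  ultimately show ?thesis by (simp add: subtree_restrict)
qed

text \<open>Appending a letter adds just the condition on that letter; when a letter is deleted, the
  condition on it was already satisfied by \<open>v\<close>.\<close>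

lemma rmul_star_iff:
  assumes v: "v \<in> star_verts" and k: "1 \<le> k"
  shows "rmul v (k, b) \<in> star_verts \<longleftrightarrow> k \<in> {1, 2} \<or> (\<exists>j\<ge>1. v \<in> Y_set w j \<and> rmul v (k, b) \<in> Y_set w j)"
proof (cases rule: rmul_cases[of v "(k, b)"])
  case app
  have r: "reduced (v @ [(k, b)])" "v @ [(k, b)] \<in> all_words"
    using app reduced_rmul[OF star_vertsD(2)[OF v]] star_vertsD(1)[OF v] k by (metis, auto simp: all_words_iff)
  have split: "v @ [(k, b)] = p @ (i, c) # y \<longleftrightarrow> (p = v \<and> i = k \<and> c = b \<and> y = []) \<or>
      (\<exists>y'. v = p @ (i, c) # y' \<and> y = y' @ [(k, b)])" for p i c y
    by (cases y rule: rev_cases) auto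
  show ?thesis
  proof
    assume "rmul v (k, b) \<in> star_verts"
    then have "v @ [(k, b)] \<in> star_verts" using app by simp
    then show "k \<in> {1, 2} \<or> (\<exists>j\<ge>1. v \<in> Y_set w j \<and> rmul v (k, b) \<in> Y_set w j)"
      using star_vertsD(3)[of "v @ [(k, b)]" v k b "[]"] app by auto
  next
    assume *: "k \<in> {1, 2} \<or> (\<exists>j\<ge>1. v \<in> Y_set w j \<and> rmul v (k, b) \<in> Y_set w j)"
    have "\<exists>j\<ge>1. p \<in> Y_set w j \<and> p @ [(i, c)] \<in> Y_set w j"
      if "v @ [(k, b)] = p @ (i, c) # y" "i \<notin> {1, 2}" for p i c y
      using that(1) unfolding split
    proof (elim disjE exE conjE)
      assume "p = v" "i = k" "c = b"
      then show ?thesis using * that(2) app(1) by auto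
    next
      fix y' assume "v = p @ (i, c) # y'"
      then show ?thesis using star_vertsD(3)[OF v _ that(2)] by blast
    qed
    then show "rmul v (k, b) \<in> star_verts" unfolding star_verts_def app(1) using r by blast
  qed
next
  case del
  then have e: "v = rmul v (k, b) @ [(k, \<not> b)]" by (simp add: inv_letter_def)
  then have "rmul v (k, b) \<in> star_verts" using vertex_subsetD(3)[OF vertex_subset_star] v by metis
  moreover have "k \<in> {1, 2} \<or> (\<exists>j\<ge>1. v \<in> Y_set w j \<and> rmul v (k, b) \<in> Y_set w j)"
    using star_vertsD(3)[OF v e] e by metis
  ultimately show ?thesis by blast
qed

text \<open>Through \<open>Y_symmetric\<close>, incoming and outgoing labels agree at each vertex,
  so one set \<open>E_labels\<close> serves both directions.\<close>

lemma rmul_star_inverse_iff: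
  assumes "v \<in> star_verts" "1 \<le> k"
  shows "rmul v (k, True) \<in> star_verts \<longleftrightarrow> rmul v (k, False) \<in> star_verts"
  unfolding rmul_star_iff[OF assms] using Y_symmetric by blast

lemma arcs_Gamma_star: "arcs (Gamma_star w) = {(u, i). u \<in> star_verts \<and> 1 \<le> i \<and> rmul u (i, True) \<in> star_verts}"
  unfolding Gamma_star_eq by (rule arcs_subtree[OF vertex_subset_star])

lemma E_labels_eq: "v \<in> star_verts \<Longrightarrow> E_labels w v = {i. 1 \<le> i \<and> rmul v (i, True) \<in> star_verts}"
  unfolding E_labels_def out_arcs_def arcs_Gamma_star by (force simp: Gamma_star_eq)

lemma Nil_in_star_verts: "[] \<in> star_verts"
  by (simp add: star_verts_def all_words_iff)

section \<open>The graph with loops\<close>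

lemma hat_graph_verts: "verts (hat_graph w) = star_verts"
  by (simp add: hat_graph_def Gamma_star_eq)

lemma hat_graph_arcs: "arcs (hat_graph w) = star_verts \<times> {1..}"
  unfolding hat_graph_def by (auto simp: arcs_Gamma_star E_labels_eq) (auto simp: Gamma_star_eq E_labels_eq)

lemma hat_graph_head:
  assumes "v \<in> star_verts" "1 \<le> i"
  shows "head (hat_graph w) (v, i) = (if rmul v (i, True) \<in> star_verts then rmul v (i, True) else v)"
  unfolding hat_graph_def using assms star_vertsD(2)[OF assms(1)]
  by (simp add: arcs_Gamma_star) (simp add: Gamma_star_eq head_cayley)

text \<open>Each label permutes the vertices, as in a covering graph of a bouquet of circles: one
  edge or loop per label starts at each vertex, and one ends there.\<close>

lemma hat_graph_head_bij:
  assumes i: "1 \<le> i"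
  shows "bij_betw (\<lambda>v. head (hat_graph w) (v, i)) star_verts star_verts"
proof (rule bij_betw_byWitness[where f' = "\<lambda>v. if rmul v (i, False) \<in> star_verts then rmul v (i, False) else v"])
  have rr: "rmul (rmul v (i, True)) (i, False) = v" "rmul (rmul v (i, False)) (i, True) = v" if "v \<in> star_verts" for v
    using rmul_rmul[OF star_vertsD(2)[OF that], of i True] rmul_rmul[OF star_vertsD(2)[OF that], of i False] by auto
  show "\<forall>v\<in>star_verts. (if rmul (head (hat_graph w) (v, i)) (i, False) \<in> star_verts
      then rmul (head (hat_graph w) (v, i)) (i, False) else head (hat_graph w) (v, i)) = v"
    using rr rmul_star_inverse_iff[OF _ i] by (auto simp: hat_graph_head[OF _ i])
  show "\<forall>v\<in>star_verts. head (hat_graph w) (if rmul v (i, False) \<in> star_verts then rmul v (i, False) else v, i) = v"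
  proof
    fix v assume v: "v \<in> star_verts"
    show "head (hat_graph w) (if rmul v (i, False) \<in> star_verts then rmul v (i, False) else v, i) = v"
      using rr(2)[OF v] v rmul_star_inverse_iff[OF v i] by (simp add: hat_graph_head[OF _ i])
  qed
qed (auto simp: hat_graph_head[OF _ i])

lemma E_labels_bound:
  assumes v: "v \<in> star_verts" and n: "2 \<le> n" and Y: "\<And>j. 1 \<le> j \<Longrightarrow> v \<in> Y_set w j \<Longrightarrow> n_of w j \<le> n"
  shows "E_labels w v \<subseteq> {1..n}"
proof
  fix i assume "i \<in> E_labels w v"
  then have i: "1 \<le> i" "rmul v (i, True) \<in> star_verts" using E_labels_eq[OF v] by auto
  then consider "i \<in> {1, 2}" | j where "1 \<le> j" "v \<in> Y_set w j" "rmul v (i, True) \<in> Y_set w j"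
    using rmul_star_iff[OF v i(1)] by blast
  then show "i \<in> {1..n}"
  proof cases
    case 1
    then show ?thesis using n by auto
  next
    case 2
    then show ?thesis using Y_rmul_label(2)[OF 2(2,1,3)] Y[OF 2(1,2)] i(1) by simp
  qed
qed

lemma ex_component_bound:
  "\<exists>n. 2 \<le> n \<and> (\<forall>j. 1 \<le> j \<longrightarrow> v \<in> Y_set w j \<longrightarrow> n_of w j \<le> n)"
proof (cases "\<exists>j\<ge>1. v \<in> Y_set w j")
  case True
  then obtain j where "1 \<le> j" "v \<in> Y_set w j" by blast
  then show ?thesis using n_of(1)[of j] Y_disjoint[of v j] by (metis order_refl)
qed auto

lemma n_vert:
  assumes v: "v \<in> star_verts"
  shows "2 \<le> n_vert w v" "E_labels w v \<subseteq> {1..n_vert w v}"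
    and "2 \<le> n \<Longrightarrow> (\<And>j. 1 \<le> j \<Longrightarrow> v \<in> Y_set w j \<Longrightarrow> n_of w j \<le> n) \<Longrightarrow> n_vert w v \<le> n"
proof -
  have "\<exists>n. 2 \<le> n \<and> E_labels w v \<subseteq> {1..n}" using ex_component_bound E_labels_bound[OF v] by metis
  then have "2 \<le> n_vert w v \<and> E_labels w v \<subseteq> {1..n_vert w v}" unfolding n_vert_def by (rule LeastI_ex)
  then show "2 \<le> n_vert w v" "E_labels w v \<subseteq> {1..n_vert w v}" by auto
  assume "2 \<le> n" "\<And>j. 1 \<le> j \<Longrightarrow> v \<in> Y_set w j \<Longrightarrow> n_of w j \<le> n"
  then have "2 \<le> n \<and> E_labels w v \<subseteq> {1..n}" using E_labels_bound[OF v] by blast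
  then show "n_vert w v \<le> n" unfolding n_vert_def by (rule Least_le)
qed

lemma hat_graph_loop:
  assumes v: "v \<in> star_verts" and i: "n_vert w v < i"
  shows "head (hat_graph w) (v, i) = v"
proof -
  have "1 \<le> i" using n_vert(1)[OF v] i by simp
  moreover have "i \<notin> E_labels w v" using n_vert(2)[OF v] i by auto
  ultimately show ?thesis using E_labels_eq[OF v] by (simp add: hat_graph_head[OF v])
qed

text \<open>\<open>C\<close> need not be connected: it is enough that no edge labeled at least 3
  leaves it and that \<open>n_vert\<close> is bounded on it. A vertex outside all
  \<open>Y_set w j\<close> carries only loops with such labels.\<close>

lemma hat_graph_component:
  assumes v: "v \<in> star_verts"
  shows "\<exists>C n. v \<in> C \<and> C \<subseteq> star_verts \<and> (\<forall>u\<in>C. n_vert w u \<le> n) \<and>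
     (\<forall>u\<in>star_verts. \<forall>i\<ge>3. u \<in> C \<longleftrightarrow> head (hat_graph w) (u, i) \<in> C)"
proof -
  \<comment> \<open>By disjointness the union has at most one member; it saves naming the
    index.\<close>
  define C where "C = (if \<exists>j\<ge>1. v \<in> Y_set w j then star_verts \<inter> (\<Union>j\<in>{j. 1 \<le> j \<and> v \<in> Y_set w j}. Y_set w j) else {v})"
  have vC: "v \<in> C" "C \<subseteq> star_verts" using v by (auto simp: C_def)
  obtain n where n: "2 \<le> n" "\<And>j. 1 \<le> j \<Longrightarrow> v \<in> Y_set w j \<Longrightarrow> n_of w j \<le> n"
    using ex_component_bound by blast
  have CY: "v \<in> Y_set w j" if u: "u \<in> C" "u \<in> Y_set w j" "1 \<le> j" for u j
  proof (cases "\<exists>j\<ge>1. v \<in> Y_set w j")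
    case True
    then obtain i where i: "1 \<le> i" "v \<in> Y_set w i" "u \<in> Y_set w i"
      using u(1) unfolding C_def if_P[OF True] by blast
    have "i = j" by (rule Y_disjoint[OF i(3,1) u(2,3)])
    then show ?thesis using i(2) by simp
  next
    case False
    then have "C = {v}" unfolding C_def by (rule if_not_P)
    then show ?thesis using u by simp
  qed
  have "n_vert w u \<le> n" if u: "u \<in> C" for u
  proof (rule n_vert(3)[OF _ n(1)])
    show "u \<in> star_verts" using u vC(2) by blast
    show "n_of w j \<le> n" if "1 \<le> j" "u \<in> Y_set w j" for j
      by (rule n(2)[OF that(1) CY[OF u that(2,1)]])
  qed
  moreover have "u \<in> C \<longleftrightarrow> head (hat_graph w) (u, i) \<in> C" if u: "u \<in> star_verts" and i: "3 \<le> i" for u i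
  proof (cases "rmul u (i, True) \<in> star_verts")
    case False
    then show ?thesis using i by (simp add: hat_graph_head[OF u])
  next
    case True
    then obtain j where j: "1 \<le> j" "u \<in> Y_set w j" "rmul u (i, True) \<in> Y_set w j"
      using rmul_star_iff[OF u, of i True] i by auto
    have "x \<in> C \<longleftrightarrow> v \<in> Y_set w j" if x: "x \<in> star_verts" "x \<in> Y_set w j" for x
    proof
      assume "v \<in> Y_set w j"
      then have ex: "\<exists>j\<ge>1. v \<in> Y_set w j" using j(1) by blast
      show "x \<in> C" unfolding C_def if_P[OF ex] using x j(1) \<open>v \<in> Y_set w j\<close> by blast
    qed (rule CY[OF _ x(2) j(1)])
    then show ?thesis using True u j i by (simp add: hat_graph_head[OF u])
  qed
  ultimately show ?thesis using vC by blast
qed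

end

section \<open>Lifting to the graph\<close>

text \<open>The lift is \<open>F\<close> followed by the inverse of \<open>p\<close> on the sheet
  \<open>W\<close> through the starting value. Allowing \<open>U \<subseteq> O'\<close> admits
  sheets of different sizes.\<close>

lemma rect_lifting_chart:
  assumes chart: "\<And>x. x \<in> K \<Longrightarrow> p x \<in> U \<Longrightarrow> \<exists>W O'. x \<in> W \<and> W \<subseteq> K \<and> W \<subseteq> topspace T \<and> U \<subseteq> O' \<and>
      homeomorphic_map (subtopology T W) (top_of_set O') p"
  shows "rect_lifting T p K U"
  unfolding rect_lifting_def lifts_on_def
proof (intro allI impI ballI)
  fix a b c d :: real and F z x
  let ?R = "{a..b} \<times> {c..d}"
  assume F: "continuous_on ?R F" "F ` ?R \<subseteq> U" and z: "z \<in> ?R" and x: "x \<in> K" "p x = F z"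
  have "p x \<in> U" using F(2) z x(2) by (metis image_subset_iff)
  then obtain W O' where W: "x \<in> W" "W \<subseteq> K" "W \<subseteq> topspace T" "U \<subseteq> O'"
    and hom: "homeomorphic_map (subtopology T W) (top_of_set O') p"
    using chart[OF x(1)] by metis
  obtain g where g: "homeomorphic_maps (subtopology T W) (top_of_set O') p g"
    using hom unfolding homeomorphic_map_maps by blast
  have contg: "continuous_map (top_of_set O') (subtopology T W) g"
    and gp: "\<And>y. y \<in> W \<Longrightarrow> g (p y) = y" and pg: "\<And>y. y \<in> O' \<Longrightarrow> p (g y) = y"
    using g W(3) unfolding homeomorphic_maps_def by auto
  have "continuous_map (top_of_set ?R) (top_of_set O') F"
    using F W(4) by (auto simp: continuous_map_in_subtopology)
  then have 1: "continuous_map (top_of_set ?R) (subtopology T W) (g \<circ> F)"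
    using contg by (rule continuous_map_compose)
  have 2: "continuous_map (top_of_set ?R) (subtopology T K) (g \<circ> F)"
    using 1 W(2) by (auto simp: continuous_map_in_subtopology)
  have "p ((g \<circ> F) y) = F y" if "y \<in> ?R" for y
  proof -
    have "F y \<in> O'" using F(2) W(4) that by (meson image_subset_iff subsetD)
    then show ?thesis by (simp add: pg)
  qed
  moreover have "(g \<circ> F) z = x" using gp[OF W(1)] x(2) by simp
  ultimately show "\<exists>G. continuous_map (top_of_set ?R) (subtopology T K) G \<and> G z = x \<and> (\<forall>y\<in>?R. p (G y) = F y)"
    using 2 by blast
qed

text \<open>The starting value selects a piece \<open>K'\<close>, and the lift never leaves it; so
  the pieces need no common bound.\<close>

lemma rect_lifting_Union:
  assumes "\<And>x. x \<in> K \<Longrightarrow> p x \<in> U \<Longrightarrow> \<exists>K'. x \<in> K' \<and> K' \<subseteq> K \<and> rect_lifting T p K' U"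
  shows "rect_lifting T p K U"
  unfolding rect_lifting_def lifts_on_def
proof (intro allI impI ballI)
  fix a b c d :: real and F z x
  let ?R = "{a..b} \<times> {c..d}"
  assume F: "continuous_on ?R F" "F ` ?R \<subseteq> U" and z: "z \<in> ?R" and x: "x \<in> K" "p x = F z"
  have "p x \<in> U" using F(2) z x(2) by (metis image_subset_iff)
  then obtain K' where K': "x \<in> K'" "K' \<subseteq> K" "rect_lifting T p K' U" using assms[OF x(1)] by metis
  then have "lifts_on T p K' ?R F" using F unfolding rect_lifting_def by simp
  then obtain G where G: "continuous_map (top_of_set ?R) (subtopology T K') G" "G z = x" "\<forall>y\<in>?R. p (G y) = F y"
    using z x(2) K'(1) unfolding lifts_on_def by metis
  have "continuous_map (top_of_set ?R) (subtopology T K) G"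
    using G(1) K'(2) by (auto simp: continuous_map_in_subtopology)
  then show "\<exists>G. continuous_map (top_of_set ?R) (subtopology T K) G \<and> G z = x \<and> (\<forall>y\<in>?R. p (G y) = F y)"
    using G by blast
qed

section \<open>Charts and the topology of the graph\<close>

context word_list begin

abbreviation target :: "word \<Rightarrow> nat \<Rightarrow> word" where
  "target u i \<equiv> head (hat_graph w) (u, i)"

lemma tail_hat_graph [simp]: "tail (hat_graph w) = fst"
  by (simp add: hat_graph_def)

lemma target_in: "u \<in> star_verts \<Longrightarrow> 1 \<le> i \<Longrightarrow> target u i \<in> star_verts"
  using hat_graph_head_bij[of i] by (rule bij_betw_apply)

lemma target_inj: "u \<in> star_verts \<Longrightarrow> v \<in> star_verts \<Longrightarrow> 1 \<le> i \<Longrightarrow> target u i = target v i \<Longrightarrow> u = v"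
  using bij_betw_imp_inj_on[OF hat_graph_head_bij] by (auto dest: inj_onD)

lemma target_surj: "v \<in> star_verts \<Longrightarrow> 1 \<le> i \<Longrightarrow> \<exists>u\<in>star_verts. target u i = v"
proof -
  assume "v \<in> star_verts" "1 \<le> i"
  then have "v \<in> (\<lambda>u. target u i) ` star_verts"
    using bij_betw_imp_surj_on[OF hat_graph_head_bij[OF \<open>1 \<le> i\<close>]] by simp
  then show ?thesis by auto
qed

lemma hat_space_iff:
  "Vertex v \<in> hat_space w \<longleftrightarrow> v \<in> star_verts"
  "Inner (u, i) t \<in> hat_space w \<longleftrightarrow> u \<in> star_verts \<and> 1 \<le> i \<and> 0 < t \<and> t < 1"
  by (auto simp: hat_space_def hat_graph_verts hat_graph_arcs)

lemma U_edge_iff: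
  "Vertex v \<notin> U_edge w e" "Inner (u, i) t \<in> U_edge w e \<longleftrightarrow> e = (u, i) \<and> 1/4 < t \<and> t < 3/4"
  by (auto simp: U_edge_def edge_param_def image_iff)

lemma U_vert_iff:
  assumes v: "v \<in> star_verts"
  shows "Vertex u \<in> U_vert w v \<longleftrightarrow> u = v"
    and "Inner (u, i) t \<in> U_vert w v \<longleftrightarrow> u \<in> star_verts \<and> 1 \<le> i \<and> 0 < t \<and> t < 1 \<and>
      (u = v \<and> t < 3/8 \<or> target u i = v \<and> 5/8 < t \<or> u = v \<and> n_vert w v < i)"
proof -
  have V: "Vertex u = edge_param w e t \<longleftrightarrow> (t = 0 \<and> fst e = u) \<or> (t = 1 \<and> head (hat_graph w) e = u)" for u e t
    by (auto simp: edge_param_def)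
  have I: "Inner e' s = edge_param w e t \<longleftrightarrow> e' = e \<and> s = t \<and> t \<noteq> 0 \<and> t \<noteq> 1" for e' s e t
    by (auto simp: edge_param_def)
  have "(v, 1) \<in> out_arcs (hat_graph w) v" using v by (simp add: out_arcs_def hat_graph_arcs)
  then have "Vertex v \<in> U_vert w v" unfolding U_vert_def by (force simp: V image_iff)
  then show "Vertex u \<in> U_vert w v \<longleftrightarrow> u = v"
    by (auto simp: U_vert_def out_arcs_def in_arcs_def image_iff V)
  \<comment> \<open>The last disjunct still asks for a loop; \<open>hat_graph_loop\<close> derives
    this from \<open>n_vert w v < i\<close>.\<close>
  have "Inner (u, i) t \<in> U_vert w v \<longleftrightarrow> u \<in> star_verts \<and> 1 \<le> i \<and> 0 < t \<and> t < 1 \<and>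
      (u = v \<and> t < 3/8 \<or> target u i = v \<and> 5/8 < t \<or> u = v \<and> target u i = v \<and> n_vert w v < i)"
  proof -
    have img: "Inner (u, i) t \<in> edge_param w e ` S \<longleftrightarrow> e = (u, i) \<and> t \<in> S \<and> t \<noteq> 0 \<and> t \<noteq> 1" for e S
      by (auto simp: image_iff I)
    show ?thesis
      unfolding U_vert_def out_arcs_def in_arcs_def Un_iff UN_iff img
      by (auto simp: hat_graph_arcs Bex_def)
  qed
  then show "Inner (u, i) t \<in> U_vert w v \<longleftrightarrow> u \<in> star_verts \<and> 1 \<le> i \<and> 0 < t \<and> t < 1 \<and>
      (u = v \<and> t < 3/8 \<or> target u i = v \<and> 5/8 < t \<or> u = v \<and> n_vert w v < i)"
    using hat_graph_loop[OF v, of i] by metis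
qed

lemma point_cases:
  obtains v where "x = Vertex v" | u i t where "x = Inner (u, i) t"
  by (cases x) auto

lemma U_vert_subset: "v \<in> star_verts \<Longrightarrow> U_vert w v \<subseteq> hat_space w"
proof
  fix x assume "v \<in> star_verts" "x \<in> U_vert w v"
  then show "x \<in> hat_space w" by (cases x rule: point_cases) (auto simp: U_vert_iff hat_space_iff)
qed

lemma U_edge_subset: "u \<in> star_verts \<Longrightarrow> 1 \<le> i \<Longrightarrow> U_edge w (u, i) \<subseteq> hat_space w"
proof
  fix x assume "u \<in> star_verts" "1 \<le> i" "x \<in> U_edge w (u, i)"
  then show "x \<in> hat_space w" by (cases x rule: point_cases) (auto simp: U_edge_iff hat_space_iff)
qed

lemma q_Inner_nonzero:
  assumes "Inner (u, i) t \<in> hat_space w"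
  shows "q (Inner (u, i) t) \<noteq> (0, 0)"
  using loop_param_nonzero(2) assms by (simp add: hat_space_iff)

lemma q_Inner_eq_iff:
  assumes "Inner (u, i) t \<in> hat_space w" "Inner (u', i') t' \<in> hat_space w"
  shows "q (Inner (u, i) t) = q (Inner (u', i') t') \<longleftrightarrow> i = i' \<and> t = t'"
  using loop_param_eq_iff assms by (simp add: hat_space_iff)

lemma q_eq_cases:
  assumes "x \<in> hat_space w" "y \<in> hat_space w" "q x = q y"
  obtains u v where "x = Vertex u" "y = Vertex v" "u \<in> star_verts" "v \<in> star_verts"
  | u v i t where "x = Inner (u, i) t" "y = Inner (v, i) t" "u \<in> star_verts" "v \<in> star_verts"
      "1 \<le> i" "0 < t" "t < 1"
proof (cases x rule: point_cases)
  case x: (1 u)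
  show ?thesis
  proof (cases y rule: point_cases)
    case (1 v)
    then show ?thesis using that(1) x assms by (simp add: hat_space_iff)
  next
    case (2 v i t)
    then show ?thesis using q_Inner_nonzero[of v i t] x assms by simp
  qed
next
  case x: (2 u i t)
  show ?thesis
  proof (cases y rule: point_cases)
    case (1 v)
    then show ?thesis using q_Inner_nonzero[of u i t] x assms by simp
  next
    case (2 v i' t')
    then have "i = i'" "t = t'" using q_Inner_eq_iff[of u i t v i' t'] x assms by auto
    then show ?thesis using that(2)[of u i t v] 2 x assms by (simp add: hat_space_iff)
  qed
qed

text \<open>The ranges below 3/8 and above 5/8 exclude each other, and an edge with label above
  \<open>n_vert w v\<close> is a loop. So both edges start at \<open>v\<close> or both end there,
  and \<open>target\<close> is injective for a fixed label.\<close>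

lemma U_vert_Inner_unique:
  assumes v: "v \<in> star_verts" and "Inner (u, i) t \<in> U_vert w v" "Inner (u', i) t \<in> U_vert w v"
  shows "u = u'"
proof -
  have *: "u \<in> star_verts" "u' \<in> star_verts" "1 \<le> i"
    "u = v \<and> t < 3/8 \<or> target u i = v \<and> 5/8 < t \<or> u = v \<and> n_vert w v < i"
    "u' = v \<and> t < 3/8 \<or> target u' i = v \<and> 5/8 < t \<or> u' = v \<and> n_vert w v < i"
    using assms by (auto simp: U_vert_iff)
  show ?thesis
  proof (cases "target u i = v \<and> target u' i = v")
    case True
    then show ?thesis using target_inj[OF *(1-3)] by simp
  next
    case False
    then show ?thesis using *(4,5) hat_graph_loop[OF v, of i] by auto
  qed
qed

lemma inj_on_U_vert: "v \<in> star_verts \<Longrightarrow> inj_on q (U_vert w v)"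
proof (rule inj_onI)
  fix x y assume v: "v \<in> star_verts" and xy: "x \<in> U_vert w v" "y \<in> U_vert w v" "q x = q y"
  then have "x \<in> hat_space w" "y \<in> hat_space w" using U_vert_subset by blast+
  then show "x = y" using xy(3)
  proof (cases rule: q_eq_cases)
    case 1
    then show ?thesis using xy v by (simp add: U_vert_iff)
  next
    case 2
    then show ?thesis using U_vert_Inner_unique[OF v] xy by simp
  qed
qed

lemma inj_on_U_edge: "u \<in> star_verts \<Longrightarrow> 1 \<le> i \<Longrightarrow> inj_on q (U_edge w (u, i))"
proof (rule inj_onI)
  fix x y assume u: "u \<in> star_verts" "1 \<le> i" and xy: "x \<in> U_edge w (u, i)" "y \<in> U_edge w (u, i)" "q x = q y"
  then have "x \<in> hat_space w" "y \<in> hat_space w" using U_edge_subset by blast+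
  then show "x = y" using xy(3) by (cases rule: q_eq_cases) (use xy in \<open>auto simp: U_edge_iff\<close>)
qed

lemma q_U_edge: "q ` U_edge w (u, i) = U_arc i"
  by (simp add: U_edge_def U_arc_def image_image q_edge_param)

lemma q_U_vert:
  assumes v: "v \<in> star_verts"
  shows "q ` U_vert w v = U_inf (n_vert w v + 1)"
proof (intro set_eqI iffI)
  fix p assume "p \<in> q ` U_vert w v"
  then obtain x where x: "x \<in> U_vert w v" "p = q x" by blast
  then show "p \<in> U_inf (n_vert w v + 1)"
  proof (cases x rule: point_cases)
    case 1
    then show ?thesis using x zero_in_U_inf by simp
  next
    case (2 u i t)
    then show ?thesis using x loop_param_in_U_inf_iff[of "n_vert w v + 1" i t] v by (auto simp: U_vert_iff)
  qed
next
  fix p assume p: "p \<in> U_inf (n_vert w v + 1)"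
  then have "p \<in> hawaiian" using U_inf_eq[of "n_vert w v + 1"] by auto
  then show "p \<in> q ` U_vert w v"
  proof (cases rule: hawaiian_cases)
    case 1
    then show ?thesis using v by (intro image_eqI[of _ _ "Vertex v"]) (auto simp: U_vert_iff)
  next
    case (2 i t)
    then consider "n_vert w v < i \<or> t < 3/8" | "5/8 < t"
      using p loop_param_in_U_inf_iff[of "n_vert w v + 1" i t] by auto
    then show ?thesis
    proof cases
      case 1
      then have "Inner (v, i) t \<in> U_vert w v" using v 2 by (auto simp: U_vert_iff)
      then show ?thesis using 2 by (intro image_eqI[of _ _ "Inner (v, i) t"]) auto
    next
      case right: 2
      obtain u where "u \<in> star_verts" "target u i = v" using target_surj[OF v 2(1)] by blast
      then have "Inner (u, i) t \<in> U_vert w v" using v 2 right by (auto simp: U_vert_iff)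
      then show ?thesis using 2 by (intro image_eqI[of _ _ "Inner (u, i) t"]) auto
    qed
  qed
qed

text \<open>The bounds 3/8 and 5/8 leave a gap on edges between distinct vertices, and entire edges
  belong to a chart only if they are loops.\<close>

lemma U_vert_disjoint:
  assumes "u \<in> star_verts" "v \<in> star_verts" "u \<noteq> v"
  shows "U_vert w u \<inter> U_vert w v = {}"
proof -
  have False if x: "x \<in> U_vert w u" "x \<in> U_vert w v" for x
  proof (cases x rule: point_cases)
    case 1
    then show ?thesis using x assms by (simp add: U_vert_iff)
  next
    case (2 a i t)
    then show ?thesis
      using x assms hat_graph_loop[OF assms(1), of i] hat_graph_loop[OF assms(2), of i] by (auto simp: U_vert_iff)
  qed
  then show ?thesis by blast
qed

lemma openin_q_U_edge_U_vert:
  assumes "u \<in> star_verts" "1 \<le> i" "v \<in> star_verts"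
  shows "openin (top_of_set hawaiian) (q ` (U_edge w (u, i) \<inter> U_vert w v))"
proof -
  define S where "S = {t::real. 1/4 < t \<and> t < 3/4 \<and> (u = v \<and> t < 3/8 \<or> target u i = v \<and> 5/8 < t \<or> u = v \<and> n_vert w v < i)}"
  have "U_edge w (u, i) \<inter> U_vert w v = Inner (u, i) ` S"
  proof (intro set_eqI)
    fix x
    show "x \<in> U_edge w (u, i) \<inter> U_vert w v \<longleftrightarrow> x \<in> Inner (u, i) ` S"
      using assms by (cases x rule: point_cases) (auto simp: U_edge_iff U_vert_iff S_def)
  qed
  then have "q ` (U_edge w (u, i) \<inter> U_vert w v) = loop_param i ` S"
    by (simp add: image_image)
  moreover have "open S" unfolding S_def
    by (intro open_Collect_conj open_Collect_disj open_Collect_less open_Collect_const continuous_intros)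
  moreover have "S \<subseteq> {0<..<1}" by (auto simp: S_def)
  ultimately show ?thesis using openin_loop_param_image[OF assms(2)] by simp
qed

text \<open>One index type for both kinds of charts lets the general atlas lemmas apply.\<close>

definition chart :: "edge + word \<Rightarrow> point set" where
  "chart c = (case c of Inl e \<Rightarrow> U_edge w e | Inr v \<Rightarrow> U_vert w v)"

definition chart_index :: "(edge + word) set" where
  "chart_index = Inl ` (star_verts \<times> {1..}) \<union> Inr ` star_verts"

lemma chart_index_cases:
  assumes "c \<in> chart_index"
  obtains u i where "c = Inl (u, i)" "u \<in> star_verts" "1 \<le> i" | v where "c = Inr v" "v \<in> star_verts"
  using assms unfolding chart_index_def by auto

lemma inj_on_chart: "c \<in> chart_index \<Longrightarrow> inj_on q (chart c)"
  by (erule chart_index_cases) (auto simp: chart_def inj_on_U_edge inj_on_U_vert)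

lemma openin_q_chart: "c \<in> chart_index \<Longrightarrow> openin (top_of_set hawaiian) (q ` chart c)"
  by (erule chart_index_cases) (auto simp: chart_def q_U_edge q_U_vert openin_U_arc openin_U_inf)

lemma openin_q_chart_Int:
  assumes "c \<in> chart_index" "d \<in> chart_index"
  shows "openin (top_of_set hawaiian) (q ` (chart c \<inter> chart d))"
proof (cases "c = d")
  case True
  then show ?thesis using openin_q_chart assms by simp
next
  case ne: False
  from assms(1) show ?thesis
  proof (cases rule: chart_index_cases)
    case c: (1 u i)
    from assms(2) show ?thesis
    proof (cases rule: chart_index_cases)
      case (1 v k)
      have "x \<notin> chart c \<inter> chart d" for x
        using c 1 ne by (cases x rule: point_cases) (auto simp: chart_def U_edge_iff)
      then have "chart c \<inter> chart d = {}" by blast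
      then show ?thesis by (metis image_empty openin_empty)
    next
      case (2 v)
      then show ?thesis using c openin_q_U_edge_U_vert by (simp add: chart_def)
    qed
  next
    case c: (2 u)
    from assms(2) show ?thesis
    proof (cases rule: chart_index_cases)
      case (1 v k)
      then show ?thesis using c openin_q_U_edge_U_vert by (simp add: chart_def Int_commute)
    next
      case (2 v)
      then have "chart c \<inter> chart d = {}" using c ne U_vert_disjoint by (auto simp: chart_def)
      then show ?thesis by (metis image_empty openin_empty)
    qed
  qed
qed

lemma chart_cover:
  assumes "x \<in> hat_space w"
  shows "\<exists>c\<in>chart_index. x \<in> chart c"
proof (cases x rule: point_cases)
  case (1 v)
  then show ?thesis using assms
    by (intro bexI[of _ "Inr v"]) (auto simp: chart_def chart_index_def hat_space_iff U_vert_iff)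
next
  case (2 u i t)
  then have u: "u \<in> star_verts" "1 \<le> i" "0 < t" "t < 1" using assms by (auto simp: hat_space_iff)
  consider "t < 3/8" | "5/8 < t" | "1/4 < t" "t < 3/4" by linarith
  then show ?thesis
  proof cases
    case 1
    then show ?thesis using 2 u
      by (intro bexI[of _ "Inr u"]) (auto simp: chart_def chart_index_def U_vert_iff)
  next
    case right: 2
    then show ?thesis using 2 u target_in[OF u(1,2)]
      by (intro bexI[of _ "Inr (target u i)"]) (auto simp: chart_def chart_index_def U_vert_iff)
  next
    case 3
    then show ?thesis using 2 u
      by (intro bexI[of _ "Inl (u, i)"]) (auto simp: chart_def chart_index_def U_edge_iff)
  qed
qed

lemma Union_chart: "(\<Union>c\<in>chart_index. chart c) = hat_space w"
proof
  show "(\<Union>c\<in>chart_index. chart c) \<subseteq> hat_space w"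
  proof
    fix x assume "x \<in> (\<Union>c\<in>chart_index. chart c)"
    then obtain c where c: "c \<in> chart_index" "x \<in> chart c" by blast
    from c(1) show "x \<in> hat_space w"
    proof (cases rule: chart_index_cases)
      case (1 u i)
      then show ?thesis using c(2) U_edge_subset[of u i] by (auto simp: chart_def)
    next
      case (2 v)
      then show ?thesis using c(2) U_vert_subset[of v] by (auto simp: chart_def)
    qed
  qed
qed (use chart_cover in blast)

lemma is_hat_topology_iff:
  "is_hat_topology w T \<longleftrightarrow> topspace T = (\<Union>c\<in>chart_index. chart c) \<and>
    (\<forall>c\<in>chart_index. openin T (chart c) \<and>
       homeomorphic_map (subtopology T (chart c)) (top_of_set (q ` chart c)) q)"
proof -
  have "(\<forall>c\<in>chart_index. P c) \<longleftrightarrow> (\<forall>e\<in>star_verts \<times> {1..}. P (Inl e)) \<and> (\<forall>v\<in>star_verts. P (Inr v))" for P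
    unfolding chart_index_def by blast
  then show ?thesis
    unfolding is_hat_topology_def Union_chart hat_graph_arcs hat_graph_verts
    by (simp add: chart_def q_U_edge q_U_vert)
qed

text \<open>Existence and uniqueness together justify the definite description in
  \<open>hat_topology\<close>.\<close>

lemma is_hat_topology: "is_hat_topology w (hat_topology w)"
proof -
  let ?T = "atlas_topology chart chart_index (top_of_set hawaiian) q"
  note atlas = atlas_topology_chart[where U = chart and I = chart_index and p = q and Y = "top_of_set hawaiian",
      OF inj_on_chart openin_q_chart openin_q_chart_Int]
  have "subtopology (top_of_set hawaiian) (q ` chart c) = top_of_set (q ` chart c)" if "c \<in> chart_index" for c
    using openin_subset[OF openin_q_chart[OF that]] by (simp add: subtopology_subtopology Int_absorb1)
  then have 1: "is_hat_topology w ?T" using atlas unfolding is_hat_topology_iff by simp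
  have 2: "T = ?T" if T: "is_hat_topology w T" for T
    by (rule atlas_topology_unique[where U = chart and I = chart_index and p = q and Y = "\<lambda>c. top_of_set (q ` chart c)"])
      (use T 1 in \<open>auto simp: is_hat_topology_iff\<close>)
  show ?thesis
    unfolding hat_topology_def by (rule theI[where P = "is_hat_topology w", OF 1 2])
qed

lemma topspace_hat: "topspace (hat_topology w) = hat_space w"
  using is_hat_topology by (simp add: is_hat_topology_def)

lemma openin_chart: "c \<in> chart_index \<Longrightarrow> openin (hat_topology w) (chart c)"
  using is_hat_topology by (simp add: is_hat_topology_iff)

lemma U_vert_homeomorphic:
  assumes "v \<in> star_verts"
  shows "openin (hat_topology w) (U_vert w v)"
    "homeomorphic_map (subtopology (hat_topology w) (U_vert w v)) (top_of_set (U_inf (n_vert w v + 1))) q"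
  using is_hat_topology assms by (auto simp: is_hat_topology_def hat_graph_verts)

lemma U_edge_homeomorphic:
  assumes "u \<in> star_verts" "1 \<le> i"
  shows "openin (hat_topology w) (U_edge w (u, i))"
    "homeomorphic_map (subtopology (hat_topology w) (U_edge w (u, i))) (top_of_set (U_arc i)) q"
  using is_hat_topology assms by (auto simp: is_hat_topology_def hat_graph_arcs)

lemma locally_injective:
  assumes "x \<in> topspace (hat_topology w)"
  shows "\<exists>U. openin (hat_topology w) U \<and> x \<in> U \<and> inj_on q U"
  using chart_cover[of x] assms openin_chart inj_on_chart by (auto simp: topspace_hat)

text \<open>Distinct inner points of a fibre have the same label and parameter, so charts of the
  same kind contain them: at the start vertices, at the end vertices, which differ by injectivity of
  \<open>target\<close>, or in the middle of the edges.\<close>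

lemma fibre_separated:
  assumes "x \<in> topspace (hat_topology w)" "y \<in> topspace (hat_topology w)" "q x = q y" "x \<noteq> y"
  shows "\<exists>U V. openin (hat_topology w) U \<and> openin (hat_topology w) V \<and> x \<in> U \<and> y \<in> V \<and> disjnt U V"
proof -
  have xy: "x \<in> hat_space w" "y \<in> hat_space w" using assms by (auto simp: topspace_hat)
  have *: ?thesis if "u \<in> star_verts" "v \<in> star_verts" "u \<noteq> v" "x \<in> U_vert w u" "y \<in> U_vert w v" for u v
    using U_vert_disjoint[OF that(1-3)] U_vert_homeomorphic(1) that unfolding disjnt_def by blast
  from xy assms(3) show ?thesis
  proof (cases rule: q_eq_cases)
    case (1 u v)
    then show ?thesis using *[of u v] assms(4) by (simp add: U_vert_iff)
  next
    case (2 u v i t)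
    have uv: "u \<noteq> v" using 2 assms(4) by auto
    consider "t < 3/8" | "5/8 < t" | "1/4 < t" "t < 3/4" by linarith
    then show ?thesis
    proof cases
      case 1
      then show ?thesis using *[of u v] 2 uv by (simp add: U_vert_iff)
    next
      case right: 2
      have "target u i \<noteq> target v i" using target_inj[of u v i] 2 uv by blast
      then show ?thesis using *[of "target u i" "target v i"] 2 right by (simp add: U_vert_iff target_in)
    next
      case 3
      have "z \<notin> U_edge w (u, i) \<inter> U_edge w (v, i)" for z
        using uv by (cases z rule: point_cases) (auto simp: U_edge_iff)
      then have "disjnt (U_edge w (u, i)) (U_edge w (v, i))" unfolding disjnt_def by blast
      moreover have "x \<in> U_edge w (u, i)" "y \<in> U_edge w (v, i)" using 2 3 by (auto simp: U_edge_iff)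
      ultimately show ?thesis using U_edge_homeomorphic(1) 2 by blast
    qed
  qed
qed

section \<open>Lifting over the pieces of the earring\<close>

lemma U_arc_lifting:
  assumes i: "1 \<le> i" and K: "K \<subseteq> hat_space w"
    and sub: "\<And>u t. Inner (u, i) t \<in> K \<Longrightarrow> 1/4 < t \<Longrightarrow> t < 3/4 \<Longrightarrow> U_edge w (u, i) \<subseteq> K"
  shows "rect_lifting (hat_topology w) q K (U_arc i)"
proof (rule rect_lifting_chart)
  fix x assume x: "x \<in> K" "q x \<in> U_arc i"
  show "\<exists>W O'. x \<in> W \<and> W \<subseteq> K \<and> W \<subseteq> topspace (hat_topology w) \<and> U_arc i \<subseteq> O' \<and>
      homeomorphic_map (subtopology (hat_topology w) W) (top_of_set O') q"
  proof (cases x rule: point_cases)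
    case 1
    then show ?thesis using x zero_notin_U_arc[OF i] by simp
  next
    case (2 u k t)
    have "x \<in> hat_space w" using x K by blast
    then have u: "u \<in> star_verts" "1 \<le> k" "0 < t" "t < 1" using 2 by (auto simp: hat_space_iff)
    then have t: "k = i" "1/4 < t" "t < 3/4" using x(2) 2 loop_param_in_U_arc_iff[OF i u(2-4)] by auto
    then have "x \<in> U_edge w (u, i)" using 2 by (simp add: U_edge_iff)
    moreover have "U_edge w (u, i) \<subseteq> K" using sub x 2 t by blast
    moreover have "U_edge w (u, i) \<subseteq> topspace (hat_topology w)"
      using U_edge_subset u t by (simp add: topspace_hat)
    moreover have "homeomorphic_map (subtopology (hat_topology w) (U_edge w (u, i))) (top_of_set (U_arc i)) q"
      using U_edge_homeomorphic(2) u t by simp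
    ultimately show ?thesis by blast
  qed
qed

text \<open>The part of \<open>q\<^sup>-\<^sup>1(U\<^sub>3\<^sup>\<infinity>)\<close> over a union \<open>C\<close> of components of the graph without the edges labeled
  \<open>a\<^sub>1\<close> and \<open>a\<^sub>2\<close>.\<close>

definition component_cover :: "word set \<Rightarrow> point set" where
  "component_cover C = hat_space w \<inter> (Vertex ` C \<union> {Inner (u, i) t |u i t.
     u \<in> C \<and> t < 3/8 \<or> target u i \<in> C \<and> 5/8 < t \<or> u \<in> C \<and> 3 \<le> i})"

lemma component_cover_iff:
  "Vertex v \<in> component_cover C \<longleftrightarrow> v \<in> star_verts \<and> v \<in> C"
  "Inner (u, i) t \<in> component_cover C \<longleftrightarrow> u \<in> star_verts \<and> 1 \<le> i \<and> 0 < t \<and> t < 1 \<and>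
     (u \<in> C \<and> t < 3/8 \<or> target u i \<in> C \<and> 5/8 < t \<or> u \<in> C \<and> 3 \<le> i)"
  by (auto simp: component_cover_def hat_space_iff)

lemma component_cover_U_inf_lifting:
  assumes C: "C \<subseteq> star_verts" and n: "\<And>u. u \<in> C \<Longrightarrow> n_vert w u \<le> n"
    and closed: "\<And>u i. u \<in> star_verts \<Longrightarrow> 3 \<le> i \<Longrightarrow> u \<in> C \<longleftrightarrow> target u i \<in> C"
  shows "rect_lifting (hat_topology w) q (component_cover C) (U_inf (n + 1))"
proof (rule rect_lifting_chart)
  fix x assume x: "x \<in> component_cover C" "q x \<in> U_inf (n + 1)"
  have "\<exists>v\<in>C. x \<in> U_vert w v"
  proof (cases x rule: point_cases)
    case (1 v)
    then show ?thesis using x by (intro bexI[of _ v]) (auto simp: component_cover_iff U_vert_iff)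
  next
    case (2 u i t)
    then have u: "u \<in> star_verts" "1 \<le> i" "0 < t" "t < 1"
      "u \<in> C \<and> t < 3/8 \<or> target u i \<in> C \<and> 5/8 < t \<or> u \<in> C \<and> 3 \<le> i"
      using x(1) by (auto simp: component_cover_iff)
    have "n + 1 \<le> i \<or> t < 3/8 \<or> 5/8 < t" using x(2) 2 u loop_param_in_U_inf_iff[of "n + 1" i t] by simp
    \<comment> \<open>For a label at least 3 and \<open>t\<close> beyond 5/8 the vertex chart may be
      the one at the end of the edge; \<open>closed\<close> puts this end into
      \<open>C\<close>.\<close>
    then consider "u \<in> C" "t < 3/8 \<or> n + 1 \<le> i" | "target u i \<in> C" "5/8 < t"
      using u(5) closed[OF u(1), of i] by argo
    then show ?thesis
    proof cases
      case 1
      then show ?thesis using n[of u] 2 u by (intro bexI[of _ u]) (auto simp: U_vert_iff)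
    next
      case right: 2
      then show ?thesis using 2 u C by (intro bexI[of _ "target u i"]) (auto simp: U_vert_iff subsetD)
    qed
  qed
  then obtain v where v: "v \<in> C" "x \<in> U_vert w v" by blast
  then have vV: "v \<in> star_verts" using C by blast
  \<comment> \<open>Whole loops occur in the chart for labels above
    \<open>n_vert w v \<ge> 2\<close> only, hence for labels at least 3, as
    \<open>component_cover\<close> demands.\<close>
  have "U_vert w v \<subseteq> component_cover C"
  proof
    fix y assume "y \<in> U_vert w v"
    then show "y \<in> component_cover C"
      using v(1) vV n_vert(1)[OF vV] by (cases y rule: point_cases) (auto simp: U_vert_iff component_cover_iff)
  qed
  moreover have "U_vert w v \<subseteq> topspace (hat_topology w)" using U_vert_subset[OF vV] by (simp add: topspace_hat)
  moreover have "U_inf (n + 1) \<subseteq> U_inf (n_vert w v + 1)" using n[OF v(1)] by (intro U_inf_antimono) auto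
  ultimately show "\<exists>W O'. x \<in> W \<and> W \<subseteq> component_cover C \<and> W \<subseteq> topspace (hat_topology w) \<and> U_inf (n + 1) \<subseteq> O' \<and>
      homeomorphic_map (subtopology (hat_topology w) W) (top_of_set O') q"
    using U_vert_homeomorphic(2)[OF vV] v(2) by blast
qed

lemma component_cover_U_arc_lifting:
  assumes closed: "\<And>u i. u \<in> star_verts \<Longrightarrow> 3 \<le> i \<Longrightarrow> u \<in> C \<longleftrightarrow> target u i \<in> C" and i: "3 \<le> i"
  shows "rect_lifting (hat_topology w) q (component_cover C) (U_arc i)"
proof (rule U_arc_lifting)
  fix u t assume "Inner (u, i) t \<in> component_cover C"
  then have "u \<in> star_verts" "u \<in> C" using closed i by (auto simp: component_cover_iff)
  then show "U_edge w (u, i) \<subseteq> component_cover C"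
    by (intro subsetI, rename_tac y, case_tac y rule: point_cases) (use i in \<open>auto simp: U_edge_iff component_cover_iff\<close>)
qed (use i in \<open>auto simp: component_cover_def\<close>)

text \<open>Between \<open>U_inf (n + 1)\<close> and \<open>U_inf 3\<close> only the middle arcs of
  the finitely many labels 3 to \<open>n\<close> are missing, and edges with these labels that start
  in \<open>C\<close> lie entirely in the cover.\<close>

lemma component_cover_lifting:
  assumes C: "C \<subseteq> star_verts" and n: "2 \<le> n" "\<And>u. u \<in> C \<Longrightarrow> n_vert w u \<le> n"
    and closed: "\<And>u i. u \<in> star_verts \<Longrightarrow> 3 \<le> i \<Longrightarrow> u \<in> C \<longleftrightarrow> target u i \<in> C"
  shows "rect_lifting (hat_topology w) q (component_cover C) (U_inf 3)"
proof (rule rect_lifting_cover[where \<O> = "insert (U_inf (n + 1)) (U_arc ` {3..n})", OF fibre_separated locally_injective])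
  show "U_inf 3 \<subseteq> \<Union>(insert (U_inf (n + 1)) (U_arc ` {3..n}))"
  proof
    fix p assume p: "p \<in> U_inf 3"
    then have "p \<in> hawaiian" using U_inf_subset_hawaiian[of 3] by auto
    then show "p \<in> \<Union>(insert (U_inf (n + 1)) (U_arc ` {3..n}))"
    proof (cases rule: hawaiian_cases)
      case 1
      then show ?thesis using zero_in_U_inf[of "n + 1"] by simp
    next
      case (2 i t)
      have "3 \<le> i \<or> t < 3/8 \<or> 5/8 < t" using p 2 loop_param_in_U_inf_iff[of 3 i t] by simp
      then consider "n + 1 \<le> i \<or> t < 3/8 \<or> 5/8 < t" | "i \<in> {3..n}" "1/4 < t" "t < 3/4" by fastforce
      then show ?thesis
      proof cases
        case 1
        then show ?thesis using 2 loop_param_in_U_inf_iff[of "n + 1" i t] by simp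
      next
        case 3: 2
        then have "p \<in> U_arc i" using 2 loop_param_in_U_arc_iff[of i i t] by simp
        then show ?thesis using 3(1) by blast
      qed
    qed
  qed
next
  fix O' assume O': "O' \<in> insert (U_inf (n + 1)) (U_arc ` {3..n})"
  have "U_arc i \<subseteq> U_inf 3" if "3 \<le> i" for i
  proof
    fix p assume "p \<in> U_arc i"
    then obtain t where "p = loop_param i t" "1/4 < t" "t < 3/4" by (auto simp: U_arc_def)
    then show "p \<in> U_inf 3" using loop_param_in_U_inf_iff[of 3 i t] that by simp
  qed
  moreover have "U_inf (n + 1) \<subseteq> U_inf 3" using n(1) by (intro U_inf_antimono) auto
  ultimately have "O' \<subseteq> U_inf 3" using O' by (metis (no_types, lifting) atLeastAtMost_iff image_iff insert_iff)
  moreover have "openin (top_of_set hawaiian) O'" using O' openin_U_inf openin_U_arc by auto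
  ultimately show "openin (top_of_set (U_inf 3)) O'"
    using U_inf_subset_hawaiian[of 3] by (metis openin_subset_trans one_le_numeral)
  have "rect_lifting (hat_topology w) q (component_cover C) (U_inf (n + 1))"
    by (rule component_cover_U_inf_lifting[OF C n(2) closed])
  moreover have "rect_lifting (hat_topology w) q (component_cover C) (U_arc i)" if "3 \<le> i" for i
    by (rule component_cover_U_arc_lifting[OF closed that])
  ultimately show "rect_lifting (hat_topology w) q (component_cover C) O'"
    using O' by auto
qed

text \<open>The bound \<open>n\<close> depends on the component, but \<open>U_inf 3\<close> does
  not. The component of the starting value determines \<open>n\<close>, and the lift remains in its
  cover.\<close>

lemma U_inf_3_lifting: "rect_lifting (hat_topology w) q (hat_space w) (U_inf 3)"
proof (rule rect_lifting_Union)
  fix x assume x: "x \<in> hat_space w" "q x \<in> U_inf 3"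
  have comp: "\<exists>C. v \<in> C \<and> rect_lifting (hat_topology w) q (component_cover C) (U_inf 3)" if v: "v \<in> star_verts" for v
  proof -
    obtain C n where C: "v \<in> C" "C \<subseteq> star_verts" "\<forall>u\<in>C. n_vert w u \<le> n"
      "\<forall>u\<in>star_verts. \<forall>i\<ge>3. u \<in> C \<longleftrightarrow> target u i \<in> C"
      using hat_graph_component[OF v] by blast
    have "2 \<le> n" using n_vert(1)[OF v] C(1,3) order_trans by blast
    then have "rect_lifting (hat_topology w) q (component_cover C) (U_inf 3)"
      by (rule component_cover_lifting[OF C(2)]) (use C in auto)
    then show ?thesis using C(1) by blast
  qed
  have "\<exists>v\<in>star_verts. \<forall>C. v \<in> C \<longrightarrow> x \<in> component_cover C"
  proof (cases x rule: point_cases)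
    case (1 v)
    then show ?thesis using x by (auto simp: hat_space_iff component_cover_iff)
  next
    case (2 u i t)
    then have u: "u \<in> star_verts" "1 \<le> i" "0 < t" "t < 1" using x by (auto simp: hat_space_iff)
    then have "3 \<le> i \<or> t < 3/8 \<or> 5/8 < t" using x(2) 2 loop_param_in_U_inf_iff[of 3 i t] by simp
    then consider "3 \<le> i \<or> t < 3/8" | "5/8 < t" by blast
    then show ?thesis
    proof cases
      case 1
      then show ?thesis using u 2 by (intro bexI[of _ u]) (auto simp: component_cover_iff)
    next
      case right: 2
      then show ?thesis using u 2 target_in[OF u(1,2)] by (intro bexI[of _ "target u i"]) (auto simp: component_cover_iff)
    qed
  qed
  then obtain v where v: "v \<in> star_verts" "\<And>C. v \<in> C \<Longrightarrow> x \<in> component_cover C" by blast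
  obtain C where "v \<in> C" "rect_lifting (hat_topology w) q (component_cover C) (U_inf 3)" using comp[OF v(1)] by blast
  moreover have "component_cover C \<subseteq> hat_space w" by (simp add: component_cover_def)
  ultimately show "\<exists>K'. x \<in> K' \<and> K' \<subseteq> hat_space w \<and> rect_lifting (hat_topology w) q K' (U_inf 3)"
    using v(2) by blast
qed

text \<open>The labels 1 and 2, which get arcs of their own, are the ones whose edges may join
  different components.\<close>

lemma hawaiian_lifting: "rect_lifting (hat_topology w) q (hat_space w) hawaiian"
proof (rule rect_lifting_cover[where \<O> = "{U_inf 3, U_arc 1, U_arc 2}", OF fibre_separated locally_injective])
  show "hawaiian \<subseteq> \<Union>{U_inf 3, U_arc 1, U_arc 2}"
  proof
    fix p assume "p \<in> hawaiian"
    then show "p \<in> \<Union>{U_inf 3, U_arc 1, U_arc 2}"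
    proof (cases rule: hawaiian_cases)
      case 1
      then show ?thesis using zero_in_U_inf[of 3] by simp
    next
      case (2 i t)
      then consider "p \<in> U_inf 3" | "i < 3" "1/4 < t" "t < 3/4"
        using loop_param_in_U_inf_iff[of 3 i t] by fastforce
      then show ?thesis
      proof cases
        case 3: 2
        then have "i = 1 \<or> i = 2" "p \<in> U_arc i" using 2 loop_param_in_U_arc_iff[of i i t] by auto
        then show ?thesis by blast
      qed blast
    qed
  qed
next
  have arc: "rect_lifting (hat_topology w) q (hat_space w) (U_arc i)" if "1 \<le> i" for i
    by (rule U_arc_lifting) (use that U_edge_subset in \<open>auto simp: hat_space_iff\<close>)
  fix O' assume "O' \<in> {U_inf 3, U_arc 1, U_arc 2}"
  then show "openin (top_of_set hawaiian) O'" "rect_lifting (hat_topology w) q (hat_space w) O'"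
    using openin_U_inf[of 3] openin_U_arc[of 1] openin_U_arc[of 2] U_inf_3_lifting arc[of 1] arc[of 2] by auto
qed

end

theorem proposition3p3:
  fixes w :: "nat \<Rightarrow> word" and F :: "real \<times> real \<Rightarrow> real \<times> real"
  assumes "w ` {1..} = all_words - {[]}"
    and "continuous_map (top_of_set ({0..1} \<times> {0..1})) (top_of_set hawaiian) F"
    and "F (0, 0) = (0, 0)"
  shows "\<exists>!G. G \<in> extensional ({0..1} \<times> {0..1}) \<and>
           continuous_map (top_of_set ({0..1} \<times> {0..1})) (hat_topology w) G \<and>
           G (0, 0) = Vertex [] \<and>
           (\<forall>p\<in>{0..1} \<times> {0..1}. q (G p) = F p)"
proof -
  interpret word_list w
    by unfold_locales (use assms(1) in auto)
  let ?S = "{0..1} \<times> {0..1} :: (real \<times> real) set"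
  let ?P = "\<lambda>G. G \<in> extensional ?S \<and> continuous_map (top_of_set ?S) (hat_topology w) G \<and>
    G (0, 0) = Vertex [] \<and> (\<forall>p\<in>?S. q (G p) = F p)"
  have F: "continuous_on ?S F" "F ` ?S \<subseteq> hawaiian"
    using assms(2) by (auto simp: continuous_map_in_subtopology image_subset_iff)
  have "lifts_on (hat_topology w) q (hat_space w) ?S F"
    using hawaiian_lifting F unfolding rect_lifting_def by metis
  moreover have "Vertex [] \<in> hat_space w" "q (Vertex []) = F (0, 0)" "(0, 0) \<in> ?S"
    using Nil_in_star_verts assms(3) by (auto simp: hat_space_iff)
  ultimately obtain G where G: "continuous_map (top_of_set ?S) (subtopology (hat_topology w) (hat_space w)) G"
    "G (0, 0) = Vertex []" "\<forall>y\<in>?S. q (G y) = F y"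
    unfolding lifts_on_def by metis
  \<comment> \<open>Restriction gives the lift a fixed value off the square, so that uniqueness can
    hold as an equality of functions.\<close>
  have "continuous_map (top_of_set ?S) (hat_topology w) (restrict G ?S)"
    by (rule continuous_map_eq[of _ _ G]) (use G(1) in \<open>auto simp: continuous_map_in_subtopology\<close>)
  then have ex: "?P (restrict G ?S)" using G by simp
  show ?thesis
  proof (rule ex1I[of ?P, OF ex])
    fix H assume H: "?P H"
    have cont: "continuous_map (top_of_set ?S) (hat_topology w) H"
      "continuous_map (top_of_set ?S) (hat_topology w) (restrict G ?S)" using H ex by blast+
    have conn: "Topological_Spaces.connected ?S" by (intro connected_Times connected_Icc)
    show "H = restrict G ?S"
    proof (rule extensionalityI[of _ ?S])
      fix z assume z: "z \<in> ?S"
      show "H z = restrict G ?S z"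
        by (rule unique_lift[where c = "(0, 0)", OF fibre_separated locally_injective conn cont])
          (use H ex z in auto)
    qed (use H in auto)
  qed
qed

end
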